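(* Let $F_1, F_2$ be commuting normal operators acting on a complex Hilbert space $\mathcal{L}$ such that $\sup_{z\in\overline{\mathbb{D}}}\|F_1^*+F_2z\|\le 1$. Then there exist $G_0, G_1\in\mathcal{B}(\mathcal{L})$ such that the quadruple $(T_{G_0+G_1z}, T_{F_1^*+F_2z}, T_{F_2^*+F_1z}, T_z)$ on $H^2(\mathcal{L})$ is a pure $\mathbb{H}$-isometry.
   Context: All operators are bounded linear maps on complex Hilbert spaces; $\mathcal{B}(\mathcal{L})$ is the algebra of operators on $\mathcal{L}$; $\mathbb{D}$ is the open unit disc in $\mathbb{C}$. $H^2(\mathcal{L})$ is the Hardy space of $\mathcal{L}$-valued functions on $\mathbb{D}$, and for a bounded holomorphic $\varphi:\mathbb{D}\to\mathcal{B}(\mathcal{L})$, $T_\varphi$ is the (analytic Toeplitz) operator of multiplication by $\varphi$ on $H^2(\mathcal{L})$. The tetrablock is $\mathbb{E}=\{(x_1,x_2,x_3)\in\mathbb{C}^3 : 1-x_1z_1-x_2z_2+x_3z_1z_2\neq 0 \text{ whenever } |z_1|\le 1, |z_2|\le 1\}$. The hexablock is $\mathbb{H}=\{(a,x_1,x_2,x_3)\in\mathbb{C}\times\mathbb{E} : \sup_{z_1,z_2\in\mathbb{D}}\left|\frac{a\sqrt{(1-|z_1|^2)(1-|z_2|^2)}}{1-x_1z_1-x_2z_2+x_3z_1z_2}\right|<1\}$. Its distinguished boundary $b\mathbb{H}$ is the smallest closed subset of $\overline{\mathbb{H}}$ on which every function continuous on $\overline{\mathbb{H}}$ and analytic in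 $\mathbb{H}$ attains its maximum modulus. An $\mathbb{H}$-unitary is a commuting quadruple of normal operators whose Taylor joint spectrum is contained in $b\mathbb{H}$. An $\mathbb{H}$-isometry on $\mathcal{H}$ is a commuting quadruple that is the restriction to $\mathcal{H}$ of an $\mathbb{H}$-unitary on some Hilbert space $\mathcal{K}\supseteq\mathcal{H}$ having $\mathcal{H}$ as a joint invariant subspace. An $\mathbb{H}$-isometry is pure if there is no nonzero closed joint reducing subspace on which it acts as an $\mathbb{H}$-unitary. *)

theory Defs
  imports "HOL-Analysis.Analysis"
begin

section \<open>Complex Hilbert spaces\<close>

text \<open>The inner product is linear in the first and conjugate-linear in the second argument.
  The norm is the one of the underlying real inner product \<open>Re \<langle>x, y\<rangle>\<close>.\<close>

class complex_inner = real_inner +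
  fixes scaleC :: "complex \<Rightarrow> 'a \<Rightarrow> 'a" (infixr "*\<^sub>C" 75)
    and cinner :: "'a \<Rightarrow> 'a \<Rightarrow> complex"
  assumes scaleC_add_right: "c *\<^sub>C (x + y) = c *\<^sub>C x + c *\<^sub>C y"
    and scaleC_add_left: "(c + d) *\<^sub>C x = c *\<^sub>C x + d *\<^sub>C x"
    and scaleC_scaleC: "c *\<^sub>C d *\<^sub>C x = (c * d) *\<^sub>C x"
    and scaleC_of_real: "complex_of_real r *\<^sub>C x = r *\<^sub>R x"
    and cinner_commute: "cinner x y = cnj (cinner y x)"
    and cinner_add_left: "cinner (x + y) z = cinner x z + cinner y z"
    and cinner_scaleC_left: "cinner (c *\<^sub>C x) y = c * cinner x y"
    and Re_cinner: "Re (cinner x y) = inner x y"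

class complex_hilbert = complex_inner + complete_space
begin

subclass banach ..

end

lemma cinner_self: "cinner x x = complex_of_real ((norm x)\<^sup>2)" for x :: "'a::complex_inner"
proof -
  have "Im (cinner x x) = 0"
    using cinner_commute[of x x] by (metis cnj.simps(2) equal_neg_zero)
  then show ?thesis
    by (simp add: complex_eq_iff Re_cinner power2_norm_eq_inner)
qed

lemma norm_scaleC: "norm (c *\<^sub>C x) = cmod c * norm x" for x :: "'a::complex_inner"
proof -
  have "cinner (c *\<^sub>C x) (c *\<^sub>C x) = c * cnj c * cinner x x"
    by (metis cinner_scaleC_left cinner_commute complex_cnj_mult mult.assoc)
  then have "complex_of_real ((norm (c *\<^sub>C x))\<^sup>2) = complex_of_real ((cmod c * norm x)\<^sup>2)"
    by (simp only: cinner_self complex_norm_square[symmetric] power_mult_distrib of_real_mult)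
  then have "(norm (c *\<^sub>C x))\<^sup>2 = (cmod c * norm x)\<^sup>2"
    by (simp only: of_real_eq_iff)
  then show ?thesis by (simp add: power2_eq_iff_nonneg)
qed

lemma scaleC_zero_right [simp]: "c *\<^sub>C (0::'a::complex_inner) = 0"
  using scaleC_add_right[of c 0 0] by simp

lemma Im_cinner: "Im (cinner x y) = - inner (\<i> *\<^sub>C x) y" for x :: "'a::complex_inner"
  by (simp add: Re_cinner[symmetric] cinner_scaleC_left)

lemma cmod_cinner_le: "cmod (cinner x y) \<le> norm x * norm y" for x :: "'a::complex_inner"
proof (cases "cinner x y = 0")
  case False
  define c where "c = cnj (cinner x y) / complex_of_real (cmod (cinner x y))"
  have nc: "cmod c = 1" using False by (simp add: c_def norm_divide)
  have "cinner (c *\<^sub>C x) y = complex_of_real (cmod (cinner x y))"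
    using False complex_norm_square[of "cinner x y"]
    by (simp add: cinner_scaleC_left c_def field_simps power2_eq_square)
  then have "cmod (cinner x y) = inner (c *\<^sub>C x) y"
    by (metis Re_cinner Re_complex_of_real)
  also have "\<dots> \<le> norm (c *\<^sub>C x) * norm y" by (rule norm_cauchy_schwarz)
  finally show ?thesis by (simp add: norm_scaleC nc)
qed simp


section \<open>Square-summable sequences\<close>

typedef (overloaded) 'a ell2 = "{x :: nat \<Rightarrow> 'a::complex_inner. summable (\<lambda>n. (norm (x n))\<^sup>2)}"
  by (rule exI[of _ "\<lambda>_. 0"]) simp

setup_lifting type_definition_ell2

lemma sq_add_le: "(norm (x + y))\<^sup>2 \<le> 2 * (norm x)\<^sup>2 + 2 * (norm y)\<^sup>2" for x :: "'a::real_inner"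
proof -
  have "(norm (x + y))\<^sup>2 \<le> (norm x + norm y)\<^sup>2"
    by (simp add: norm_triangle_ineq power_mono)
  also have "\<dots> \<le> 2 * (norm x)\<^sup>2 + 2 * (norm y)\<^sup>2"
    using zero_le_power2[of "norm x - norm y"] by (simp add: power2_eq_square algebra_simps)
  finally show ?thesis .
qed

lemma summable_sq_add:
  fixes x :: "nat \<Rightarrow> 'a::real_inner"
  assumes "summable (\<lambda>n. (norm (x n))\<^sup>2)" "summable (\<lambda>n. (norm (y n))\<^sup>2)"
  shows "summable (\<lambda>n. (norm (x n + y n))\<^sup>2)"
proof (rule summable_comparison_test'[where N=0])
  show "summable (\<lambda>n. 2 * (norm (x n))\<^sup>2 + 2 * (norm (y n))\<^sup>2)"
    using assms by (intro summable_add summable_mult)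
qed (simp add: sq_add_le)

lemma summable_cinner:
  fixes x :: "nat \<Rightarrow> 'a::complex_inner"
  assumes "summable (\<lambda>n. (norm (x n))\<^sup>2)" "summable (\<lambda>n. (norm (y n))\<^sup>2)"
  shows "summable (\<lambda>n. cinner (x n) (y n))"
proof (rule summable_comparison_test'[where N=0])
  show "summable (\<lambda>n. (norm (x n))\<^sup>2 + (norm (y n))\<^sup>2)"
    using assms by (intro summable_add)
  fix n
  have "cmod (cinner (x n) (y n)) \<le> norm (x n) * norm (y n)" by (rule cmod_cinner_le)
  also have "\<dots> \<le> (norm (x n))\<^sup>2 + (norm (y n))\<^sup>2"
    using sum_squares_bound[of "norm (x n)" "norm (y n)"]
      mult_nonneg_nonneg[OF norm_ge_zero[of "x n"] norm_ge_zero[of "y n"]] by linarith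
  finally show "cmod (cinner (x n) (y n)) \<le> (norm (x n))\<^sup>2 + (norm (y n))\<^sup>2" .
qed

lemma summable_inner:
  fixes x :: "nat \<Rightarrow> 'a::complex_inner"
  assumes "summable (\<lambda>n. (norm (x n))\<^sup>2)" "summable (\<lambda>n. (norm (y n))\<^sup>2)"
  shows "summable (\<lambda>n. inner (x n) (y n))"
  using summable_Re[OF summable_cinner[OF assms]] by (simp add: Re_cinner)

instantiation ell2 :: (complex_inner) real_vector
begin

lift_definition zero_ell2 :: "'a ell2" is "\<lambda>_. 0" by simp
lift_definition plus_ell2 :: "'a ell2 \<Rightarrow> 'a ell2 \<Rightarrow> 'a ell2" is "\<lambda>x y n. x n + y n"
  by (rule summable_sq_add)
lift_definition uminus_ell2 :: "'a ell2 \<Rightarrow> 'a ell2" is "\<lambda>x n. - x n" by simp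
lift_definition minus_ell2 :: "'a ell2 \<Rightarrow> 'a ell2 \<Rightarrow> 'a ell2" is "\<lambda>x y n. x n - y n"
  using summable_sq_add[of _ "\<lambda>n. - _ n"] by fastforce
lift_definition scaleR_ell2 :: "real \<Rightarrow> 'a ell2 \<Rightarrow> 'a ell2" is "\<lambda>c x n. c *\<^sub>R x n"
  by (simp add: power_mult_distrib summable_mult)

instance
proof
  fix x y z :: "'a ell2" and r s :: real
  show "x + y + z = x + (y + z)" by transfer (simp add: add.assoc)
  show "x + y = y + x" by transfer (simp add: add.commute)
  show "0 + x = x" by transfer simp
  show "- x + x = 0" by transfer simp
  show "x - y = x + - y" by transfer simp
  show "r *\<^sub>R (x + y) = r *\<^sub>R x + r *\<^sub>R y" by transfer (simp add: scaleR_add_right)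
  show "(r + s) *\<^sub>R x = r *\<^sub>R x + s *\<^sub>R x" by transfer (simp add: scaleR_add_left)
  show "r *\<^sub>R s *\<^sub>R x = (r * s) *\<^sub>R x" by transfer simp
  show "1 *\<^sub>R x = x" by transfer simp
qed

end

instantiation ell2 :: (complex_inner) complex_inner
begin

lift_definition scaleC_ell2 :: "complex \<Rightarrow> 'a ell2 \<Rightarrow> 'a ell2" is "\<lambda>c x n. c *\<^sub>C x n"
  by (simp add: norm_scaleC power_mult_distrib summable_mult)
lift_definition cinner_ell2 :: "'a ell2 \<Rightarrow> 'a ell2 \<Rightarrow> complex"
  is "\<lambda>x y. \<Sum>n. cinner (x n) (y n)" .
lift_definition inner_ell2 :: "'a ell2 \<Rightarrow> 'a ell2 \<Rightarrow> real"
  is "\<lambda>x y. \<Sum>n. inner (x n) (y n)" .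

definition norm_ell2 :: "'a ell2 \<Rightarrow> real" where "norm_ell2 x = sqrt (inner x x)"
definition sgn_ell2 :: "'a ell2 \<Rightarrow> 'a ell2" where "sgn_ell2 x = x /\<^sub>R norm x"
definition dist_ell2 :: "'a ell2 \<Rightarrow> 'a ell2 \<Rightarrow> real" where "dist_ell2 x y = norm (x - y)"
definition uniformity_ell2 :: "('a ell2 \<times> 'a ell2) filter"
  where "uniformity_ell2 = (INF e\<in>{0 <..}. principal {(x, y). dist x y < e})"
definition open_ell2 :: "'a ell2 set \<Rightarrow> bool"
  where "open_ell2 S = (\<forall>x\<in>S. \<forall>\<^sub>F (x', y) in uniformity. x' = x \<longrightarrow> y \<in> S)"

instance
proof
  fix x y z :: "'a ell2" and c d :: complex and r s :: real
  show "sgn x = x /\<^sub>R norm x" by (rule sgn_ell2_def)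
  show "dist x y = norm (x - y)" by (rule dist_ell2_def)
  show "norm x = sqrt (inner x x)" by (rule norm_ell2_def)
  show "inner x y = inner y x" by transfer (simp add: inner_commute)
  show "inner (x + y) z = inner x z + inner y z"
    by transfer (simp add: inner_add_left suminf_add summable_inner)
  show "inner (r *\<^sub>R x) y = r * inner x y"
    by transfer (simp add: suminf_mult summable_inner)
  show "0 \<le> inner x x"
    by transfer (simp add: suminf_nonneg summable_inner)
  show "inner x x = 0 \<longleftrightarrow> x = 0"
  proof (transfer, safe)
    fix x :: "nat \<Rightarrow> 'a"
    assume s: "summable (\<lambda>n. (norm (x n))\<^sup>2)" and "(\<Sum>n. x n \<bullet> x n) = 0"
    then have "\<forall>n. x n \<bullet> x n = 0"
      by (subst (asm) suminf_eq_zero_iff) (auto simp: power2_norm_eq_inner)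
    then show "x = (\<lambda>_. 0)" by auto
  qed simp
  show "c *\<^sub>C (x + y) = c *\<^sub>C x + c *\<^sub>C y" by transfer (simp add: scaleC_add_right)
  show "(c + d) *\<^sub>C x = c *\<^sub>C x + d *\<^sub>C x" by transfer (simp add: scaleC_add_left)
  show "c *\<^sub>C d *\<^sub>C x = (c * d) *\<^sub>C x" by transfer (simp add: scaleC_scaleC)
  show "complex_of_real r *\<^sub>C x = r *\<^sub>R x" by transfer (simp add: scaleC_of_real)
  show "cinner x y = cnj (cinner y x)"
  proof transfer
    fix x y :: "nat \<Rightarrow> 'a"
    assume "summable (\<lambda>n. (norm (x n))\<^sup>2)" "summable (\<lambda>n. (norm (y n))\<^sup>2)"
    then have "(\<lambda>n. cnj (cinner (y n) (x n))) sums cnj (\<Sum>n. cinner (y n) (x n))"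
      by (simp add: sums_cnj summable_cinner summable_sums)
    then show "(\<Sum>n. cinner (x n) (y n)) = cnj (\<Sum>n. cinner (y n) (x n))"
      by (simp add: cinner_commute[symmetric] sums_iff)
  qed
  show "cinner (x + y) z = cinner x z + cinner y z"
    by transfer (simp add: cinner_add_left suminf_add summable_cinner)
  show "cinner (c *\<^sub>C x) y = c * cinner x y"
    by transfer (simp add: cinner_scaleC_left suminf_mult summable_cinner)
  show "Re (cinner x y) = inner x y"
  proof transfer
    fix x y :: "nat \<Rightarrow> 'a"
    assume "summable (\<lambda>n. (norm (x n))\<^sup>2)" "summable (\<lambda>n. (norm (y n))\<^sup>2)"
    then have "(\<lambda>n. Re (cinner (x n) (y n))) sums Re (\<Sum>n. cinner (x n) (y n))"
      by (intro sums_Re) (simp add: summable_cinner summable_sums)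
    then show "Re (\<Sum>n. cinner (x n) (y n)) = (\<Sum>n. inner (x n) (y n))"
      by (simp add: Re_cinner sums_iff)
  qed
qed (auto simp: uniformity_ell2_def open_ell2_def)

end

lemma summable_Rep_ell2: "summable (\<lambda>n. (norm (Rep_ell2 x n))\<^sup>2)"
  using Rep_ell2[of x] by simp

lemma norm_ell2_sq: "(norm x)\<^sup>2 = (\<Sum>n. (norm (Rep_ell2 x n))\<^sup>2)" for x :: "'a::complex_inner ell2"
  by (simp add: power2_norm_eq_inner inner_ell2.rep_eq)

lemma sum_le_norm_ell2: "(\<Sum>n<N. (norm (Rep_ell2 x n))\<^sup>2) \<le> (norm x)\<^sup>2"
  unfolding norm_ell2_sq by (rule sum_le_suminf[OF summable_Rep_ell2]) auto

lemma norm_Rep_ell2_le: "norm (Rep_ell2 x n) \<le> norm x"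
proof -
  have "(norm (Rep_ell2 x n))\<^sup>2 \<le> (\<Sum>n<Suc n. (norm (Rep_ell2 x n))\<^sup>2)"
    by (simp add: sum_nonneg)
  also have "\<dots> \<le> (norm x)\<^sup>2" by (rule sum_le_norm_ell2)
  finally show ?thesis by (rule power2_le_imp_le) simp
qed

instance ell2 :: (complex_hilbert) complex_hilbert
proof
  fix X :: "nat \<Rightarrow> 'a ell2"
  assume C: "Cauchy X"
  have "Cauchy (\<lambda>k. Rep_ell2 (X k) n)" for n
  proof (rule metric_CauchyI)
    fix e :: real assume "0 < e"
    then obtain M where M: "\<forall>m\<ge>M. \<forall>k\<ge>M. dist (X m) (X k) < e"
      using metric_CauchyD[OF C] by blast
    have "dist (Rep_ell2 (X m) n) (Rep_ell2 (X k) n) \<le> dist (X m) (X k)" for m k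
      using norm_Rep_ell2_le[of "X m - X k" n] by (simp add: dist_norm minus_ell2.rep_eq)
    then show "\<exists>M. \<forall>m\<ge>M. \<forall>k\<ge>M. dist (Rep_ell2 (X m) n) (Rep_ell2 (X k) n) < e"
      using M by (meson le_less_trans)
  qed
  then have "\<forall>n. \<exists>l. (\<lambda>k. Rep_ell2 (X k) n) \<longlonglongrightarrow> l"
    by (simp add: Cauchy_convergent_iff convergent_def)
  then obtain l where l: "\<And>n. (\<lambda>k. Rep_ell2 (X k) n) \<longlonglongrightarrow> l n" by metis
  have tail: "summable (\<lambda>n. (norm (Rep_ell2 (X m) n - l n))\<^sup>2) \<and>
      (\<Sum>n. (norm (Rep_ell2 (X m) n - l n))\<^sup>2) \<le> e\<^sup>2"
    if M: "\<forall>m\<ge>M. \<forall>k\<ge>M. dist (X m) (X k) < e" and m: "m \<ge> M" for M m e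
  proof -
    have part: "(\<Sum>n<N. (norm (Rep_ell2 (X m) n - l n))\<^sup>2) \<le> e\<^sup>2" for N
    proof (rule tendsto_upperbound)
      show "(\<lambda>k. \<Sum>n<N. (norm (Rep_ell2 (X m) n - Rep_ell2 (X k) n))\<^sup>2)
          \<longlonglongrightarrow> (\<Sum>n<N. (norm (Rep_ell2 (X m) n - l n))\<^sup>2)"
        by (intro tendsto_intros l)
      have "(\<Sum>n<N. (norm (Rep_ell2 (X m) n - Rep_ell2 (X k) n))\<^sup>2) \<le> e\<^sup>2" if "k \<ge> M" for k
      proof -
        have "(\<Sum>n<N. (norm (Rep_ell2 (X m) n - Rep_ell2 (X k) n))\<^sup>2) \<le> (norm (X m - X k))\<^sup>2"
          using sum_le_norm_ell2[of "X m - X k" N] by (simp add: minus_ell2.rep_eq)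
        also have "\<dots> \<le> e\<^sup>2"
          using M m that by (intro power_mono) (auto simp: dist_norm less_imp_le)
        finally show ?thesis .
      qed
      then show "\<forall>\<^sub>F k in sequentially.
          (\<Sum>n<N. (norm (Rep_ell2 (X m) n - Rep_ell2 (X k) n))\<^sup>2) \<le> e\<^sup>2"
        using eventually_sequentially by blast
    qed simp
    have "summable (\<lambda>n. (norm (Rep_ell2 (X m) n - l n))\<^sup>2)"
      by (rule summableI_nonneg_bounded[OF _ part]) simp
    then show ?thesis using part suminf_le_const by blast
  qed
  obtain M1 where "\<forall>m\<ge>M1. \<forall>k\<ge>M1. dist (X m) (X k) < 1"
    using metric_CauchyD[OF C, of 1] by auto
  then have s1: "summable (\<lambda>n. (norm (Rep_ell2 (X M1) n - l n))\<^sup>2)" using tail by blast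
  have "summable (\<lambda>n. (norm ((l n - Rep_ell2 (X M1) n) + Rep_ell2 (X M1) n))\<^sup>2)"
    using s1 by (intro summable_sq_add summable_Rep_ell2) (simp add: norm_minus_commute)
  then have sl: "summable (\<lambda>n. (norm (l n))\<^sup>2)" by simp
  define L where "L = Abs_ell2 l"
  have RL: "Rep_ell2 L = l" using sl by (simp add: L_def Abs_ell2_inverse)
  have "X \<longlonglongrightarrow> L"
  proof (rule metric_LIMSEQ_I)
    fix r :: real assume r: "0 < r"
    then obtain M where M: "\<forall>m\<ge>M. \<forall>k\<ge>M. dist (X m) (X k) < r / 2"
      using metric_CauchyD[OF C, of "r/2"] by auto
    have "dist (X m) L < r" if "m \<ge> M" for m
    proof -
      have "(norm (X m - L))\<^sup>2 \<le> (r / 2)\<^sup>2"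
        using tail[OF M that] by (simp add: norm_ell2_sq minus_ell2.rep_eq RL)
      then have "norm (X m - L) \<le> r / 2" using r by (simp add: power2_le_iff_abs_le)
      then show ?thesis using r by (simp add: dist_norm)
    qed
    then show "\<exists>M. \<forall>m\<ge>M. dist (X m) L < r" by blast
  qed
  then show "convergent X" by (auto simp: convergent_def)
qed


section \<open>The vector-valued Hardy space\<close>

text \<open>The elements of the Hardy space are the functions on the open unit disc given by a power series
  with square-summable coefficients; as HOL functions are total, they are set to 0 off the disc.\<close>

definition is_taylor :: "'a::complex_hilbert ell2 \<Rightarrow> (complex \<Rightarrow> 'a) \<Rightarrow> bool" where
  "is_taylor a f \<longleftrightarrow>
     (\<forall>z. (cmod z < 1 \<longrightarrow> (\<lambda>n. z ^ n *\<^sub>C Rep_ell2 a n) sums f z) \<and> (\<not> cmod z < 1 \<longrightarrow> f z = 0))"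

typedef (overloaded) 'a hardy = "{f :: complex \<Rightarrow> 'a::complex_hilbert. \<exists>a. is_taylor a f}"
  by (rule exI[of _ "\<lambda>_. 0"]) (auto simp: is_taylor_def zero_ell2.rep_eq intro!: exI[of _ 0])

setup_lifting type_definition_hardy

definition hardy_coeff :: "'a::complex_hilbert hardy \<Rightarrow> 'a ell2" where
  "hardy_coeff f = (THE a. is_taylor a (Rep_hardy f))"

lemma is_taylor_add: "is_taylor a f \<Longrightarrow> is_taylor b g \<Longrightarrow> is_taylor (a + b) (\<lambda>z. f z + g z)"
  by (auto simp: is_taylor_def plus_ell2.rep_eq scaleC_add_right sums_add)

lemma bounded_linear_scaleC: "bounded_linear (\<lambda>x::'a::complex_inner. c *\<^sub>C x)"
proof (rule bounded_linear_intro)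
  show "norm (c *\<^sub>C x) \<le> norm x * cmod c" for x :: 'a by (simp add: norm_scaleC)
  show "c *\<^sub>C (r *\<^sub>R x) = r *\<^sub>R (c *\<^sub>C x)" for r and x :: 'a
    by (metis scaleC_of_real scaleC_scaleC mult.commute)
qed (rule scaleC_add_right)

lemma is_taylor_scaleC: "is_taylor a f \<Longrightarrow> is_taylor (c *\<^sub>C a) (\<lambda>z. c *\<^sub>C f z)"
proof -
  assume a: "is_taylor a f"
  have "(\<lambda>n. z ^ n *\<^sub>C c *\<^sub>C Rep_ell2 a n) sums (c *\<^sub>C f z)" if "cmod z < 1" for z
  proof -
    have "(\<lambda>n. z ^ n *\<^sub>C Rep_ell2 a n) sums f z" using a that by (simp add: is_taylor_def)
    from bounded_linear.sums[OF bounded_linear_scaleC[of c] this]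
    show ?thesis by (simp only: scaleC_scaleC mult.commute)
  qed
  with a show ?thesis by (simp add: is_taylor_def scaleC_ell2.rep_eq)
qed

lemma is_taylor_scaleR: "is_taylor a f \<Longrightarrow> is_taylor (r *\<^sub>R a) (\<lambda>z. r *\<^sub>R f z)"
  using is_taylor_scaleC[of a f "complex_of_real r"] by (simp add: scaleC_of_real)

lemma is_taylor_uminus: "is_taylor a f \<Longrightarrow> is_taylor (- a) (\<lambda>z. - f z)"
  using is_taylor_scaleR[of a f "-1"] by simp

lemma is_taylor_diff: "is_taylor a f \<Longrightarrow> is_taylor b g \<Longrightarrow> is_taylor (a - b) (\<lambda>z. f z - g z)"
  using is_taylor_add[OF _ is_taylor_uminus, of a f b g] by simp

lemma bounded_linear_cinner_left: "bounded_linear (\<lambda>x::'a::complex_inner. cinner x w)"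
proof (rule bounded_linear_intro)
  show "norm (cinner x w) \<le> norm x * norm w" for x :: 'a by (rule cmod_cinner_le)
  show "cinner (r *\<^sub>R x) w = r *\<^sub>R cinner x w" for r and x :: 'a
    by (simp add: scaleC_of_real[symmetric] cinner_scaleC_left scaleR_conv_of_real)
qed (rule cinner_add_left)

lemma is_taylor_zero_unique:
  assumes "is_taylor a f" "\<And>z. f z = 0"
  shows "a = 0"
proof -
  have "cinner (Rep_ell2 a n) w = 0" for n w
  proof -
    define F where "F = Abs_fps (\<lambda>n. cinner (Rep_ell2 a n) w)"
    have s: "(\<lambda>n. fps_nth F n * z ^ n) sums 0" if "cmod z < 1" for z
    proof -
      have "(\<lambda>n. z ^ n *\<^sub>C Rep_ell2 a n) sums 0"
        using assms that by (simp add: is_taylor_def)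
      from bounded_linear.sums[OF bounded_linear_cinner_left[of w] this]
      show ?thesis
        by (simp add: F_def cinner_scaleC_left mult.commute
            linear_0[OF bounded_linear.linear[OF bounded_linear_cinner_left]])
    qed
    have "fps_conv_radius F \<ge> 1"
      unfolding fps_conv_radius_def
    proof (rule conv_radius_geI_ex')
      fix r :: real assume "0 < r" "ereal r < 1"
      then have "cmod (of_real r) < 1" by (simp add: one_ereal_def)
      from s[OF this] show "summable (\<lambda>n. fps_nth F n * of_real r ^ n)"
        by (rule sums_summable)
    qed
    then have r: "fps_conv_radius F > 0"
      using less_le_trans[of 0 "1::ereal"] by simp
    have "F = 0"
    proof (rule eval_fps_eqD[OF r])
      have "eventually (\<lambda>z. cmod z < 1) (nhds (0::complex))"
        by (rule eventually_nhds_metric[THEN iffD2]) (auto intro!: exI[of _ 1])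
      then show "eventually (\<lambda>z. eval_fps F z = eval_fps 0 z) (nhds 0)"
        by eventually_elim (use s in \<open>auto simp: eval_fps_def sums_iff\<close>)
    qed simp
    then have "fps_nth F n = 0" by simp
    then show ?thesis by (simp add: F_def)
  qed
  then have "Rep_ell2 a n = 0" for n
    using cinner_self[of "Rep_ell2 a n"] by simp
  then have "Rep_ell2 a = Rep_ell2 0" by (simp add: fun_eq_iff zero_ell2.rep_eq)
  then show ?thesis by (simp add: Rep_ell2_inject)
qed

lemma is_taylor_unique:
  assumes "is_taylor a f" "is_taylor b f"
  shows "a = b"
proof -
  have "is_taylor (a - b) (\<lambda>z. f z - f z)"
    by (intro is_taylor_diff assms)
  then have "a - b = 0" by (rule is_taylor_zero_unique) simp
  then show ?thesis by simp
qed

lemma hardy_coeffI: "is_taylor a (Rep_hardy f) \<Longrightarrow> hardy_coeff f = a"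
  unfolding hardy_coeff_def using is_taylor_unique by blast

lemma is_taylor_hardy_coeff: "is_taylor (hardy_coeff f) (Rep_hardy f)"
proof -
  have "Rep_hardy f \<in> {f. \<exists>a. is_taylor a f}" by (rule Rep_hardy)
  then obtain a where "is_taylor a (Rep_hardy f)" by (elim CollectE exE)
  then show ?thesis using hardy_coeffI[of a f] by simp
qed

lemma ex_is_taylor: "\<exists>f. is_taylor a f"
proof -
  have "summable (\<lambda>n. z ^ n *\<^sub>C Rep_ell2 a n)" if "cmod z < 1" for z
  proof (rule summable_comparison_test'[where N=0])
    show "summable (\<lambda>n. norm a * cmod z ^ n)"
      using that by (intro summable_mult summable_geometric) simp
    show "norm (z ^ n *\<^sub>C Rep_ell2 a n) \<le> norm a * cmod z ^ n" for n
      using mult_right_mono[OF norm_Rep_ell2_le[of a n], of "cmod z ^ n"]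
      by (simp add: norm_scaleC norm_power mult.commute)
  qed
  then have "is_taylor a (\<lambda>z. if cmod z < 1 then (\<Sum>n. z ^ n *\<^sub>C Rep_ell2 a n) else 0)"
    by (simp add: is_taylor_def summable_sums)
  then show ?thesis by blast
qed

lemma hardy_coeff_surj: "\<exists>f. hardy_coeff f = a"
proof -
  obtain f where f: "is_taylor a f" using ex_is_taylor by blast
  then have "f \<in> {f. \<exists>a. is_taylor a f}" by (intro CollectI exI)
  then have "Rep_hardy (Abs_hardy f) = f" by (rule Abs_hardy_inverse)
  with f have "hardy_coeff (Abs_hardy f) = a" by (intro hardy_coeffI) simp
  then show ?thesis by (rule exI)
qed

lemma hardy_coeff_inject: "hardy_coeff f = hardy_coeff g \<longleftrightarrow> f = g"
proof
  assume e: "hardy_coeff f = hardy_coeff g"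
  have "Rep_hardy f z = Rep_hardy g z" for z
    using is_taylor_hardy_coeff[of f] is_taylor_hardy_coeff[of g] e
    by (cases "cmod z < 1") (auto simp: is_taylor_def intro: sums_unique2)
  then have "Rep_hardy f = Rep_hardy g" by (rule ext)
  then show "f = g" by (simp add: Rep_hardy_inject)
qed simp

text \<open>The vector space operations are pointwise; the inner product is
  \<open>\<langle>f, g\<rangle> = (\<Sum>n. \<langle>f\<^sub>n, g\<^sub>n\<rangle>)\<close> for the Taylor coefficients \<open>f\<^sub>n\<close> and \<open>g\<^sub>n\<close>.\<close>

instantiation hardy :: (complex_hilbert) real_vector
begin

lift_definition zero_hardy :: "'a hardy" is "\<lambda>_. 0"
  by (auto simp: is_taylor_def zero_ell2.rep_eq intro!: exI[of _ 0])
lift_definition plus_hardy :: "'a hardy \<Rightarrow> 'a hardy \<Rightarrow> 'a hardy" is "\<lambda>f g z. f z + g z"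
  by (elim exE) (rule exI, erule (1) is_taylor_add)
lift_definition uminus_hardy :: "'a hardy \<Rightarrow> 'a hardy" is "\<lambda>f z. - f z"
  by (elim exE) (rule exI, erule is_taylor_uminus)
lift_definition minus_hardy :: "'a hardy \<Rightarrow> 'a hardy \<Rightarrow> 'a hardy" is "\<lambda>f g z. f z - g z"
  by (elim exE) (rule exI, erule (1) is_taylor_diff)
lift_definition scaleR_hardy :: "real \<Rightarrow> 'a hardy \<Rightarrow> 'a hardy" is "\<lambda>c f z. c *\<^sub>R f z"
  by (elim exE) (rule exI, erule is_taylor_scaleR)

instance
proof
  fix x y z :: "'a hardy" and r s :: real
  show "x + y + z = x + (y + z)" by transfer (simp add: add.assoc)
  show "x + y = y + x" by transfer (simp add: add.commute)
  show "0 + x = x" by transfer simp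
  show "- x + x = 0" by transfer simp
  show "x - y = x + - y" by transfer simp
  show "r *\<^sub>R (x + y) = r *\<^sub>R x + r *\<^sub>R y" by transfer (simp add: scaleR_add_right)
  show "(r + s) *\<^sub>R x = r *\<^sub>R x + s *\<^sub>R x" by transfer (simp add: scaleR_add_left)
  show "r *\<^sub>R s *\<^sub>R x = (r * s) *\<^sub>R x" by transfer simp
  show "1 *\<^sub>R x = x" by transfer simp
qed

end

instantiation hardy :: (complex_hilbert) complex_inner
begin

lift_definition scaleC_hardy :: "complex \<Rightarrow> 'a hardy \<Rightarrow> 'a hardy" is "\<lambda>c f z. c *\<^sub>C f z"
  by (elim exE) (rule exI, erule is_taylor_scaleC)

definition cinner_hardy :: "'a hardy \<Rightarrow> 'a hardy \<Rightarrow> complex"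
  where "cinner_hardy f g = cinner (hardy_coeff f) (hardy_coeff g)"
definition inner_hardy :: "'a hardy \<Rightarrow> 'a hardy \<Rightarrow> real"
  where "inner_hardy f g = inner (hardy_coeff f) (hardy_coeff g)"
definition norm_hardy :: "'a hardy \<Rightarrow> real" where "norm_hardy x = sqrt (inner x x)"
definition sgn_hardy :: "'a hardy \<Rightarrow> 'a hardy" where "sgn_hardy x = x /\<^sub>R norm x"
definition dist_hardy :: "'a hardy \<Rightarrow> 'a hardy \<Rightarrow> real" where "dist_hardy x y = norm (x - y)"
definition uniformity_hardy :: "('a hardy \<times> 'a hardy) filter"
  where "uniformity_hardy = (INF e\<in>{0 <..}. principal {(x, y). dist x y < e})"
definition open_hardy :: "'a hardy set \<Rightarrow> bool"
  where "open_hardy S = (\<forall>x\<in>S. \<forall>\<^sub>F (x', y) in uniformity. x' = x \<longrightarrow> y \<in> S)"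

lemma hardy_coeff_add: "hardy_coeff (f + g) = hardy_coeff f + hardy_coeff g"
  by (rule hardy_coeffI) (simp add: plus_hardy.rep_eq is_taylor_add is_taylor_hardy_coeff)

lemma hardy_coeff_scaleC: "hardy_coeff (c *\<^sub>C f) = c *\<^sub>C hardy_coeff f"
  by (rule hardy_coeffI) (simp add: scaleC_hardy.rep_eq is_taylor_scaleC is_taylor_hardy_coeff)

lemma hardy_coeff_scaleR: "hardy_coeff (r *\<^sub>R f) = r *\<^sub>R hardy_coeff f"
  by (rule hardy_coeffI) (simp add: scaleR_hardy.rep_eq is_taylor_scaleR is_taylor_hardy_coeff)

lemma hardy_coeff_zero: "hardy_coeff 0 = 0"
  by (rule hardy_coeffI) (simp add: zero_hardy.rep_eq is_taylor_def zero_ell2.rep_eq)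

instance
proof
  fix x y z :: "'a hardy" and c d :: complex and r s :: real
  show "sgn x = x /\<^sub>R norm x" by (rule sgn_hardy_def)
  show "dist x y = norm (x - y)" by (rule dist_hardy_def)
  show "norm x = sqrt (inner x x)" by (rule norm_hardy_def)
  show "inner x y = inner y x" by (simp add: inner_hardy_def inner_commute)
  show "inner (x + y) z = inner x z + inner y z"
    by (simp add: inner_hardy_def hardy_coeff_add inner_add_left)
  show "inner (r *\<^sub>R x) y = r * inner x y"
    by (simp add: inner_hardy_def hardy_coeff_scaleR)
  show "0 \<le> inner x x" by (simp add: inner_hardy_def)
  show "inner x x = 0 \<longleftrightarrow> x = 0"
    using hardy_coeff_inject[of x 0] by (simp add: inner_hardy_def hardy_coeff_zero)
  show "c *\<^sub>C (x + y) = c *\<^sub>C x + c *\<^sub>C y" by transfer (simp add: scaleC_add_right)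
  show "(c + d) *\<^sub>C x = c *\<^sub>C x + d *\<^sub>C x" by transfer (simp add: scaleC_add_left)
  show "c *\<^sub>C d *\<^sub>C x = (c * d) *\<^sub>C x" by transfer (simp add: scaleC_scaleC)
  show "complex_of_real r *\<^sub>C x = r *\<^sub>R x" by transfer (simp add: scaleC_of_real)
  show "cinner x y = cnj (cinner y x)" by (simp add: cinner_hardy_def cinner_commute[symmetric])
  show "cinner (x + y) z = cinner x z + cinner y z"
    by (simp add: cinner_hardy_def hardy_coeff_add cinner_add_left)
  show "cinner (c *\<^sub>C x) y = c * cinner x y"
    by (simp add: cinner_hardy_def hardy_coeff_scaleC cinner_scaleC_left)
  show "Re (cinner x y) = inner x y" by (simp add: cinner_hardy_def inner_hardy_def Re_cinner)
qed (auto simp: uniformity_hardy_def open_hardy_def)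

end

lemma norm_hardy_coeff: "norm (hardy_coeff f) = norm f"
  by (simp add: norm_eq_sqrt_inner inner_hardy_def)

lemma dist_hardy_coeff: "dist (hardy_coeff f) (hardy_coeff g) = dist f g"
proof -
  have "hardy_coeff (f + (-1) *\<^sub>R g) = hardy_coeff f + (-1) *\<^sub>R hardy_coeff g"
    by (simp only: hardy_coeff_add hardy_coeff_scaleR)
  then show ?thesis by (simp add: dist_norm norm_hardy_coeff[symmetric])
qed

instance hardy :: (complex_hilbert) complex_hilbert
proof
  fix X :: "nat \<Rightarrow> 'a hardy"
  assume "Cauchy X"
  then have "Cauchy (\<lambda>n. hardy_coeff (X n))" by (simp add: Cauchy_def dist_hardy_coeff)
  then obtain l where "(\<lambda>n. hardy_coeff (X n)) \<longlonglongrightarrow> l"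
    using Cauchy_convergent convergent_def by blast
  moreover obtain f where "hardy_coeff f = l" using hardy_coeff_surj by blast
  ultimately have "X \<longlonglongrightarrow> f" by (auto simp: lim_sequentially dist_hardy_coeff)
  then show "convergent X" by (auto simp: convergent_def)
qed

text \<open>Multiplication by an operator-valued function \<open>\<phi>\<close> on the disc. The value is only meaningful
  if the product lies in the Hardy space again, as is the case for bounded holomorphic \<open>\<phi>\<close>.\<close>

definition toeplitz :: "(complex \<Rightarrow> 'a \<Rightarrow> 'a) \<Rightarrow> 'a::complex_hilbert hardy \<Rightarrow> 'a hardy" where
  "toeplitz \<phi> f = Abs_hardy (\<lambda>z. if cmod z < 1 then \<phi> z (Rep_hardy f z) else 0)"


section \<open>Operators\<close>

text \<open>Operators on a closed subspace \<open>K\<close> are represented by functions on the ambient space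
  whose values off \<open>K\<close> are irrelevant.\<close>

definition closed_csubspace :: "'a::complex_hilbert set \<Rightarrow> bool" where
  "closed_csubspace K \<longleftrightarrow> closed K \<and> subspace K \<and> (\<forall>c. \<forall>x\<in>K. c *\<^sub>C x \<in> K)"

definition operator_on :: "'a::complex_hilbert set \<Rightarrow> ('a \<Rightarrow> 'a) \<Rightarrow> bool" where
  "operator_on K T \<longleftrightarrow>
     (\<forall>x\<in>K. T x \<in> K) \<and>
     (\<forall>x\<in>K. \<forall>y\<in>K. T (x + y) = T x + T y) \<and>
     (\<forall>c. \<forall>x\<in>K. T (c *\<^sub>C x) = c *\<^sub>C T x) \<and>
     (\<exists>B. \<forall>x\<in>K. norm (T x) \<le> B * norm x)"

definition adjoint_on :: "'a::complex_hilbert set \<Rightarrow> ('a \<Rightarrow> 'a) \<Rightarrow> ('a \<Rightarrow> 'a) \<Rightarrow> bool" where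
  "adjoint_on K T S \<longleftrightarrow> operator_on K S \<and> (\<forall>x\<in>K. \<forall>y\<in>K. cinner (T x) y = cinner x (S y))"

definition cadjoint :: "('a::complex_hilbert \<Rightarrow> 'a) \<Rightarrow> 'a \<Rightarrow> 'a" where
  "cadjoint T = (THE S. adjoint_on UNIV T S)"

definition commute_on :: "'a set \<Rightarrow> ('a \<Rightarrow> 'a) \<Rightarrow> ('a \<Rightarrow> 'a) \<Rightarrow> bool" where
  "commute_on K S T \<longleftrightarrow> (\<forall>x\<in>K. S (T x) = T (S x))"

definition normal_on :: "'a::complex_hilbert set \<Rightarrow> ('a \<Rightarrow> 'a) \<Rightarrow> bool" where
  "normal_on K T \<longleftrightarrow> operator_on K T \<and> (\<exists>S. adjoint_on K T S \<and> commute_on K S T)"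

definition commuting_operators :: "'a::complex_hilbert set \<Rightarrow> ('a \<Rightarrow> 'a) list \<Rightarrow> bool" where
  "commuting_operators K Ts \<longleftrightarrow>
     (\<forall>T\<in>set Ts. operator_on K T) \<and> (\<forall>S\<in>set Ts. \<forall>T\<in>set Ts. commute_on K S T)"


section \<open>Taylor joint spectrum\<close>

text \<open>The Koszul complex of a commuting \<open>n\<close>-tuple on \<open>K\<close>: an element of \<open>K \<otimes> \<Lambda>(\<complex>\<^sup>n)\<close> is given by its
  coefficients with respect to the basis \<open>e\<^sub>i\<^sub>1 \<and> \<dots> \<and> e\<^sub>i\<^sub>p\<close>, indexed by the sets
  \<open>{i\<^sub>1 < \<dots> < i\<^sub>p} \<subseteq> {0..<n}\<close>, and the boundary map is \<open>x \<otimes> \<omega> \<mapsto> (\<Sum>i<n. T\<^sub>i x \<otimes> (e\<^sub>i \<and> \<omega>))\<close>.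
  As the boundary map is graded, exactness of the complex at all stages means that its kernel
  equals its range on the whole of \<open>K \<otimes> \<Lambda>(\<complex>\<^sup>n)\<close>.\<close>

definition koszul_space :: "'a::complex_hilbert set \<Rightarrow> nat \<Rightarrow> (nat set \<Rightarrow> 'a) set" where
  "koszul_space K n =
     {x. (\<forall>I. I \<subseteq> {..<n} \<longrightarrow> x I \<in> K) \<and> (\<forall>I. \<not> I \<subseteq> {..<n} \<longrightarrow> x I = 0)}"

definition koszul_map ::
    "('a::complex_hilbert \<Rightarrow> 'a) list \<Rightarrow> (nat set \<Rightarrow> 'a) \<Rightarrow> nat set \<Rightarrow> 'a" where
  "koszul_map Ts x I =
     (if I \<subseteq> {..<length Ts}
      then \<Sum>i\<in>I. (-1) ^ card {j \<in> I. j < i} *\<^sub>R (Ts ! i) (x (I - {i}))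
      else 0)"

definition koszul_exact :: "'a::complex_hilbert set \<Rightarrow> ('a \<Rightarrow> 'a) list \<Rightarrow> bool" where
  "koszul_exact K Ts \<longleftrightarrow>
     {x \<in> koszul_space K (length Ts). koszul_map Ts x = (\<lambda>_. 0)}
       = koszul_map Ts ` koszul_space K (length Ts)"

definition taylor_spectrum ::
    "'a::complex_hilbert set \<Rightarrow> ('a \<Rightarrow> 'a) list \<Rightarrow> complex list set" where
  "taylor_spectrum K Ts =
     {cs. length cs = length Ts \<and>
          \<not> koszul_exact K (map2 (\<lambda>T c x. T x - c *\<^sub>C x) Ts cs)}"


section \<open>Tetrablock and hexablock\<close>

definition tetrablock :: "(complex \<times> complex \<times> complex) set" where
  "tetrablock = {(x1, x2, x3).
     \<forall>z1 z2. cmod z1 \<le> 1 \<longrightarrow> cmod z2 \<le> 1 \<longrightarrow> 1 - x1 * z1 - x2 * z2 + x3 * z1 * z2 \<noteq> 0}"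

text \<open>The supremum below is that of a bounded set, since the denominator is bounded away from 0
  on the closed bidisc for a point of the tetrablock.\<close>

definition hexablock :: "(complex \<times> complex \<times> complex \<times> complex) set" where
  "hexablock = {(a, x1, x2, x3). (x1, x2, x3) \<in> tetrablock \<and>
     (SUP (z1, z2) \<in> ball 0 1 \<times> ball 0 1.
        cmod (a * complex_of_real (sqrt ((1 - (cmod z1)\<^sup>2) * (1 - (cmod z2)\<^sup>2)))
              / (1 - x1 * z1 - x2 * z2 + x3 * z1 * z2))) < 1}"

definition complex_linear4 ::
    "(complex \<times> complex \<times> complex \<times> complex \<Rightarrow> complex) \<Rightarrow> bool" where
  "complex_linear4 D \<longleftrightarrow> linear D \<and>
     (\<forall>c a x1 x2 x3. D (c * a, c * x1, c * x2, c * x3) = c * D (a, x1, x2, x3))"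

definition analytic_in ::
    "(complex \<times> complex \<times> complex \<times> complex \<Rightarrow> complex)
     \<Rightarrow> (complex \<times> complex \<times> complex \<times> complex) set \<Rightarrow> bool" where
  "analytic_in f U \<longleftrightarrow> (\<forall>p\<in>U. \<exists>D. complex_linear4 D \<and> (f has_derivative D) (at p))"

definition is_boundary ::
    "(complex \<times> complex \<times> complex \<times> complex) set
     \<Rightarrow> (complex \<times> complex \<times> complex \<times> complex) set \<Rightarrow> bool" where
  "is_boundary U C \<longleftrightarrow> closed C \<and> C \<subseteq> closure U \<and>
     (\<forall>f. continuous_on (closure U) f \<longrightarrow> analytic_in f U \<longrightarrow>
          (\<exists>p\<in>C. \<forall>q\<in>closure U. cmod (f q) \<le> cmod (f p)))"

text \<open>The smallest boundary, that is, the intersection of all of them. (For bounded \<open>U\<close> the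
  intersection is itself a boundary, by the theorem on the existence of the Shilov boundary.)\<close>

definition distinguished_boundary ::
    "(complex \<times> complex \<times> complex \<times> complex) set
     \<Rightarrow> (complex \<times> complex \<times> complex \<times> complex) set" where
  "distinguished_boundary U = \<Inter>{C. is_boundary U C}"


section \<open>Unitaries and isometries associated with the hexablock\<close>

definition hexablock_unitary_on :: "'a::complex_hilbert set \<Rightarrow> ('a \<Rightarrow> 'a) list \<Rightarrow> bool" where
  "hexablock_unitary_on K Us \<longleftrightarrow>
     length Us = 4 \<and> commuting_operators K Us \<and> (\<forall>U\<in>set Us. normal_on K U) \<and>
     taylor_spectrum K Us \<subseteq>
       {[a, x1, x2, x3] | a x1 x2 x3. (a, x1, x2, x3) \<in> distinguished_boundary hexablock}"

text \<open>The inclusion of the space \<open>'a\<close> into the larger Hilbert space \<open>K\<close> is given by a linear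
  isometry \<open>V\<close>. Letting \<open>K\<close> range over the closed subspaces of \<open>'a ell2\<close> is no restriction: one
  can shrink \<open>K\<close> to its smallest closed subspace that contains the range of \<open>V\<close> and reduces
  \<open>Us\<close> (the restriction of \<open>Us\<close> to it is again a hexablock unitary). That subspace
  has Hilbert dimension at most \<open>max \<aleph>\<^sub>0 (dim 'a)\<close>, and it is zero if \<open>'a\<close> is, so that it embeds
  isometrically into \<open>'a ell2\<close>.\<close>

definition hexablock_isometry :: "('a::complex_hilbert \<Rightarrow> 'a) list \<Rightarrow> bool" where
  "hexablock_isometry Ts \<longleftrightarrow>
     length Ts = 4 \<and> commuting_operators UNIV Ts \<and>
     (\<exists>(K :: 'a ell2 set) V Us.
        closed_csubspace K \<and> hexablock_unitary_on K Us \<and>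
        (\<forall>x y. V (x + y) = V x + V y) \<and> (\<forall>c x. V (c *\<^sub>C x) = c *\<^sub>C V x) \<and>
        (\<forall>x. norm (V x) = norm x) \<and> range V \<subseteq> K \<and>
        (\<forall>i<4. \<forall>x. (Us ! i) (V x) = V ((Ts ! i) x)))"

definition orthocomplement :: "'a::complex_hilbert set \<Rightarrow> 'a set" where
  "orthocomplement M = {y. \<forall>x\<in>M. cinner x y = 0}"

definition reduces :: "'a::complex_hilbert set \<Rightarrow> ('a \<Rightarrow> 'a) \<Rightarrow> bool" where
  "reduces M T \<longleftrightarrow> T ` M \<subseteq> M \<and> T ` orthocomplement M \<subseteq> orthocomplement M"

definition pure_hexablock_isometry :: "('a::complex_hilbert \<Rightarrow> 'a) list \<Rightarrow> bool" where
  "pure_hexablock_isometry Ts \<longleftrightarrow>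
     hexablock_isometry Ts \<and>
     \<not> (\<exists>M. closed_csubspace M \<and> M \<noteq> {0} \<and> (\<forall>T\<in>set Ts. reduces M T) \<and>
            hexablock_unitary_on M Ts)"

end

theory Submission
  imports Defs
begin

text \<open>
On the unit circle the second and third entries of the quadruple are the operator-valued functions
\<open>F\<^sub>1\<^sup>* + z F\<^sub>2\<close> and \<open>F\<^sub>2\<^sup>* + z F\<^sub>1\<close>, and the former is the adjoint of the latter times \<open>z\<close>. The distinguished
boundary of the hexablock contains all points with \<open>x\<^sub>1 = cnj x\<^sub>2 x\<^sub>3\<close>, \<open>\<bar>x\<^sub>3\<bar> = 1\<close> and
\<open>\<bar>a\<bar>\<^sup>2 + \<bar>x\<^sub>1\<bar>\<^sup>2 = 1\<close>, each of which is a peak point of an affine function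
(\<open>hexablock_torus_subset_distinguished_boundary\<close>). So what is needed is a pencil with
\<open>\<bar>G\<^sub>0 + z G\<^sub>1\<bar>\<^sup>2 = 1 - \<bar>F\<^sub>1\<^sup>* + z F\<^sub>2\<bar>\<^sup>2\<close> for \<open>\<bar>z\<bar> = 1\<close> whose coefficients commute with everything in
sight: a Fejer-Riesz factorization in a commutative operator algebra.

It is found as if \<open>F\<^sub>1\<close> and \<open>F\<^sub>2\<close> were functions, but without spectral theory. Fuglede's theorem
(\<open>fuglede\<close>), derived from Cauchy's estimate for operator polynomials, makes the algebra
commutative. Choosing the phase of \<open>z\<close> pointwise, the hypothesis says \<open>\<bar>F\<^sub>1\<bar> + \<bar>F\<^sub>2\<bar> \<le> 1\<close>; as an operator
inequality this follows from Cauchy's estimate for the powers of the pencil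
(\<open>norm_modulus_sum_le\<close>). Then \<open>1 - (\<bar>F\<^sub>1\<bar> \<plusminus> \<bar>F\<^sub>2\<bar>)\<^sup>2\<close> have square roots, from which \<open>G\<^sub>0\<close> and the modulus of
\<open>G\<^sub>1\<close> are formed, while \<open>G\<^sub>1\<close> itself is a quotient that exists as a norm limit
(\<open>spectral_factorization\<close>).

Replacing multiplication by \<open>z\<close> by the bilateral shift extends the four Toeplitz operators to
commuting normal operators with the same relations. A point of their Taylor spectrum satisfies these
relations as well, because off the relations a sum of squares is coercive and the Koszul complex is
contractible (\<open>koszul_exact_if_coercive\<close>, \<open>hexablock_unitaryI\<close>); so the spectrum lies in the
distinguished boundary. The isometry is pure because multiplication by \<open>z\<close> is a unilateral shift, which
is not normal on any nonzero closed subspace that it leaves invariant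
(\<open>normal_on_toeplitz_shift_trivial\<close>).
\<close>

section \<open>The algebra of adjointable operators\<close>

lemma cinner_zero_left [simp]: "cinner 0 x = 0" for x :: "'a::complex_inner"
  by (rule linear_0[OF bounded_linear.linear[OF bounded_linear_cinner_left]])

lemma cinner_zero_right [simp]: "cinner x 0 = 0" for x :: "'a::complex_inner"
  by (metis cinner_zero_left cinner_commute complex_cnj_zero)

lemma cinner_add_right: "cinner x (y + z) = cinner x y + cinner x z" for x :: "'a::complex_inner"
  by (metis cinner_add_left cinner_commute complex_cnj_add)

lemma cinner_scaleC_right: "cinner x (c *\<^sub>C y) = cnj c * cinner x y" for x :: "'a::complex_inner"
  by (metis cinner_scaleC_left cinner_commute complex_cnj_mult)

lemma cinner_scaleR_left: "cinner (r *\<^sub>R x) y = r *\<^sub>R cinner x y" for x :: "'a::complex_inner"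
  by (simp add: scaleC_of_real[symmetric] cinner_scaleC_left scaleR_conv_of_real)

lemma cinner_scaleR_right: "cinner x (r *\<^sub>R y) = r *\<^sub>R cinner x y" for x :: "'a::complex_inner"
  by (simp add: scaleC_of_real[symmetric] cinner_scaleC_right scaleR_conv_of_real)

lemma cinner_minus_left: "cinner (- x) y = - cinner x y" for x :: "'a::complex_inner"
  using cinner_scaleR_left[of "-1" x y] by simp

lemma cinner_minus_right: "cinner x (- y) = - cinner x y" for x :: "'a::complex_inner"
  using cinner_scaleR_right[of x "-1" y] by simp

lemma cinner_diff_left: "cinner (x - y) z = cinner x z - cinner y z" for x :: "'a::complex_inner"
  using cinner_add_left[of x "- y" z] by (simp add: cinner_minus_left)

lemma cinner_diff_right: "cinner x (y - z) = cinner x y - cinner x z" for x :: "'a::complex_inner"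
  using cinner_add_right[of x y "- z"] by (simp add: cinner_minus_right)

lemma cinner_eq_zeroI: "x = 0" if "\<And>y. cinner x y = 0" for x :: "'a::complex_inner"
  using that[of x] by (simp add: cinner_self)

lemma cinner_eqI: "x = y" if "\<And>z. cinner x z = cinner y z" for x :: "'a::complex_inner"
  using cinner_eq_zeroI[of "x - y"] that by (simp add: cinner_diff_left)

lemma scaleC_one [simp]: "1 *\<^sub>C x = x" for x :: "'a::complex_inner"
  using scaleC_of_real[of 1 x] by simp

lemma scaleC_zero_left [simp]: "0 *\<^sub>C x = 0" for x :: "'a::complex_inner"
  using scaleC_of_real[of 0 x] by simp

text \<open>The algebra of bounded operators is made a type, so that ring laws and norm convergence apply to
operators directly. Adjointability is part of the type, which makes the adjoint a total operation.
The algebra is a ring with \<open>monoid_mult\<close> and not a \<open>ring_1\<close>, because \<open>1 = 0\<close> on the zero space.\<close>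

typedef (overloaded) 'a bop =
  "{T :: 'a::complex_hilbert \<Rightarrow>\<^sub>L 'a. \<exists>S :: 'a \<Rightarrow>\<^sub>L 'a. \<forall>x y. cinner (T x) y = cinner x (S y)}"
  by (rule exI[of _ 0]) (auto intro!: exI[of _ 0])

setup_lifting type_definition_bop

instantiation bop :: (complex_hilbert) real_vector
begin

lift_definition zero_bop :: "'a bop" is 0
  by (auto intro!: exI[of _ 0])
lift_definition plus_bop :: "'a bop \<Rightarrow> 'a bop \<Rightarrow> 'a bop" is "(+)"
  by (elim exE, rule_tac x = "x + xa" in exI)
    (simp add: blinfun.add_left cinner_add_left cinner_add_right)
lift_definition uminus_bop :: "'a bop \<Rightarrow> 'a bop" is "uminus"
  by (elim exE, rule_tac x = "- x" in exI)
    (simp add: blinfun.minus_left cinner_minus_left cinner_minus_right)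
lift_definition minus_bop :: "'a bop \<Rightarrow> 'a bop \<Rightarrow> 'a bop" is "(-)"
  by (elim exE, rule_tac x = "x - xa" in exI)
    (simp add: blinfun.diff_left cinner_diff_left cinner_diff_right)
lift_definition scaleR_bop :: "real \<Rightarrow> 'a bop \<Rightarrow> 'a bop" is "(*\<^sub>R)"
  by (elim exE, rule_tac x = "real *\<^sub>R x" in exI)
    (simp add: blinfun.scaleR_left cinner_scaleR_left cinner_scaleR_right)
instance
proof
  fix x y z :: "'a bop" and r s :: real
  show "x + y + z = x + (y + z)" by transfer (simp add: add.assoc)
  show "x + y = y + x" by transfer (simp add: add.commute)
  show "0 + x = x" by transfer simp
  show "- x + x = 0" by transfer simp
  show "x - y = x + - y" by transfer simp
  show "r *\<^sub>R (x + y) = r *\<^sub>R x + r *\<^sub>R y" by transfer (simp add: scaleR_add_right)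
  show "(r + s) *\<^sub>R x = r *\<^sub>R x + s *\<^sub>R x" by transfer (simp add: scaleR_add_left)
  show "r *\<^sub>R s *\<^sub>R x = (r * s) *\<^sub>R x" by transfer simp
  show "1 *\<^sub>R x = x" by transfer simp
qed

end

instantiation bop :: (complex_hilbert) real_normed_vector
begin

lift_definition norm_bop :: "'a bop \<Rightarrow> real" is norm .
lift_definition dist_bop :: "'a bop \<Rightarrow> 'a bop \<Rightarrow> real" is dist .
definition sgn_bop :: "'a bop \<Rightarrow> 'a bop" where "sgn_bop x = x /\<^sub>R norm x"
definition uniformity_bop :: "('a bop \<times> 'a bop) filter"
  where "uniformity_bop = (INF e\<in>{0 <..}. principal {(x, y). dist x y < e})"
definition open_bop :: "'a bop set \<Rightarrow> bool"
  where "open_bop S = (\<forall>x\<in>S. \<forall>\<^sub>F (x', y) in uniformity. x' = x \<longrightarrow> y \<in> S)"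

instance
proof
  fix x y :: "'a bop" and r :: real
  show "sgn x = x /\<^sub>R norm x" by (rule sgn_bop_def)
  show "dist x y = norm (x - y)" by transfer (rule dist_norm)
  show "norm x = 0 \<longleftrightarrow> x = 0" by transfer simp
  show "norm (x + y) \<le> norm x + norm y" by transfer (rule norm_triangle_ineq)
  show "norm (r *\<^sub>R x) = \<bar>r\<bar> * norm x" by transfer simp
qed (auto simp: uniformity_bop_def open_bop_def)

end

instantiation bop :: (complex_hilbert) "{real_normed_algebra, monoid_mult}"
begin

lift_definition one_bop :: "'a bop" is id_blinfun
  by (rule exI[of _ id_blinfun]) simp
lift_definition times_bop :: "'a bop \<Rightarrow> 'a bop \<Rightarrow> 'a bop" is blinfun_compose
  by (elim exE, rule_tac x = "blinfun_compose xa x" in exI) simp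

instance
proof
  fix x y z :: "'a bop" and r s :: real
  show "x * y * z = x * (y * z)" by transfer (rule blinfun_eqI, simp)
  show "(x + y) * z = x * z + y * z"
    by transfer (auto intro!: blinfun_eqI simp: blinfun.add_left)
  show "x * (y + z) = x * y + x * z"
    by transfer (auto intro!: blinfun_eqI simp: blinfun.add_left blinfun.add_right)
  show "r *\<^sub>R x * y = r *\<^sub>R (x * y)"
    by transfer (auto intro!: blinfun_eqI simp: blinfun.scaleR_left)
  show "x * r *\<^sub>R y = r *\<^sub>R (x * y)"
    by transfer (auto intro!: blinfun_eqI simp: blinfun.scaleR_left blinfun.scaleR_right)
  show "1 * x = x" by transfer (auto intro!: blinfun_eqI)
  show "x * 1 = x" by transfer (auto intro!: blinfun_eqI)
  show "norm (x * y) \<le> norm x * norm y" by transfer (rule norm_blinfun_compose)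
qed

end

definition app :: "'a::complex_hilbert bop \<Rightarrow> 'a \<Rightarrow> 'a" where "app T = blinfun_apply (Rep_bop T)"

lemma bounded_linear_app: "bounded_linear (app T)"
  unfolding app_def by (rule blinfun.bounded_linear_right)

lemma app_add_right: "app T (x + y) = app T x + app T y"
  and app_diff_right: "app T (x - y) = app T x - app T y"
  and app_minus_right: "app T (- x) = - app T x"
  and app_scaleR_right: "app T (r *\<^sub>R x) = r *\<^sub>R app T x"
  and app_zero_right [simp]: "app T 0 = 0"
  and app_sum_right: "app T (sum f I) = (\<Sum>i\<in>I. app T (f i))"
  by (simp_all add: app_def blinfun.bilinear_simps blinfun.sum_right)

lemma app_add: "app (S + T) x = app S x + app T x"
  and app_diff: "app (S - T) x = app S x - app T x"
  and app_minus: "app (- T) x = - app T x"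
  and app_scaleR: "app (r *\<^sub>R T) x = r *\<^sub>R app T x"
  and app_zero [simp]: "app 0 x = 0"
  and app_one [simp]: "app 1 x = x"
  and app_mult: "app (S * T) x = app S (app T x)"
  by (simp_all add: app_def plus_bop.rep_eq minus_bop.rep_eq uminus_bop.rep_eq scaleR_bop.rep_eq
      zero_bop.rep_eq one_bop.rep_eq times_bop.rep_eq blinfun.bilinear_simps)

lemma app_sum: "app (sum f I) x = (\<Sum>i\<in>I. app (f i) x)"
  by (induction I rule: infinite_finite_induct) (simp_all add: app_add)

lemmas app_simps = app_add app_diff app_minus app_scaleR app_mult app_add_right app_diff_right
  app_minus_right app_scaleR_right

lemma bop_eqI: "(\<And>x. app S x = app T x) \<Longrightarrow> S = T"
  by (simp add: app_def blinfun_eqI Rep_bop_inject[symmetric])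

lemma norm_app_le: "norm (app T x) \<le> norm T * norm x"
  by (simp add: app_def norm_bop.rep_eq norm_blinfun)

lemma norm_bop_le: "(\<And>x. norm (app T x) \<le> b * norm x) \<Longrightarrow> 0 \<le> b \<Longrightarrow> norm T \<le> b"
  unfolding app_def norm_bop.rep_eq by (rule norm_blinfun_bound)

lemma norm_bop_eq_onorm: "norm T = onorm (app T)"
  by (simp add: app_def norm_bop.rep_eq norm_blinfun.rep_eq)

lemma app_scaleC_right: "app T (c *\<^sub>C x) = c *\<^sub>C app T x"
proof -
  obtain S where S: "\<And>x y. cinner (app T x) y = cinner x (blinfun_apply S y)"
    using Rep_bop[of T] by (auto simp: app_def)
  show ?thesis by (rule cinner_eqI) (simp add: S cinner_scaleC_left)
qed

text \<open>The adjunction identity makes both maps linear, and the estimate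
\<open>\<parallel>g y\<parallel>\<^sup>2 = \<langle>f (g y), y\<rangle> \<le> \<bar>B\<bar> \<parallel>g y\<parallel> \<parallel>y\<parallel>\<close> carries the bound of \<open>f\<close> over to \<open>g\<close>. All concrete operators
below are built in this way.\<close>

lemma bop_of_adjoint_pair:
  assumes adj: "\<And>x y. cinner (f x) y = cinner x (g y)" and bd: "\<And>x. norm (f x) \<le> B * norm x"
  obtains T where "app T = f"
proof -
  have f: "bounded_linear f"
  proof (rule bounded_linear_intro)
    show "f (x + y) = f x + f y" for x y by (rule cinner_eqI) (simp add: adj cinner_add_left)
    show "f (r *\<^sub>R x) = r *\<^sub>R f x" for r x by (rule cinner_eqI) (simp add: adj cinner_scaleR_left)
    show "norm (f x) \<le> norm x * B" for x using bd[of x] by (simp add: mult.commute)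
  qed
  have g: "bounded_linear g"
  proof (rule bounded_linear_intro)
    have flip: "cinner (g y) x = cinner y (f x)" for x y by (metis adj cinner_commute)
    show "g (x + y) = g x + g y" for x y by (rule cinner_eqI) (simp add: flip cinner_add_left)
    show "g (r *\<^sub>R x) = r *\<^sub>R g x" for r x by (rule cinner_eqI) (simp add: flip cinner_scaleR_left)
    show "norm (g y) \<le> norm y * \<bar>B\<bar>" for y
    proof (cases "g y = 0")
      case False
      have "(norm (g y))\<^sup>2 = cmod (cinner (f (g y)) y)"
        by (simp only: adj cinner_self) (simp add: norm_power)
      also have "\<dots> \<le> norm (f (g y)) * norm y" by (rule cmod_cinner_le)
      also have "\<dots> \<le> (\<bar>B\<bar> * norm (g y)) * norm y"
        by (rule mult_right_mono[OF order_trans[OF bd]]) (simp_all add: mult_right_mono)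
      finally show ?thesis using False by (simp add: power2_eq_square mult_ac)
    qed simp
  qed
  have "Blinfun f \<in> {T :: 'a \<Rightarrow>\<^sub>L 'a. \<exists>S :: 'a \<Rightarrow>\<^sub>L 'a. \<forall>x y. cinner (T x) y = cinner x (S y)}"
    using f g adj by (auto simp: bounded_linear_Blinfun_apply intro!: exI[of _ "Blinfun g"])
  then have "app (Abs_bop (Blinfun f)) = f"
    using f by (simp add: app_def Abs_bop_inverse bounded_linear_Blinfun_apply)
  then show ?thesis by (rule that)
qed

definition adj :: "'a::complex_hilbert bop \<Rightarrow> 'a bop" where
  "adj T = (SOME S. \<forall>x y. cinner (app T x) y = cinner x (app S y))"

lemma cinner_app_left: "cinner (app T x) y = cinner x (app (adj T) y)"
proof -
  obtain S where S: "\<And>x y. cinner (app T x) y = cinner x (blinfun_apply S y)"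
    using Rep_bop[of T] by (auto simp: app_def)
  have S': "cinner (blinfun_apply S y) x = cinner y (app T x)" for x y
    by (metis S cinner_commute)
  obtain S'' where "app S'' = blinfun_apply S"
    using bop_of_adjoint_pair[OF S' norm_blinfun] .
  then have "\<exists>S. \<forall>x y. cinner (app T x) y = cinner x (app S y)"
    using S by (intro exI[of _ S'']) simp
  from someI_ex[OF this] show ?thesis unfolding adj_def by (elim allE)
qed

lemma cinner_app_right: "cinner x (app T y) = cinner (app (adj T) x) y"
  by (metis cinner_app_left cinner_commute)

lemma inner_app_left: "inner (app T x) y = inner x (app (adj T) y)"
  by (metis Re_cinner cinner_app_left)

lemma adjI: "(\<And>x y. cinner (app T x) y = cinner x (app S y)) \<Longrightarrow> adj T = S"
  by (rule bop_eqI, rule cinner_eqI, subst (1 2) cinner_commute)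
    (simp add: cinner_app_left[symmetric])

lemma adj_adj [simp]: "adj (adj T) = T"
  by (rule adjI) (simp add: cinner_app_right)

lemma adj_add [simp]: "adj (S + T) = adj S + adj T"
  by (rule adjI) (simp add: app_simps cinner_add_left cinner_add_right cinner_app_left)

lemma adj_diff [simp]: "adj (S - T) = adj S - adj T"
  by (rule adjI) (simp add: app_simps cinner_diff_left cinner_diff_right cinner_app_left)

lemma adj_minus [simp]: "adj (- T) = - adj T"
  by (rule adjI) (simp add: app_simps cinner_minus_left cinner_minus_right cinner_app_left)

lemma adj_scaleR [simp]: "adj (r *\<^sub>R T) = r *\<^sub>R adj T"
  by (rule adjI) (simp add: app_simps cinner_scaleR_left cinner_scaleR_right cinner_app_left)

lemma adj_zero [simp]: "adj 0 = 0" and adj_one [simp]: "adj 1 = 1"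
  by (rule adjI, simp)+

lemma adj_mult [simp]: "adj (S * T) = adj T * adj S"
  by (rule adjI) (simp add: app_simps cinner_app_left)

lemma adj_power [simp]: "adj (T ^ n) = adj T ^ n"
  by (induction n) (simp_all add: power_commutes)

lemma norm_app_sq: "(norm (app T x))\<^sup>2 = inner (app (adj T * T) x) x"
  by (simp add: power2_norm_eq_inner app_mult inner_app_left inner_commute)

lemma norm_adj_mult_self: "norm (adj T * T) = (norm T)\<^sup>2"
proof (rule antisym)
  have le: "norm T \<le> sqrt (norm (adj T * T))" for T :: "'a bop"
  proof (rule norm_bop_le)
    fix x
    have "(norm (app T x))\<^sup>2 \<le> norm (app (adj T * T) x) * norm x"
      unfolding norm_app_sq by (rule norm_cauchy_schwarz)
    also have "\<dots> \<le> norm (adj T * T) * norm x * norm x"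
      by (rule mult_right_mono[OF norm_app_le]) simp
    also have "\<dots> = (sqrt (norm (adj T * T)) * norm x)\<^sup>2"
      by (simp add: power_mult_distrib power2_eq_square)
    finally show "norm (app T x) \<le> sqrt (norm (adj T * T)) * norm x"
      by (rule power2_le_imp_le) simp
  qed simp
  then have sq: "(norm T)\<^sup>2 \<le> norm (adj T * T)" for T :: "'a bop"
    using power_mono[OF le, of T 2] by simp
  have adj_ge: "norm T \<le> norm (adj T)" for T :: "'a bop"
    using order_trans[OF sq norm_mult_ineq, of T]
    by (cases "norm T = 0") (auto simp: power2_eq_square)
  then have "norm (adj T) \<le> norm T" by (metis adj_adj)
  then show "norm (adj T * T) \<le> (norm T)\<^sup>2"
    using norm_mult_ineq[of "adj T" T] mult_right_mono[of "norm (adj T)" "norm T" "norm T"]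
    by (simp add: power2_eq_square)
  show "(norm T)\<^sup>2 \<le> norm (adj T * T)" by (rule sq)
qed

lemma norm_adj [simp]: "norm (adj T) = norm T"
proof -
  have "norm T \<le> norm (adj T)" for T :: "'a bop"
    using norm_mult_ineq[of "adj T" T] norm_adj_mult_self[of T]
    by (cases "norm T = 0") (auto simp: power2_eq_square)
  from this[of T] this[of "adj T"] show ?thesis by simp
qed

lemma bounded_linear_adj: "bounded_linear (adj :: 'a::complex_hilbert bop \<Rightarrow> 'a bop)"
  by (rule bounded_linear_intro[where K = 1]) simp_all

lemmas tendsto_adj [tendsto_intros] = bounded_linear.tendsto[OF bounded_linear_adj]

text \<open>A limit of adjointable operators is adjointable: taking adjoints is isometric, so the adjoints
of a Cauchy sequence converge as well, and the adjunction identity passes to the limit.\<close>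

instance bop :: (complex_hilbert) complete_space
proof
  fix X :: "nat \<Rightarrow> 'a bop"
  assume X: "Cauchy X"
  have "Cauchy (\<lambda>n. Rep_bop (X n))" "Cauchy (\<lambda>n. Rep_bop (adj (X n)))"
    using X by (simp_all add: Cauchy_def dist_bop.rep_eq[symmetric])
      (simp add: dist_norm flip: adj_diff)
  then obtain T S where T: "(\<lambda>n. Rep_bop (X n)) \<longlonglongrightarrow> T" and S: "(\<lambda>n. Rep_bop (adj (X n))) \<longlonglongrightarrow> S"
    by (auto simp: Cauchy_convergent_iff convergent_def)
  have "cinner (T x) y = cinner x (S y)" for x y
  proof (rule LIMSEQ_unique)
    show "(\<lambda>n. cinner (app (X n) x) y) \<longlonglongrightarrow> cinner (T x) y"
      unfolding app_def by (intro bounded_linear.tendsto[OF bounded_linear_cinner_left] tendsto_intros T)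
    have "(\<lambda>n. cnj (cinner (app (adj (X n)) y) x)) \<longlonglongrightarrow> cnj (cinner (S y) x)"
      unfolding app_def
      by (intro bounded_linear.tendsto[OF bounded_linear_cinner_left] tendsto_intros S)
    then show "(\<lambda>n. cinner (app (X n) x) y) \<longlonglongrightarrow> cinner x (S y)"
      by (simp add: cinner_app_left cinner_commute[symmetric])
  qed
  then have "Rep_bop (Abs_bop T) = T" by (intro Abs_bop_inverse) auto
  then have "X \<longlonglongrightarrow> Abs_bop T"
    using T by (simp add: lim_sequentially dist_bop.rep_eq)
  then show "convergent X" by (auto simp: convergent_def)
qed

instance bop :: (complex_hilbert) banach ..

text \<open>Complex multiples of operators are written as products with \<open>scal c\<close>, the operator \<open>c \<cdot> 1\<close>, which is
central.\<close>

definition scal :: "complex \<Rightarrow> 'a::complex_hilbert bop" where "scal c = (THE T. app T = (*\<^sub>C) c)"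

lemma app_scal [simp]: "app (scal c) x = c *\<^sub>C x" for x :: "'a::complex_hilbert"
proof -
  obtain T :: "'a bop" where T: "app T = (*\<^sub>C) c"
    by (rule bop_of_adjoint_pair[of "(*\<^sub>C) c" "(*\<^sub>C) (cnj c)" "cmod c"])
      (simp_all add: norm_scaleC cinner_scaleC_left cinner_scaleC_right)
  have "scal c = T"
    unfolding scal_def
  proof (rule the_equality)
    show "S = T" if "app S = (*\<^sub>C) c" for S by (rule bop_eqI) (simp add: T that)
  qed (rule T)
  with T show ?thesis by simp
qed

lemma scal_add: "scal (c + d) = scal c + scal d"
  and scal_mult: "scal (c * d) = scal c * scal d"
  and scal_one [simp]: "scal 1 = 1"
  and scal_zero [simp]: "scal 0 = 0"
  by (rule bop_eqI; simp add: app_simps scaleC_add_left scaleC_scaleC scaleC_of_real)+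

lemma scal_minus: "scal (- c) = - scal c"
  using scal_add[of c "- c"] by (simp add: eq_neg_iff_add_eq_0 add.commute)

lemma scal_diff: "scal (c - d) = scal c - scal d"
  using scal_add[of c "- d"] by (simp add: scal_minus)

lemma scal_power: "scal (c ^ n) = scal c ^ n"
  by (induction n) (simp_all add: scal_mult)

lemma scal_sum: "scal (sum f I) = (\<Sum>i\<in>I. scal (f i))"
  by (induction I rule: infinite_finite_induct) (simp_all add: scal_add)

lemma adj_scal [simp]: "adj (scal c) = scal (cnj c)"
  by (rule adjI) (simp add: cinner_scaleC_left cinner_scaleC_right)

lemma scal_commute: "T * scal c = scal c * T"
  by (rule bop_eqI) (simp add: app_simps app_scaleC_right)

lemma norm_scal_mult [simp]: "norm (scal c * T) = cmod c * norm T"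
proof (rule antisym)
  show le: "norm (scal c * T) \<le> cmod c * norm T" for c and T :: "'a bop"
    by (rule norm_bop_le)
      (auto simp: app_mult norm_scaleC mult.assoc intro!: mult_left_mono norm_app_le)
  show "cmod c * norm T \<le> norm (scal c * T)"
  proof (cases "c = 0")
    case False
    have "T = scal (1 / c) * (scal c * T)"
      using False by (simp add: mult.assoc[symmetric] scal_mult[symmetric])
    then have "norm T \<le> cmod (1 / c) * norm (scal c * T)" by (metis le)
    then show ?thesis using False by (simp add: norm_divide field_simps)
  qed simp
qed

text \<open>Commutation is a relation of its own, since the equation \<open>S * T = T * S\<close> would be useless as a
rewrite rule, whereas the closure properties of the relation are introduction rules.\<close>

definition comm :: "'a::complex_hilbert bop \<Rightarrow> 'a bop \<Rightarrow> bool" where "comm S T \<longleftrightarrow> S * T = T * S"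

lemma comm_sym: "comm S T \<Longrightarrow> comm T S" by (simp add: comm_def)

lemma comm_refl: "comm T T" by (simp add: comm_def)

lemma comm_add: "comm R S \<Longrightarrow> comm R T \<Longrightarrow> comm R (S + T)"
  and comm_diff: "comm R S \<Longrightarrow> comm R T \<Longrightarrow> comm R (S - T)"
  and comm_minus: "comm R S \<Longrightarrow> comm R (- S)"
  and comm_scaleR: "comm R S \<Longrightarrow> comm R (r *\<^sub>R S)"
  and comm_scal: "comm R (scal c)"
  and comm_one: "comm R 1"
  and comm_zero: "comm R 0"
  by (simp_all add: comm_def distrib_left distrib_right left_diff_distrib right_diff_distrib
      scal_commute)

lemma comm_mult: "comm R S \<Longrightarrow> comm R T \<Longrightarrow> comm R (S * T)"
  unfolding comm_def by (metis mult.assoc)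

lemma comm_power: "comm R S \<Longrightarrow> comm R (S ^ n)"
  by (induction n) (simp_all add: comm_one comm_mult)

lemma comm_adj: "comm (adj S) (adj T) \<longleftrightarrow> comm S T"
proof -
  have imp: "comm (adj S) (adj T)" if "comm S T" for S T :: "'a bop"
    using arg_cong[OF that[unfolded comm_def], of adj] by (simp add: comm_def)
  show ?thesis using imp[of S T] imp[of "adj S" "adj T"] by auto
qed

lemma comm_limit: "comm R T" if "X \<longlonglongrightarrow> T" "\<And>n. comm R (X n)"
proof -
  have "(\<lambda>n. R * X n) \<longlonglongrightarrow> R * T" "(\<lambda>n. X n * R) \<longlonglongrightarrow> T * R"
    by (intro tendsto_intros that)+
  with that(2) show ?thesis unfolding comm_def using LIMSEQ_unique by fastforce
qed

lemmas comm_intros = comm_refl comm_add comm_diff comm_mult comm_minus comm_scaleR comm_scal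
  comm_one comm_zero comm_power

section \<open>Operator polynomials and Fuglede's theorem\<close>

lemma norm_one_le: "norm (1 :: 'a::complex_hilbert bop) \<le> 1"
  by (rule norm_bop_le) auto

lemma norm_power_le: "norm (T ^ n) \<le> norm T ^ n" for T :: "'a::complex_hilbert bop"
proof (induction n)
  case (Suc n)
  then show ?case
    using norm_mult_ineq[of T "T ^ n"] mult_left_mono[OF Suc, of "norm T"] by simp
qed (simp add: norm_one_le)

lemma roots_of_unity_sum:
  assumes "j < n" "k < n"
  shows "(\<Sum>m<n. cis (2 * pi * real m / real n) ^ j * cnj (cis (2 * pi * real m / real n)) ^ k)
    = (if j = k then of_nat n else 0)"
proof -
  define w where "w = (\<lambda>m::nat. cis (2 * pi * real m / real n))"
  define u where "u = w j * cnj (w k)"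
  have n: "n > 0" using assms by simp
  have inj: "inj_on w {..<n}" unfolding w_def using Complex.bij_betw_roots_unity[OF n] by (rule bij_betw_imp_inj_on)
  have wp: "w m ^ i = w i ^ m" for m i
    unfolding w_def Complex.DeMoivre by (rule arg_cong[of _ _ cis]) (simp add: mult_ac)
  have wc: "w k * cnj (w k) = 1" for k by (simp add: w_def cis_cnj cis_mult)
  have wn: "w m ^ n = 1" for m
    using n by (simp add: w_def Complex.DeMoivre)
  have "w m ^ j * cnj (w m) ^ k = u ^ m" for m
    by (simp only: u_def power_mult_distrib complex_cnj_power[symmetric] wp[of m j] wp[of m k])
  then have "(\<Sum>m<n. w m ^ j * cnj (w m) ^ k) = (\<Sum>m<n. u ^ m)" by simp
  also have "\<dots> = (if j = k then of_nat n else 0)"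
  proof (cases "j = k")
    case False
    have "u \<noteq> 1"
    proof
      assume "u = 1"
      then have "w k = w j * (w k * cnj (w k))" by (simp add: u_def mult_ac)
      then show False using wc inj assms False by (auto dest: inj_onD)
    qed
    moreover have "u ^ n = 1" by (simp add: u_def power_mult_distrib wn flip: complex_cnj_power)
    ultimately show ?thesis using geometric_sum[of u n] False by simp
  qed (simp add: u_def wc)
  finally show ?thesis by (simp add: w_def)
qed

lemma scal_scal_mult: "scal a * (scal b * T) = scal (a * b) * T"
  by (simp add: scal_mult mult.assoc)

text \<open>Cauchy's estimate for an operator polynomial: the average of \<open>w\<^sup>-\<^sup>k f (r w)\<close> over the \<open>n\<close>-th roots of
unity \<open>w\<close> is the coefficient of \<open>z\<^sup>k\<close> times \<open>r\<^sup>k\<close>, so that no integration is needed.\<close>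

lemma op_poly_coeff_bound:
  fixes c :: "nat \<Rightarrow> 'a::complex_hilbert bop"
  assumes bd: "\<And>z. cmod z = r \<Longrightarrow> norm (\<Sum>j<n. scal (z ^ j) * c j) \<le> b"
    and k: "k < n" and r: "0 \<le> r"
  shows "norm (c k) * r ^ k \<le> b"
proof -
  define w where "w = (\<lambda>m::nat. cis (2 * pi * real m / real n))"
  define f where "f z = (\<Sum>j<n. scal (z ^ j) * c j)" for z
  have "(\<Sum>m<n. scal (cnj (w m) ^ k) * f (of_real r * w m))
      = (\<Sum>m<n. \<Sum>j<n. scal (of_real r ^ j * (w m ^ j * cnj (w m) ^ k)) * c j)"
    by (intro sum.cong refl)
      (simp add: f_def sum_distrib_left scal_scal_mult power_mult_distrib mult_ac)
  also have "\<dots> = (\<Sum>j<n. \<Sum>m<n. scal (of_real r ^ j * (w m ^ j * cnj (w m) ^ k)) * c j)"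
    by (rule sum.swap)
  also have "\<dots> = (\<Sum>j<n. scal (of_real r ^ j * (\<Sum>m<n. w m ^ j * cnj (w m) ^ k)) * c j)"
    by (simp add: sum_distrib_left scal_sum sum_distrib_right)
  also have "\<dots> = (\<Sum>j<n. if j = k then scal (of_real r ^ k * of_nat n) * c k else 0)"
    unfolding w_def using k by (intro sum.cong refl) (simp add: roots_of_unity_sum)
  also have "\<dots> = scal (of_real r ^ k * of_nat n) * c k" using k by simp
  finally have "norm (scal (of_real r ^ k * of_nat n) * c k)
      = norm (\<Sum>m<n. scal (cnj (w m) ^ k) * f (of_real r * w m))" by simp
  also have "\<dots> \<le> (\<Sum>m<n. norm (scal (cnj (w m) ^ k) * f (of_real r * w m)))"
    by (rule norm_sum)
  also have "\<dots> \<le> (\<Sum>m<n. b)"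
    using r by (intro sum_mono) (auto simp: w_def f_def norm_power norm_mult intro!: bd)
  also have "\<dots> = real n * b" by simp
  finally have "real n * (norm (c k) * r ^ k) \<le> real n * b"
    using r by (simp add: norm_mult norm_power mult_ac)
  then show ?thesis using k by simp
qed

text \<open>Coefficient lists, in Horner form, of polynomials in a complex variable with operator
coefficients. The coefficients need not commute, so these are not polynomials over a commutative
ring.\<close>

primrec oeval :: "'a::complex_hilbert bop list \<Rightarrow> complex \<Rightarrow> 'a bop" where
  "oeval [] z = 0"
| "oeval (c # cs) z = c + scal z * oeval cs z"

lemma oeval_eq_sum: "oeval cs z = (\<Sum>j<length cs. scal (z ^ j) * cs ! j)"
  by (induction cs)
    (simp_all add: sum.lessThan_Suc_shift sum_distrib_left scal_mult mult.assoc
      del: sum.lessThan_Suc)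

fun oadd :: "'a::complex_hilbert bop list \<Rightarrow> 'a bop list \<Rightarrow> 'a bop list" where
  "oadd [] ds = ds"
| "oadd cs [] = cs"
| "oadd (c # cs) (d # ds) = (c + d) # oadd cs ds"

primrec omult :: "'a::complex_hilbert bop list \<Rightarrow> 'a bop list \<Rightarrow> 'a bop list" where
  "omult [] ds = []"
| "omult (c # cs) ds = oadd (map ((*) c) ds) (0 # omult cs ds)"

lemma oeval_oadd: "oeval (oadd cs ds) z = oeval cs z + oeval ds z"
  by (induction cs ds rule: oadd.induct) (simp_all add: algebra_simps)

lemma oeval_map_mult: "oeval (map ((*) c) ds) z = c * oeval ds z"
  by (induction ds) (simp_all add: distrib_left scal_commute mult.assoc[symmetric])

lemma oeval_omult: "oeval (omult cs ds) z = oeval cs z * oeval ds z"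
  by (induction cs) (simp_all add: oeval_oadd oeval_map_mult distrib_right mult.assoc)

text \<open>Only the first two coefficients \<open>a\<close> and \<open>b\<close> of a polynomial function \<open>f\<close> are tracked.\<close>

definition op_poly :: "(complex \<Rightarrow> 'a::complex_hilbert bop) \<Rightarrow> 'a bop \<Rightarrow> 'a bop \<Rightarrow> bool" where
  "op_poly f a b \<longleftrightarrow> (\<exists>cs. \<forall>z. f z = oeval (a # b # cs) z)"

lemma op_poly_mult:
  assumes "op_poly f a b" "op_poly g a' b'"
  shows "op_poly (\<lambda>z. f z * g z) (a * a') (a * b' + b * a')"
proof -
  obtain cs ds where "\<And>z. f z = oeval (a # b # cs) z" "\<And>z. g z = oeval (a' # b' # ds) z"
    using assms by (auto simp: op_poly_def)
  then have "f z * g z = oeval (omult (a # b # cs) (a' # b' # ds)) z" for z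
    by (simp only: oeval_omult)
  then show ?thesis unfolding op_poly_def by (auto simp del: oeval.simps)
qed

lemma op_poly_const: "op_poly (\<lambda>_. a) a 0"
  unfolding op_poly_def by (rule exI[of _ "[]"]) simp

lemma op_poly_linear: "op_poly (\<lambda>z. a + scal z * b) a b"
  unfolding op_poly_def by (rule exI[of _ "[]"]) simp

lemma op_poly_power:
  assumes "op_poly f 1 b"
  shows "op_poly (\<lambda>z. f z ^ n) 1 (real n *\<^sub>R b)"
proof (induction n)
  case 0
  show ?case using op_poly_const[of 1] by simp
next
  case (Suc n)
  from op_poly_mult[OF assms Suc] show ?case by (simp add: algebra_simps)
qed

lemma op_poly_linear_coeff_bound:
  assumes "op_poly f a b" "\<And>z. cmod z = r \<Longrightarrow> norm (f z) \<le> B" "0 \<le> r"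
  shows "norm b * r \<le> B"
proof -
  obtain cs where "\<And>z. f z = oeval (a # b # cs) z" using assms(1) by (auto simp: op_poly_def)
  then have "norm ((a # b # cs) ! 1) * r ^ 1 \<le> B"
    using assms(2,3) by (intro op_poly_coeff_bound[where n = "length (a # b # cs)"])
      (auto simp only: oeval_eq_sum[symmetric], simp)
  then show ?thesis by simp
qed

definition geom :: "nat \<Rightarrow> 'a::complex_hilbert bop \<Rightarrow> 'a bop" where
  "geom m X = (\<Sum>j\<le>m. X ^ j)"

lemma geom_Suc: "geom (Suc m) X = 1 + X * geom m X"
  by (simp add: geom_def sum.atMost_Suc_shift sum_distrib_left del: sum.atMost_Suc)

lemma geom_telescope: "(1 - X) * geom m X = 1 - X ^ Suc m"
proof (induction m)
  case (Suc m)
  have "(1 - X) * geom (Suc m) X = (1 - X) + X * ((1 - X) * geom m X)"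
    by (simp add: geom_Suc algebra_simps)
  also have "\<dots> = 1 - X ^ Suc (Suc m)" unfolding Suc by (simp add: right_diff_distrib)
  finally show ?case .
qed (simp add: geom_def)

lemma op_poly_geom: "op_poly (\<lambda>z. geom (Suc m) (scal z * M)) 1 M"
proof -
  have ex: "\<exists>cs. \<forall>z. geom m (scal z * M) = oeval (1 # cs) z" for m
  proof (induction m)
    case 0
    show ?case by (rule exI[of _ "[]"]) (simp add: geom_def)
  next
    case (Suc m)
    then obtain cs where cs: "\<And>z. geom m (scal z * M) = oeval (1 # cs) z" by blast
    have "geom (Suc m) (scal z * M) = oeval (1 # map ((*) M) (1 # cs)) z" for z
      unfolding geom_Suc cs oeval.simps(2)[of 1 "map ((*) M) (1 # cs)"] oeval_map_mult
      by (simp add: mult.assoc)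
    then show ?case by blast
  qed
  obtain cs where cs: "\<And>z. geom m (scal z * M) = oeval (1 # cs) z" using ex by blast
  have "geom (Suc m) (scal z * M) = oeval (1 # map ((*) M) (1 # cs)) z" for z
    unfolding geom_Suc cs oeval.simps(2)[of 1 "map ((*) M) (1 # cs)"] oeval_map_mult
    by (simp add: mult.assoc)
  then show ?thesis unfolding op_poly_def by auto
qed

lemma comm_geom: "comm R X \<Longrightarrow> comm R (geom m X)"
  by (induction m) (simp_all add: geom_def[of 0] geom_Suc comm_intros)

lemma comm_power_mult: "comm S T \<Longrightarrow> (S * T) ^ n = S ^ n * T ^ n"
proof (induction n)
  case (Suc n)
  then have "T * S ^ n = S ^ n * T" using comm_power[of T S n] by (simp add: comm_def)
  then show ?case using Suc by (simp add: mult.assoc) (metis mult.assoc)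
qed simp

lemma norm_adj_mult_normal:
  assumes "comm N (adj N)"
  shows "norm (adj N * T) = norm (N * T)"
proof -
  have "(norm (adj N * T))\<^sup>2 = norm (adj T * (N * adj N) * T)"
    by (simp add: norm_adj_mult_self[symmetric] mult.assoc)
  also have "\<dots> = norm (adj T * (adj N * N) * T)" using assms by (simp add: comm_def)
  also have "\<dots> = (norm (N * T))\<^sup>2"
    by (simp add: norm_adj_mult_self[symmetric] mult.assoc)
  finally show ?thesis by (simp add: power2_eq_iff_nonneg)
qed

text \<open>Let \<open>M = N\<^sup>*\<close>, let \<open>Q\<close> be a long partial sum of the geometric series of \<open>z M\<close>, and consider the polynomial
\<open>g z = (1 - z M)\<^sup>n A Q\<^sup>n\<close> on a small circle \<open>\<bar>z\<bar> = r\<close>. By normality the factor \<open>1 - z M\<close> may be replaced, under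
the norm, by its adjoint, which commutes with \<open>A\<close>; so \<open>A\<close> can be pulled out, and by normality again
\<open>\<parallel>g z\<parallel> \<le> \<parallel>A\<parallel> \<parallel>(1 - z M) Q\<parallel>\<^sup>n\<close>, which is almost \<open>\<parallel>A\<parallel>\<close>. The linear coefficient of \<open>g\<close> is
\<open>n (A M - M A)\<close>, hence \<open>n r \<parallel>A M - M A\<parallel> \<le> \<parallel>A\<parallel>\<close> by Cauchy's estimate, for every \<open>n\<close>.\<close>

theorem fuglede:
  assumes normal: "comm N (adj N)" and AN: "comm A N"
  shows "comm A (adj N)"
proof -
  define M where "M = adj N"
  define \<delta> where "\<delta> = A * M - M * A"
  \<comment> \<open>The radius makes the norm of \<open>z M\<close> at most 1/2, also for \<open>N = 0\<close>.\<close>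
  define r where "r = 1 / (2 * (norm N + 1))"
  have r: "0 < r" "r * norm N \<le> 1 / 2"
  proof -
    have "0 < norm N + 1" by (simp add: add_nonneg_pos)
    then show "0 < r" "r * norm N \<le> 1 / 2" by (auto simp: r_def field_simps)
  qed
  have est: "real n * (norm \<delta> * r) \<le> norm A" for n
  proof -
    have bound: "real n * (norm \<delta> * r) \<le> norm A * (1 + (1 / 2) ^ (m + 2)) ^ n" for m
    proof -
      define g where "g z = (1 + scal z * (- M)) ^ n * A * geom (Suc m) (scal z * M) ^ n" for z
      have "op_poly g (1 * A * 1) (1 * A * (real n *\<^sub>R M) + (1 * 0 + real n *\<^sub>R (- M) * A) * 1)"
        unfolding g_def
        by (intro op_poly_mult op_poly_power op_poly_geom op_poly_linear op_poly_const)
      then have "op_poly g A (real n *\<^sub>R \<delta>)" by (simp add: \<delta>_def algebra_simps)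
      moreover have "norm (g z) \<le> norm A * (1 + (1 / 2) ^ (m + 2)) ^ n" if z: "cmod z = r" for z
      proof -
        define X where "X = scal z * M"
        define Y where "Y = 1 - X"
        define Q where "Q = geom (Suc m) X"
        have XN: "comm (adj X) X" "comm A (adj X)"
          using normal AN
          by (auto simp: X_def M_def intro!: comm_intros intro: comm_sym)
        have YN: "comm Y (adj Y)" "comm A (adj Y)" "comm (adj Y) Q"
          using XN by (auto simp: Y_def Q_def intro!: comm_intros comm_geom
              intro: comm_sym[OF comm_diff] comm_sym comm_one)
        have "norm (g z) = norm (Y ^ n * (A * Q ^ n))"
          by (simp add: g_def Y_def X_def Q_def mult.assoc)
        \<comment> \<open>Normality trades \<open>Y\<close> for its adjoint, which commutes with \<open>A\<close>.\<close>
        also have "\<dots> = norm (adj (Y ^ n) * (A * Q ^ n))"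
          using YN(1) by (intro norm_adj_mult_normal[symmetric])
            (metis adj_power comm_power comm_sym)
        also have "adj (Y ^ n) * (A * Q ^ n) = A * (adj Y * Q) ^ n"
          using comm_power[OF YN(2), of n] comm_power_mult[OF YN(3), of n]
          by (simp add: comm_def mult.assoc[symmetric])
        also have "norm \<dots> \<le> norm A * norm (adj Y * Q) ^ n"
          by (rule order_trans[OF norm_mult_ineq mult_left_mono[OF norm_power_le]]) simp
        also have "norm (adj Y * Q) = norm (1 - X ^ Suc (Suc m))"
          unfolding norm_adj_mult_normal[OF YN(1)] by (simp only: Y_def Q_def geom_telescope)
        also have "norm A * \<dots> ^ n \<le> norm A * (1 + (1 / 2) ^ (m + 2)) ^ n"
        proof -
          have "norm X \<le> 1 / 2" using r z by (simp add: X_def M_def)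
          then have "norm X ^ Suc (Suc m) \<le> (1 / 2) ^ (m + 2)"
            using power_mono[of "norm X" "1/2" "m + 2"] by simp
          then have "norm (1 - X ^ Suc (Suc m)) \<le> 1 + (1 / 2) ^ (m + 2)"
            using norm_triangle_ineq4[of 1 "X ^ Suc (Suc m)"] norm_one_le
              norm_power_le[of X "Suc (Suc m)"] by (smt (verit))
          then show ?thesis by (intro mult_left_mono power_mono) auto
        qed
        finally show ?thesis .
      qed
      ultimately have "norm (real n *\<^sub>R \<delta>) * r \<le> norm A * (1 + (1 / 2) ^ (m + 2)) ^ n"
        using r by (intro op_poly_linear_coeff_bound) auto
      then show ?thesis by simp
    qed
    have "(\<lambda>m. norm A * (1 + (1 / 2) ^ (m + 2)) ^ n) \<longlonglongrightarrow> norm A * (1 + 0) ^ n"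
      by (intro tendsto_intros LIMSEQ_ignore_initial_segment LIMSEQ_power_zero) simp
    then show ?thesis using bound
      by (intro LIMSEQ_le_const[of _ "norm A"]) auto
  qed
  have "norm \<delta> * r = 0"
    using r est by (intro real_archimedian_rdiv_eq_0[of _ "norm A"]) auto
  then show ?thesis using r by (simp add: \<delta>_def comm_def M_def)
qed

section \<open>Square roots and inverses of positive operators\<close>

text \<open>The iteration \<open>W = (X + W\<^sup>2) / 2\<close>, whose fixed point yields the square root \<open>1 - W\<close> of \<open>1 - X\<close>. The
iterates are polynomials in \<open>X\<close> with nonnegative coefficients, so all norms are dominated by the
values of the same iteration at the scalar \<open>X = 1\<close>.\<close>

primrec sqrt_iter :: "'a::complex_hilbert bop \<Rightarrow> nat \<Rightarrow> 'a bop" where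
  "sqrt_iter X 0 = 0"
| "sqrt_iter X (Suc n) = (1 / 2) *\<^sub>R (X + sqrt_iter X n * sqrt_iter X n)"

primrec sqrt_iter_bound :: "nat \<Rightarrow> real" where
  "sqrt_iter_bound 0 = 0"
| "sqrt_iter_bound (Suc n) = (1 + (sqrt_iter_bound n)\<^sup>2) / 2"

lemma sqrt_iter_bound_range: "0 \<le> sqrt_iter_bound n \<and> sqrt_iter_bound n \<le> 1"
  by (induction n) (auto simp: power_le_one)

lemma sqrt_iter_bound_mono: "sqrt_iter_bound n \<le> sqrt_iter_bound (Suc n)"
  using zero_le_power2[of "1 - sqrt_iter_bound n"] by (simp add: power2_eq_square algebra_simps)

lemma summable_sqrt_iter_bound: "summable (\<lambda>n. sqrt_iter_bound (Suc n) - sqrt_iter_bound n)"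
proof -
  have "convergent sqrt_iter_bound"
    using sqrt_iter_bound_range
    by (intro Bseq_monoseq_convergent BseqI'[of _ 1])
      (auto simp: monoseq_Suc simp del: sqrt_iter_bound.simps intro: sqrt_iter_bound_mono)
  then show ?thesis unfolding convergent_def using telescope_summable by blast
qed

lemma comm_sqrt_iter: "comm R X \<Longrightarrow> comm R (sqrt_iter X n)"
  by (induction n) (simp_all add: comm_intros)

lemma adj_sqrt_iter: "adj X = X \<Longrightarrow> adj (sqrt_iter X n) = sqrt_iter X n"
  by (induction n) simp_all

lemma norm_sqrt_iter_le: "norm (sqrt_iter X n) \<le> sqrt_iter_bound n" if "norm X \<le> 1"
proof (induction n)
  case (Suc n)
  have "norm (X + sqrt_iter X n * sqrt_iter X n)
      \<le> norm X + norm (sqrt_iter X n) * norm (sqrt_iter X n)"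
    by (rule order_trans[OF norm_triangle_ineq add_left_mono[OF norm_mult_ineq]])
  also have "\<dots> \<le> 1 + sqrt_iter_bound n * sqrt_iter_bound n"
    using that Suc by (intro add_mono mult_mono) (auto simp: sqrt_iter_bound_range)
  finally show ?case by (simp add: power2_eq_square)
qed simp

lemma norm_sqrt_iter_diff_le:
  assumes "norm X \<le> 1"
  shows "norm (sqrt_iter X (Suc n) - sqrt_iter X n) \<le> sqrt_iter_bound (Suc n) - sqrt_iter_bound n"
proof (induction n)
  case 0
  then show ?case using assms by simp
next
  case (Suc n)
  define Y Y' where "Y = sqrt_iter X n" and "Y' = sqrt_iter X (Suc n)"
  define s s' where "s = sqrt_iter_bound n" and "s' = sqrt_iter_bound (Suc n)"
  have "comm Y' Y"
    unfolding Y_def Y'_def by (intro comm_sqrt_iter comm_sym[OF comm_sqrt_iter] comm_refl)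
  then have "sqrt_iter X (Suc (Suc n)) - Y' = (1 / 2) *\<^sub>R ((Y' - Y) * (Y' + Y))"
    by (simp add: Y_def Y'_def comm_def algebra_simps)
  also have "norm \<dots> \<le> (1 / 2) * (norm (Y' - Y) * norm (Y' + Y))"
    by (simp add: norm_mult_ineq)
  also have "\<dots> \<le> (1 / 2) * ((s' - s) * (s' + s))"
  proof -
    have "norm (Y' - Y) \<le> s' - s" using Suc by (simp add: Y_def Y'_def s_def s'_def)
    moreover have "norm (Y' + Y) \<le> s' + s"
      using norm_triangle_le[OF add_mono[OF norm_sqrt_iter_le[OF assms] norm_sqrt_iter_le[OF assms]]]
      unfolding Y_def Y'_def s_def s'_def by blast
    moreover have "0 \<le> s' - s" using calculation(1) norm_ge_zero order_trans by blast
    ultimately show ?thesis by (intro mult_left_mono mult_mono) simp_all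
  qed
  also have "\<dots> = sqrt_iter_bound (Suc (Suc n)) - s'"
    by (simp add: s_def s'_def power2_eq_square field_simps)
  finally show ?case by (simp add: Y'_def s'_def)
qed

text \<open>The hypothesis says \<open>0 \<le> T \<le> 2\<close>, and the third conclusion gives in particular that \<open>Y\<close> is positive
(see \<open>inner_app_nonneg\<close>). As a norm limit of polynomials in \<open>T\<close>, the root commutes with everything
that commutes with \<open>T\<close>.\<close>

lemma op_sqrt:
  assumes sa: "adj T = T" and T: "norm (1 - T) \<le> 1"
  obtains Y where "adj Y = Y" "Y * Y = T" "norm (1 - Y) \<le> 1" "\<And>R. comm R T \<Longrightarrow> comm R Y"
proof -
  define X where "X = 1 - T"
  define Z where "Z = sqrt_iter X"
  have X: "norm X \<le> 1" "adj X = X" using assms by (simp_all add: X_def)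
  have "summable (\<lambda>n. Z (Suc n) - Z n)"
    unfolding Z_def
    by (rule summable_comparison_test'[OF summable_sqrt_iter_bound norm_sqrt_iter_diff_le[OF X(1)]])
  then have "(\<lambda>n. \<Sum>k<n. Z (Suc k) - Z k) \<longlonglongrightarrow> (\<Sum>k. Z (Suc k) - Z k)"
    by (rule summable_LIMSEQ)
  then obtain W where W: "Z \<longlonglongrightarrow> W"
    unfolding sum_lessThan_telescope by (auto simp: Z_def)
  have "(\<lambda>n. Z (Suc n)) \<longlonglongrightarrow> (1 / 2) *\<^sub>R (X + W * W)"
    unfolding Z_def sqrt_iter.simps using W by (intro tendsto_intros) (simp_all add: Z_def)
  then have eq: "W = (1 / 2) *\<^sub>R (X + W * W)"
    using LIMSEQ_Suc[OF W] LIMSEQ_unique by blast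
  have nW: "norm W \<le> 1"
  proof (rule Lim_norm_ubound[OF _ W])
    show "\<forall>\<^sub>F n in sequentially. norm (Z n) \<le> 1"
      unfolding Z_def
      using order_trans[OF norm_sqrt_iter_le[OF X(1)] conjunct2[OF sqrt_iter_bound_range]]
      by (intro always_eventually allI)
  qed simp
  have aW: "adj W = W"
    using tendsto_adj[OF W] adj_sqrt_iter[OF X(2)] W LIMSEQ_unique by (simp add: Z_def) blast
  show ?thesis
  proof (rule that[of "1 - W"])
    have "2 *\<^sub>R W = X + W * W" by (subst eq) simp
    then have "W + W = X + W * W" by (simp add: scaleR_2)
    then show "(1 - W) * (1 - W) = T" by (simp add: X_def algebra_simps)
    show "comm R (1 - W)" if "comm R T" for R
    proof -
      have "comm R (Z n)" for n
        unfolding Z_def X_def using that by (intro comm_sqrt_iter comm_intros)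
      then show ?thesis using comm_limit[OF W] by (simp add: comm_intros)
    qed
  qed (use nW aW in simp_all)
qed

lemma inner_app_nonneg: "0 \<le> inner (app Y x) x" if "norm (1 - Y) \<le> 1"
proof -
  have "inner (app (1 - Y) x) x \<le> norm (app (1 - Y) x) * norm x" by (rule norm_cauchy_schwarz)
  also have "\<dots> \<le> (norm (1 - Y) * norm x) * norm x" by (rule mult_right_mono[OF norm_app_le]) simp
  also have "\<dots> \<le> inner x x"
    using that mult_right_mono[of "norm (1 - Y)" 1 "norm x * norm x"]
    by (simp add: dot_square_norm power2_eq_square mult.assoc)
  finally show ?thesis by (simp add: app_simps inner_diff_left)
qed

text \<open>With a root \<open>z\<close> of \<open>s\<close> that commutes with \<open>r\<close>, one has \<open>\<langle>r x, s x\<rangle> = \<langle>r z x, z x\<rangle>\<close>: the product of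
commuting positive operators is positive.\<close>

lemma inner_app_app_nonneg:
  assumes r: "norm (1 - r) \<le> 1" and s: "adj s = s" "norm (1 - s) \<le> 1" and rs: "comm r s"
  shows "0 \<le> inner (app r x) (app s x)"
proof -
  obtain z where z: "adj z = z" "z * z = s" "comm r z"
    using op_sqrt[OF s] rs by metis
  have "inner (app r x) (app s x) = inner (app (z * r) x) (app z x)"
    unfolding z(2)[symmetric] by (simp add: app_mult inner_app_left z(1))
  also have "\<dots> = inner (app r (app z x)) (app z x)"
    using z(3) by (simp add: comm_def app_mult[symmetric])
  finally show ?thesis using inner_app_nonneg[OF r] by simp
qed

lemma norm_one_minus_adj_mult_self_le: "norm (1 - adj A * A) \<le> 1" if "norm A \<le> 1"
proof (rule norm_bop_le)
  fix x
  have "norm (app (adj A) (app A x)) \<le> norm (app A x)"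
    using that norm_app_le[of "adj A" "app A x"] mult_right_mono[of "norm A" 1 "norm (app A x)"]
    by simp
  then have "(norm (app (adj A) (app A x)))\<^sup>2 \<le> (norm (app A x))\<^sup>2" by (rule power_mono) simp
  moreover have "(norm (app (1 - adj A * A) x))\<^sup>2
      = (norm x)\<^sup>2 - 2 * (norm (app A x))\<^sup>2 + (norm (app (adj A) (app A x)))\<^sup>2"
    unfolding norm_app_sq
    by (simp add: power2_norm_eq_inner app_simps inner_diff_left inner_diff_right inner_app_left
        inner_commute)
  ultimately have "(norm (app (1 - adj A * A) x))\<^sup>2 \<le> (norm x)\<^sup>2"
    using zero_le_power2[of "norm (app A x)"] by linarith
  then have "norm (app (1 - adj A * A) x) \<le> norm x" by (rule power2_le_imp_le) simp
  then show "norm (app (1 - adj A * A) x) \<le> 1 * norm x" by simp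
qed simp

text \<open>For a suitable \<open>t > 0\<close> the operator \<open>1 - t D\<close> is a strict contraction, and the Neumann series inverts
\<open>t D\<close>.\<close>

lemma coercive_invertible:
  fixes D :: "'a::complex_hilbert bop"
  assumes c: "0 < c" and D: "\<And>x. c * (norm x)\<^sup>2 \<le> inner (app D x) x"
  obtains E where "D * E = 1" "E * D = 1"
proof -
  \<comment> \<open>Adding \<open>c\<close> keeps \<open>L\<close> positive on the zero space, where \<open>D = 0\<close>.\<close>
  define L where "L = norm D + c"
  \<comment> \<open>This \<open>t\<close> minimizes the bound \<open>1 - 2 t c + t\<^sup>2 L\<^sup>2\<close> for the square of the norm of \<open>1 - t D\<close>.\<close>
  define t where "t = c / L\<^sup>2"
  define X where "X = 1 - t *\<^sub>R D"
  define \<rho> where "\<rho> = sqrt (1 - (c / L)\<^sup>2)"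
  have L: "0 < L" "norm D \<le> L" "c \<le> L" using c by (simp_all add: L_def add_nonneg_pos)
  have t: "0 < t" using c L by (simp add: t_def)
  have "0 < (c / L)\<^sup>2" "(c / L)\<^sup>2 \<le> 1" using c L by (auto simp: power_le_one)
  then have \<rho>: "0 \<le> \<rho>" "\<rho> < 1" "\<rho>\<^sup>2 = 1 - (c / L)\<^sup>2" by (simp_all add: \<rho>_def real_less_lsqrt)
  have "norm X \<le> \<rho>"
  proof (rule norm_bop_le)
    fix x
    have "(norm (app D x))\<^sup>2 \<le> (L * norm x)\<^sup>2"
      using order_trans[OF norm_app_le mult_right_mono[OF L(2)]] by (intro power_mono) auto
    then have "t\<^sup>2 * (norm (app D x))\<^sup>2 \<le> t\<^sup>2 * (L * norm x)\<^sup>2" by (rule mult_left_mono) simp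
    moreover have "2 * t * (c * (norm x)\<^sup>2) \<le> 2 * t * inner (app D x) x"
      using t D by (intro mult_left_mono) auto
    moreover have "(norm (app X x))\<^sup>2
        = (norm x)\<^sup>2 - 2 * t * inner (app D x) x + t\<^sup>2 * (norm (app D x))\<^sup>2"
      by (simp add: X_def power2_norm_eq_inner app_simps inner_diff_left inner_diff_right
          inner_commute power2_eq_square[of t])
    moreover have "(norm x)\<^sup>2 - 2 * t * (c * (norm x)\<^sup>2) + t\<^sup>2 * (L * norm x)\<^sup>2 = (\<rho> * norm x)\<^sup>2"
      unfolding power_mult_distrib \<rho>(3) t_def using L by (simp add: field_simps power2_eq_square)
    ultimately have "(norm (app X x))\<^sup>2 \<le> (\<rho> * norm x)\<^sup>2" by linarith
    then show "norm (app X x) \<le> \<rho> * norm x" by (rule power2_le_imp_le) (simp add: \<rho>(1))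
  qed (rule \<rho>)
  then have "norm (X ^ n) \<le> \<rho> ^ n" for n
    using norm_power_le[of X n] power_mono[of "norm X" \<rho> n] by simp
  then have X: "summable (\<lambda>n. X ^ n)"
    using \<rho>(1,2) by (intro summable_comparison_test'[OF summable_geometric[of \<rho>]]) simp_all
  define S where "S = (\<Sum>n. X ^ n)"
  have "S = 1 + (\<Sum>n. X ^ Suc n)" using suminf_split_head[OF X] by (simp add: S_def)
  moreover have "(\<Sum>n. X ^ Suc n) = X * S"
    unfolding S_def by (simp add: suminf_mult[OF X])
  moreover have "(\<Sum>n. X ^ Suc n) = S * X"
    unfolding S_def power_Suc2 by (simp add: suminf_mult2[OF X])
  ultimately have "(1 - X) * S = 1" "S * (1 - X) = 1" by (simp_all add: algebra_simps)
  then have "D * (t *\<^sub>R S) = 1" "(t *\<^sub>R S) * D = 1" by (simp_all add: X_def)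
  then show ?thesis by (rule that)
qed

lemma comm_inverse: "comm R E" if "D * E = 1" "E * D = 1" "comm R D"
proof -
  have "R * E = E * (D * R) * E" by (simp add: mult.assoc[symmetric] that(2))
  also have "D * R = R * D" using that(3) by (simp add: comm_def)
  also have "E * (R * D) * E = E * R" by (simp add: mult.assoc that(1))
  finally show ?thesis by (simp add: comm_def)
qed

section \<open>The sum of two moduli\<close>

lemma op_binomial:
  assumes "comm S T"
  shows "(S + T) ^ n = (\<Sum>k\<le>n. real (n choose k) *\<^sub>R (S ^ (n - k) * T ^ k))"
proof (induction n)
  case (Suc n)
  define b where "b n k = real (n choose k) *\<^sub>R (S ^ (n - k) * T ^ k)" for n k
  have TS: "T * (S ^ i * U) = S ^ i * (T * U)" for i U
    using comm_power[OF comm_sym[OF assms], of i] by (simp add: comm_def mult.assoc[symmetric])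
  have "b (Suc n) (Suc k) = S * b n (Suc k) + T * b n k" if "k \<le> n" for k
  proof (cases "k = n")
    case False
    with that have "Suc (n - Suc k) = n - k" by simp
    then have "S * S ^ (n - Suc k) = S ^ (n - k)" by (metis power_Suc)
    then show ?thesis
      by (simp add: b_def TS scaleR_left_distrib mult.assoc[symmetric] add.commute)
        (simp add: mult.assoc TS)
  qed (simp add: b_def)
  then have "(\<Sum>k\<le>n. b (Suc n) (Suc k)) = (\<Sum>k\<le>n. S * b n (Suc k)) + (\<Sum>k\<le>n. T * b n k)"
    by (simp add: sum.distrib)
  moreover have "b (Suc n) 0 + (\<Sum>k\<le>n. S * b n (Suc k)) = S * (\<Sum>k\<le>n. b n k)"
  proof -
    have "b (Suc n) 0 + (\<Sum>k\<le>n. S * b n (Suc k)) = (\<Sum>k\<le>Suc n. S * b n k)"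
      by (subst sum.atMost_Suc_shift) (simp add: b_def)
    then show ?thesis by (simp add: b_def sum_distrib_left)
  qed
  ultimately have "(\<Sum>k\<le>Suc n. b (Suc n) k) = S * (\<Sum>k\<le>n. b n k) + T * (\<Sum>k\<le>n. b n k)"
    by (subst sum.atMost_Suc_shift) (simp add: sum_distrib_left add.assoc[symmetric])
  with Suc show ?case by (simp add: b_def distrib_right)
qed simp

lemma norm_selfadjoint_power:
  assumes "adj H = H"
  shows "norm (H ^ (2 ^ k)) = norm H ^ (2 ^ k)"
proof (induction k)
  case (Suc k)
  have "norm (H ^ (2 ^ Suc k)) = norm (adj (H ^ (2 ^ k)) * H ^ (2 ^ k))"
    using assms by (simp add: mult_2 power_add)
  then show ?case unfolding norm_adj_mult_self Suc by (simp add: power_mult[symmetric] mult.commute)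
qed simp

text \<open>For self-adjoint \<open>H\<close> the \<open>2\<^sup>k\<close>-th powers satisfy \<open>\<parallel>H\<^sup>m\<parallel> = \<parallel>H\<parallel>\<^sup>m\<close>, which would grow exponentially if
\<open>\<parallel>H\<parallel> > 1\<close>.\<close>

lemma norm_le_one_if_powers_linear:
  assumes H: "adj H = H" and bd: "\<And>n. norm (H ^ n) \<le> real n + 1"
  shows "norm H \<le> 1"
proof (rule ccontr)
  assume "\<not> norm H \<le> 1"
  define d where "d = norm H - 1"
  then have d: "d > 0" "norm H = 1 + d" using \<open>\<not> norm H \<le> 1\<close> by simp_all
  \<comment> \<open>Comparing \<open>(1 + q d)\<^sup>2 \<le> \<parallel>H\<parallel>\<^sup>2\<^sup>q \<le> 2 q + 1\<close> for a power \<open>q\<close> of two gives \<open>q d\<^sup>2 < 2\<close>.\<close>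
  obtain m :: nat where m: "2 / d\<^sup>2 < real m" using reals_Archimedean2 by blast
  define q :: nat where "q = 2 ^ m"
  have q: "real m \<le> real q" unfolding q_def by (simp add: less_imp_le)
  have "(1 + real q * d)\<^sup>2 \<le> ((1 + d) ^ q)\<^sup>2"
    using Bernoulli_inequality[of d q] d by (intro power_mono) (auto simp: mult.commute)
  also have "\<dots> = norm (H ^ (2 ^ Suc m))"
    unfolding norm_selfadjoint_power[OF H] d by (simp add: q_def power_mult[symmetric] mult.commute)
  also have "\<dots> \<le> 2 * real q + 1" using bd[of "2 ^ Suc m"] by (simp add: q_def)
  finally have "real q * (real q * d\<^sup>2 + 2 * d) \<le> real q * 2"
    by (simp add: power2_eq_square algebra_simps)
  then have "real q * d\<^sup>2 + 2 * d \<le> 2" by (simp add: q_def)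
  then have "real q * d\<^sup>2 < 2" using d by simp
  moreover have "2 < real m * d\<^sup>2" using m d by (simp add: field_simps)
  ultimately show False using mult_right_mono[OF q, of "d\<^sup>2"] by simp
qed

lemma norm_mult_powers_sq:
  assumes A: "comm A (adj A)" and B: "comm B (adj B)" and AB: "comm A B" "comm A (adj B)"
  shows "(norm (A ^ i * B ^ j))\<^sup>2 = norm ((adj A * A) ^ i * (adj B * B) ^ j)"
proof -
  have BA: "comm (adj B) (adj A)" "comm B (adj A)"
    using AB comm_adj[of A B] comm_adj[of A "adj B"] by (simp_all add: comm_sym)
  have "(norm (A ^ i * B ^ j))\<^sup>2 = norm (adj B ^ j * (adj A ^ i * A ^ i) * B ^ j)"
    by (simp add: norm_adj_mult_self[symmetric] mult.assoc)
  also have "adj A ^ i * A ^ i = (adj A * A) ^ i"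
    using A by (simp add: comm_power_mult comm_sym)
  also have "adj B ^ j * (adj A * A) ^ i * B ^ j = (adj A * A) ^ i * (adj B ^ j * B ^ j)"
  proof -
    have "comm ((adj A * A) ^ i) (adj B ^ j)"
      using BA AB by (intro comm_power comm_sym[OF comm_power] comm_mult) (auto intro: comm_sym)
    then show ?thesis by (simp add: comm_def mult.assoc[symmetric])
  qed
  also have "adj B ^ j * B ^ j = (adj B * B) ^ j"
    using B by (simp add: comm_power_mult comm_sym)
  finally show ?thesis .
qed

text \<open>If \<open>p\<close> and \<open>q\<close> are self-adjoint square roots of \<open>A\<^sup>* A\<close> and \<open>B\<^sup>* B\<close>, such as the moduli of \<open>A\<close> and \<open>B\<close> up to sign, then
\<open>\<parallel>p\<^sup>i q\<^sup>j\<parallel> = \<parallel>A\<^sup>i B\<^sup>j\<parallel>\<close>. Each binomial term of \<open>(A + z B)\<^sup>n\<close> has norm at most 1 by Cauchy's estimate, so the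
\<open>n + 1\<close> terms of \<open>(p + q)\<^sup>n\<close> give \<open>\<parallel>(p + q)\<^sup>n\<parallel> \<le> n + 1\<close>, and the linear growth forces \<open>\<parallel>p + q\<parallel> \<le> 1\<close>. This
replaces the pointwise choice of a phase \<open>z\<close> with \<open>\<bar>a + z b\<bar> = \<bar>a\<bar> + \<bar>b\<bar>\<close> in a functional calculus.\<close>

lemma norm_modulus_sum_le:
  fixes A B p q :: "'a::complex_hilbert bop"
  assumes A: "comm A (adj A)" and B: "comm B (adj B)" and AB: "comm A B" "comm A (adj B)"
    and bd: "\<And>z. cmod z = 1 \<Longrightarrow> norm (A + scal z * B) \<le> 1"
    and p: "adj p = p" "p * p = adj A * A" and q: "adj q = q" "q * q = adj B * B" and pq: "comm p q"
  shows "norm (p + q) \<le> 1"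
proof (rule norm_le_one_if_powers_linear)
  fix n
  have le1: "real (n choose k) * norm (p ^ (n - k) * q ^ k) \<le> 1" if "k \<le> n" for k
  proof -
    have "norm (\<Sum>k<Suc n. scal (z ^ k) * (real (n choose k) *\<^sub>R (A ^ (n - k) * B ^ k))) \<le> 1"
      if z: "cmod z = 1" for z
    proof -
      have "comm A (scal z * B)" using AB by (intro comm_intros)
      then have "(A + scal z * B) ^ n
          = (\<Sum>k\<le>n. real (n choose k) *\<^sub>R (A ^ (n - k) * (scal z * B) ^ k))"
        by (rule op_binomial)
      also have "\<dots> = (\<Sum>k<Suc n. scal (z ^ k) * (real (n choose k) *\<^sub>R (A ^ (n - k) * B ^ k)))"
        unfolding lessThan_Suc_atMost
      proof (rule sum.cong[OF refl])
        fix k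
        have "(scal z * B) ^ k = scal (z ^ k) * B ^ k"
          using comm_power_mult[of "scal z" B k] by (simp add: comm_def scal_commute scal_power)
        then show "real (n choose k) *\<^sub>R (A ^ (n - k) * (scal z * B) ^ k)
            = scal (z ^ k) * (real (n choose k) *\<^sub>R (A ^ (n - k) * B ^ k))"
          by simp (metis mult.assoc scal_commute)
      qed
      finally show ?thesis
        using norm_power_le[of "A + scal z * B" n] power_le_one[OF norm_ge_zero bd[OF z], of n]
        by simp
    qed
    then have "norm (real (n choose k) *\<^sub>R (A ^ (n - k) * B ^ k)) * 1 ^ k \<le> 1"
      by (rule op_poly_coeff_bound) (use that in auto)
    moreover have "(norm (p ^ (n - k) * q ^ k))\<^sup>2 = (norm (A ^ (n - k) * B ^ k))\<^sup>2"
      using norm_mult_powers_sq[OF A B AB, of "n - k" k] norm_mult_powers_sq[of p q "n - k" k] p q pq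
      by (simp add: comm_refl)
    then have "norm (p ^ (n - k) * q ^ k) = norm (A ^ (n - k) * B ^ k)"
      by (simp add: power2_eq_iff_nonneg)
    ultimately show ?thesis by simp
  qed
  have "norm ((p + q) ^ n) \<le> (\<Sum>k\<le>n. norm (real (n choose k) *\<^sub>R (p ^ (n - k) * q ^ k)))"
    unfolding op_binomial[OF pq] by (rule norm_sum)
  also have "\<dots> \<le> (\<Sum>k\<le>n. 1)" using le1 by (intro sum_mono) auto
  finally show "norm ((p + q) ^ n) \<le> real n + 1" by simp
qed (simp add: p q)

section \<open>The operator Fejer-Riesz factorization\<close>

lemma norm_mult_eq_if_adj_mult_self_eq:
  assumes "adj S * S = adj T * T"
  shows "norm (S * V) = norm (T * V)"
proof -
  have "(norm (S * V))\<^sup>2 = norm (adj V * (adj S * S) * V)"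
    by (simp add: norm_adj_mult_self[symmetric] mult.assoc)
  also have "\<dots> = (norm (T * V))\<^sup>2"
    unfolding assms by (simp add: norm_adj_mult_self[symmetric] mult.assoc)
  finally show ?thesis by (simp add: power2_eq_iff_nonneg)
qed

lemma norm_mult_le_if_app_le:
  assumes "\<And>v. norm (app S v) \<le> norm (app T v)"
  shows "norm (S * V) \<le> norm (T * V)"
proof (rule norm_bop_le)
  show "norm (app (S * V) x) \<le> norm (T * V) * norm x" for x
    using order_trans[OF assms norm_app_le[of "T * V" x, unfolded app_mult]] by (simp add: app_mult)
qed simp

lemma norm_pencil_coeffs_le:
  assumes "\<And>z. cmod z = 1 \<Longrightarrow> norm (A + scal z * B) \<le> b"
  shows "norm A \<le> b" "norm B \<le> b"
proof -
  have "norm ((if k = 0 then A else B)) * 1 ^ k \<le> b" if "k < 2" for k :: nat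
    by (rule op_poly_coeff_bound[where n = 2]) (use that assms in \<open>auto simp: eval_nat_numeral\<close>)
  from this[of 0] this[of 1] show "norm A \<le> b" "norm B \<le> b" by simp_all
qed

text \<open>The quotient \<open>L = K / G\<close> exists although \<open>G\<close> need not be invertible, because \<open>\<bar>K\<bar> = \<bar>w G\<bar>\<close> with
\<open>w \<le> G\<close>: the approximants \<open>K (G + \<epsilon>)\<^sup>-\<^sup>1\<close> satisfy
\<open>\<parallel>K (G + \<epsilon>)\<^sup>-\<^sup>1 - K (G + \<delta>)\<^sup>-\<^sup>1\<parallel> \<le> \<bar>\<epsilon> - \<delta>\<bar>\<close> and so converge in norm, which keeps all commutation
relations.\<close>

lemma regularized_quotient:
  fixes G w K :: "'a::complex_hilbert bop"
  assumes G: "adj G = G" "\<And>x. 0 \<le> inner (app G x) x"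
    and w: "adj w = w" "\<And>x. norm (app w x) \<le> norm (app G x)"
    and K: "adj K * K = (w * G) * (w * G)"
    and GwK: "comm G w" "comm G K" 
  obtains L where "G * L = K" "adj L * L = w * w" "\<And>R. comm R G \<Longrightarrow> comm R K \<Longrightarrow> comm R L"
proof -
  define e where "e n = 1 / real (Suc n)" for n
  have e: "e n > 0" for n by (simp add: e_def)
  have e0: "e \<longlonglongrightarrow> 0" unfolding e_def by (rule LIMSEQ_Suc[OF lim_1_over_n])
  have "\<exists>E. (G + e n *\<^sub>R 1) * E = 1 \<and> E * (G + e n *\<^sub>R 1) = 1" for n
  proof (rule coercive_invertible[of "e n" "G + e n *\<^sub>R 1"])
    show "e n * (norm x)\<^sup>2 \<le> inner (app (G + e n *\<^sub>R 1) x) x" for x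
      using G(2)[of x] by (simp add: app_simps inner_add_left power2_norm_eq_inner)
  qed (use e in auto)
  then obtain E where E: "\<And>n. (G + e n *\<^sub>R 1) * E n = 1" "\<And>n. E n * (G + e n *\<^sub>R 1) = 1" by metis
  have EC: "comm R (E n)" if "comm R G" for R n
    by (rule comm_inverse[OF E]) (use that in \<open>intro comm_intros\<close>)
  have GE: "G * E n = 1 - e n *\<^sub>R E n" for n
    using E(1)[of n] by (simp add: distrib_right eq_diff_eq)
  have aE: "adj (E n) = E n" for n
  proof -
    have "adj (E n) = adj (E n) * adj (G + e n *\<^sub>R 1) * E n"
      using E(1)[of n] by (simp add: G(1) mult.assoc)
    also have "adj (E n) * adj (G + e n *\<^sub>R 1) = 1" by (metis E(1) adj_mult adj_one)
    finally show ?thesis by simp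
  qed
  have contr: "norm (app (G * E n) v) \<le> norm (app 1 v)" for n v
  proof -
    define u where "u = app (E n) v"
    have v: "v = app G u + e n *\<^sub>R u"
      using arg_cong[OF E(1)[of n], of "\<lambda>T. app T v"] by (simp add: u_def app_simps)
    have "(norm v)\<^sup>2 = (norm (app G u))\<^sup>2 + 2 * e n * inner (app G u) u + (e n)\<^sup>2 * (norm u)\<^sup>2"
      unfolding v power2_norm_eq_inner
      by (simp add: inner_add_left inner_add_right inner_commute power2_eq_square algebra_simps)
    then have "(norm (app G u))\<^sup>2 \<le> (norm v)\<^sup>2"
      using G(2)[of u] e[of n] by (simp add: mult_nonneg_nonneg less_imp_le)
    then have "norm (app G u) \<le> norm v" by (rule power2_le_imp_le) simp
    then show ?thesis by (simp add: u_def app_mult)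
  qed
  note ctr = norm_mult_le_if_app_le[OF contr, simplified]
  \<comment> \<open>The bound \<open>w \<le> G\<close> pays for one factor \<open>(G + \<epsilon>)\<^sup>-\<^sup>1\<close>, and \<open>w G\<close> therefore for two.\<close>
  have wG: "norm (w * V) \<le> norm (G * V)" for V by (rule norm_mult_le_if_app_le) (rule w)
  have KV: "norm (K * V) = norm (w * G * V)" for V
    by (rule norm_mult_eq_if_adj_mult_self_eq)
      (use K w(1) G(1) GwK(1) in \<open>simp add: comm_def\<close>)
  define X where "X n = K * E n" for n
  have diff: "norm (X n - X m) \<le> \<bar>e n - e m\<bar>" for n m
  proof -
    have "E n - E m = E n * ((G + e m *\<^sub>R 1) - (G + e n *\<^sub>R 1)) * E m"
    proof -
      have "E n * (S - T) * E m = E n * (S * E m) - (E n * T) * E m" for S T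
        by (simp add: algebra_simps)
      from this[of "G + e m *\<^sub>R 1" "G + e n *\<^sub>R 1"] show ?thesis by (simp only: E mult_1_left mult_1_right)
    qed
    also have "\<dots> = (e m - e n) *\<^sub>R (E n * E m)"
      by (simp add: scaleR_left_diff_distrib algebra_simps)
    finally have "X n - X m = (e m - e n) *\<^sub>R (K * (E n * E m))"
      by (simp add: X_def right_diff_distrib[symmetric])
    then have nX: "norm (X n - X m) = \<bar>e n - e m\<bar> * norm (w * G * (E n * E m))"
      by (simp add: KV abs_minus_commute)
    have "norm (w * G * (E n * E m)) \<le> norm (G * (G * (E n * E m)))"
      using wG by (simp add: mult.assoc)
    also have "G * (G * (E n * E m)) = (G * E n) * ((G * E m) * 1)"
      using EC[of G n] by (simp add: comm_def comm_refl) (metis mult.assoc)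
    also have "norm \<dots> \<le> 1"
      using order_trans[OF ctr order_trans[OF ctr norm_one_le]] by (simp add: mult.assoc)
    finally show ?thesis unfolding nX by (rule mult_left_le) simp
  qed
  have "Cauchy X"
  proof (rule metric_CauchyI)
    fix d :: real assume "0 < d"
    then obtain N where "\<forall>m\<ge>N. \<forall>n\<ge>N. dist (e m) (e n) < d"
      using metric_CauchyD[OF LIMSEQ_imp_Cauchy[OF e0]] by blast
    then show "\<exists>N. \<forall>m\<ge>N. \<forall>n\<ge>N. dist (X m) (X n) < d"
      using diff unfolding dist_norm real_norm_def by (meson le_less_trans)
  qed
  then obtain L where L: "X \<longlonglongrightarrow> L" by (auto simp: Cauchy_convergent_iff convergent_def)
  show ?thesis
  proof
    have "G * X n = K - e n *\<^sub>R X n" for n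
    proof -
      have "G * X n = K * (G * E n)" using GwK(2) by (simp add: X_def comm_def mult.assoc[symmetric])
      then show ?thesis by (simp add: GE X_def right_diff_distrib)
    qed
    moreover have "(\<lambda>n. K - e n *\<^sub>R X n) \<longlonglongrightarrow> K - 0 *\<^sub>R L" by (intro tendsto_intros e0 L)
    ultimately have "(\<lambda>n. G * X n) \<longlonglongrightarrow> K" by simp
    moreover have "(\<lambda>n. G * X n) \<longlonglongrightarrow> G * L" by (intro tendsto_intros L)
    ultimately show "G * L = K" by (rule LIMSEQ_unique[symmetric])
  next
    have wGE: "w * G * E n = w - e n *\<^sub>R (w * E n)" for n
      by (simp add: mult.assoc GE right_diff_distrib)
    have "(\<lambda>n. e n *\<^sub>R (w * E n)) \<longlonglongrightarrow> 0"
    proof (rule Lim_null_comparison[OF _ e0])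
      have "norm (w * E n) \<le> 1" for n
        using wG[of "E n"] order_trans[OF ctr[of n 1] norm_one_le] by simp
      then show "\<forall>\<^sub>F n in sequentially. norm (e n *\<^sub>R (w * E n)) \<le> e n"
        using e by (intro always_eventually allI) (simp add: less_imp_le mult_left_le)
    qed
    then have "(\<lambda>n. w - e n *\<^sub>R (w * E n)) \<longlonglongrightarrow> w - 0" by (intro tendsto_intros)
    then have "(\<lambda>n. w * G * E n) \<longlonglongrightarrow> w" by (simp add: wGE)
    then have "(\<lambda>n. adj (w * G * E n) * (w * G * E n)) \<longlonglongrightarrow> adj w * w" by (intro tendsto_intros)
    moreover have "adj (X n) * X n = adj (w * G * E n) * (w * G * E n)" for n
    proof -
      have "adj (X n) * X n = E n * (adj K * K) * E n" by (simp add: X_def aE mult.assoc)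
      also have "adj K * K = adj (w * G) * (w * G)"
        using K w(1) G(1) GwK(1) by (simp add: comm_def)
      finally show ?thesis by (simp add: aE mult.assoc)
    qed
    ultimately have "(\<lambda>n. adj (X n) * X n) \<longlonglongrightarrow> w * w" by (simp add: w(1))
    moreover have "(\<lambda>n. adj (X n) * X n) \<longlonglongrightarrow> adj L * L" by (intro tendsto_intros L)
    ultimately show "adj L * L = w * w" by (rule LIMSEQ_unique[symmetric])
  next
    show "comm R L" if "comm R G" "comm R K" for R
      using comm_limit[OF L] EC that by (simp add: X_def comm_mult)
  qed
qed

text \<open>With \<open>p = \<bar>F\<^sub>1\<bar>\<close>, \<open>q = \<bar>F\<^sub>2\<bar>\<close>, \<open>r = (1 - (p - q)\<^sup>2)\<^sup>1\<^sup>/\<^sup>2\<close> and \<open>s = (1 - (p + q)\<^sup>2)\<^sup>1\<^sup>/\<^sup>2\<close>, the operators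
\<open>G = (r + s) / 2\<close> and \<open>w = (r - s) / 2\<close> satisfy \<open>w G = p q\<close> and \<open>G\<^sup>2 + w\<^sup>2 = 1 - p\<^sup>2 - q\<^sup>2\<close>. So \<open>G\<^sub>0 = G\<close>, and
\<open>G\<^sub>1\<close> is \<open>w\<close> with the phase of \<open>- F\<^sub>1 F\<^sub>2\<close>, that is, the quotient of \<open>- F\<^sub>1 F\<^sub>2\<close> by \<open>G\<close>. For \<open>\<bar>z\<bar> = 1\<close>
the two equations of the conclusion say \<open>\<bar>G\<^sub>0 + z G\<^sub>1\<bar>\<^sup>2 + \<bar>F\<^sub>1\<^sup>* + z F\<^sub>2\<bar>\<^sup>2 = 1\<close>.\<close>

theorem spectral_factorization:
  fixes F1 F2 :: "'a::complex_hilbert bop"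
  assumes N1: "comm F1 (adj F1)" and N2: "comm F2 (adj F2)" and F12: "comm F1 F2"
    and bd: "\<And>z. cmod z = 1 \<Longrightarrow> norm (adj F1 + scal z * F2) \<le> 1"
  obtains G0 G1 where "adj G0 * G0 + adj G1 * G1 + F1 * adj F1 + adj F2 * F2 = 1"
    "adj G0 * G1 + F1 * F2 = 0"
    "\<And>R. comm R F1 \<Longrightarrow> comm R (adj F1) \<Longrightarrow> comm R F2 \<Longrightarrow> comm R (adj F2) \<Longrightarrow> comm R G0 \<and> comm R G1"
proof -
  \<comment> \<open>The bicommutant of \<open>{F\<^sub>1, F\<^sub>1\<^sup>*, F\<^sub>2, F\<^sub>2\<^sup>*}\<close> is commutative because that set is, by Fuglede's theorem.\<close>
  have F12': "comm F1 (adj F2)" by (rule fuglede[OF N2 F12])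
  have F21': "comm F2 (adj F1)" by (rule fuglede[OF N1 comm_sym[OF F12]])
  have aF: "comm (adj F1) (adj F2)" by (simp add: comm_adj F12)
  define C where "C R \<longleftrightarrow> comm R F1 \<and> comm R (adj F1) \<and> comm R F2 \<and> comm R (adj F2)" for R
  define bic where "bic X \<longleftrightarrow> (\<forall>R. C R \<longrightarrow> comm R X)" for X
  have C: "C F1" "C (adj F1)" "C F2" "C (adj F2)"
    using N1 N2 F12 F12' F21' aF unfolding C_def by (auto intro: comm_sym comm_refl)
  have bicF: "bic F1" "bic (adj F1)" "bic F2" "bic (adj F2)" by (auto simp: bic_def C_def)
  have bic_comm: "comm X Y" if "bic X" "bic Y" for X Y
  proof -
    have "C X" using that(1) C unfolding bic_def C_def by (blast intro: comm_sym)
    then show ?thesis using that(2) by (simp add: bic_def)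
  qed
  have bic_intros: "bic X \<Longrightarrow> bic Y \<Longrightarrow> bic (X + Y)" "bic X \<Longrightarrow> bic Y \<Longrightarrow> bic (X - Y)"
    "bic X \<Longrightarrow> bic Y \<Longrightarrow> bic (X * Y)" "bic X \<Longrightarrow> bic (a *\<^sub>R X)" "bic 1" for X Y a
    by (auto simp: bic_def intro: comm_intros)
  note norms = norm_pencil_coeffs_le[OF bd]
  have root: "\<exists>Y. adj Y = Y \<and> Y * Y = T \<and> norm (1 - Y) \<le> 1 \<and> bic Y"
    if "adj T = T" "norm (1 - T) \<le> 1" "bic T" for T
  proof -
    obtain Y where "adj Y = Y" "Y * Y = T" "norm (1 - Y) \<le> 1" "\<And>R. comm R T \<Longrightarrow> comm R Y"
      using op_sqrt[OF \<open>adj T = T\<close> \<open>norm (1 - T) \<le> 1\<close>] by blast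
    with \<open>bic T\<close> show ?thesis unfolding bic_def by blast
  qed
  obtain p where p: "adj p = p" "p * p = F1 * adj F1" "bic p"
    using root[of "F1 * adj F1"] norm_one_minus_adj_mult_self_le[OF norms(1)]
      bic_intros(3)[OF bicF(1,2)] by auto
  obtain q where q: "adj q = q" "q * q = adj F2 * F2" "bic q"
    using root[of "adj F2 * F2"] norm_one_minus_adj_mult_self_le[OF norms(2)]
      bic_intros(3)[OF bicF(4,3)] by auto
  have pq: "comm p q" by (rule bic_comm[OF p(3) q(3)])
  have sums: "norm (p + q) \<le> 1" "norm (p - q) \<le> 1"
  proof -
    \<comment> \<open>The same estimate serves both signs of \<open>q\<close>.\<close>
    have *: "norm (p + q') \<le> 1" if "adj q' = q'" "q' * q' = adj F2 * F2" "comm p q'" for q'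
      by (rule norm_modulus_sum_le[of "adj F1" F2])
        (use N1 N2 F21' aF bd p that in \<open>auto intro: comm_sym\<close>)
    show "norm (p + q) \<le> 1" using q pq by (intro *)
    have "norm (p + (- q)) \<le> 1" using q pq by (intro *) (simp_all add: comm_intros)
    then show "norm (p - q) \<le> 1" by simp
  qed
  have sq: "norm (1 - (1 - h * h)) \<le> 1" if "norm h \<le> 1" for h :: "'a bop"
    using norm_mult_ineq[of h h] mult_mono[OF that that] by simp
  obtain r where r: "adj r = r" "r * r = 1 - (p - q) * (p - q)" "norm (1 - r) \<le> 1" "bic r"
    using root[OF _ sq[OF sums(2)]] p q by (auto simp: bic_intros)
  obtain s where s: "adj s = s" "s * s = 1 - (p + q) * (p + q)" "norm (1 - s) \<le> 1" "bic s"
    using root[OF _ sq[OF sums(1)]] p q by (auto simp: bic_intros)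
  define G where "G = (1 / 2) *\<^sub>R (r + s)"
  define w where "w = (1 / 2) *\<^sub>R (r - s)"
  have bic_Gw: "bic G" "bic w" using r s by (auto simp: G_def w_def intro!: bic_intros)
  have rs: "r * s = s * r" using bic_comm[OF r(4) s(4)] by (simp add: comm_def)
  have qp: "q * p = p * q" using pq by (simp add: comm_def)
  have wG: "w * G = p * q"
  proof -
    have "w * G = (1 / 4) *\<^sub>R (r * r - s * s)"
      by (simp add: w_def G_def algebra_simps rs)
    also have "\<dots> = (1 / 4) *\<^sub>R (4 *\<^sub>R (p * q))"
      unfolding r(2) s(2)
      by (rule arg_cong[of _ _ "scaleR (1/4)"])
        (simp add: algebra_simps qp scaleR_left_distrib[of 2 2, simplified] scaleR_2)
    finally show ?thesis by simp
  qed
  have GGww: "G * G + w * w = 1 - F1 * adj F1 - adj F2 * F2"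
  proof -
    have "G * G + w * w = (1 / 2) *\<^sub>R (r * r + s * s)"
      by (simp add: w_def G_def algebra_simps rs) (simp add: scaleR_left_distrib[symmetric])
    also have "\<dots> = (1 / 2) *\<^sub>R (2 *\<^sub>R (1 - p * p - q * q))"
      unfolding r(2) s(2)
      by (rule arg_cong[of _ _ "scaleR (1/2)"]) (simp add: algebra_simps qp scaleR_2)
    finally show ?thesis by (simp add: p q)
  qed
  obtain L where L: "G * L = - (F1 * F2)" "adj L * L = w * w"
    "\<And>R. comm R G \<Longrightarrow> comm R (- (F1 * F2)) \<Longrightarrow> comm R L"
  proof (rule regularized_quotient[of G w "- (F1 * F2)"])
    show "adj G = G" "adj w = w" by (simp_all add: G_def w_def r s)
    show "0 \<le> inner (app G x) x" for x
      using inner_app_nonneg[OF r(3), of x] inner_app_nonneg[OF s(3), of x]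
      by (simp add: G_def app_simps inner_add_left)
    show "norm (app w x) \<le> norm (app G x)" for x
    proof -
      have "0 \<le> inner (app r x) (app s x)"
        by (rule inner_app_app_nonneg[OF r(3) s(1,3) bic_comm[OF r(4) s(4)]])
      then have "(norm (app r x - app s x))\<^sup>2 \<le> (norm (app r x + app s x))\<^sup>2"
        by (simp add: power2_norm_eq_inner inner_add_left inner_add_right inner_diff_left
            inner_diff_right inner_commute)
      then have "norm (app r x - app s x) \<le> norm (app r x + app s x)"
        by (rule power2_le_imp_le) simp
      then show ?thesis by (simp add: G_def w_def app_simps)
    qed
    have "adj (- (F1 * F2)) * (- (F1 * F2)) = adj F2 * (F1 * adj F1) * F2"
      using N1 by (simp add: comm_def mult.assoc[symmetric])
    also have "\<dots> = (F1 * adj F1) * (adj F2 * F2)"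
      using bic_comm[OF bicF(4) bic_intros(3)[OF bicF(1,2)]] by (simp add: comm_def mult.assoc)
    also have "\<dots> = w * G * (w * G)"
      unfolding wG p(2)[symmetric] q(2)[symmetric] by (metis qp mult.assoc)
    finally show "adj (- (F1 * F2)) * (- (F1 * F2)) = w * G * (w * G)" .
    show "comm G w" "comm G (- (F1 * F2))"
      using bic_Gw bic_intros(3)[OF bicF(1,3)] by (auto intro!: bic_comm comm_minus)
  qed auto
  show ?thesis
  proof (rule that[of G L])
    have aG: "adj G = G" by (simp add: G_def r s)
    show "adj G * G + adj L * L + F1 * adj F1 + adj F2 * F2 = 1"
      unfolding aG L(2) GGww by simp
    show "adj G * L + F1 * F2 = 0" unfolding aG L(1) by simp
    fix R assume "comm R F1" "comm R (adj F1)" "comm R F2" "comm R (adj F2)"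
    then have "comm R G" "comm R (F1 * F2)" using bic_Gw(1) by (auto simp: bic_def C_def comm_mult)
    then show "comm R G \<and> comm R L" using L(3) by (auto simp: comm_minus)
  qed
qed

section \<open>The distinguished boundary of the hexablock\<close>

lemma tetrablock_abs_less:
  assumes "(x1, x2, x3) \<in> tetrablock" and z: "cmod z \<le> 1"
  shows "cmod (x2 - x3 * z) < cmod (1 - x1 * z)"
proof (rule ccontr)
  assume not: "\<not> ?thesis"
  have nz: "1 - x1 * z1 - x2 * z2 + x3 * z1 * z2 \<noteq> 0" if "cmod z1 \<le> 1" "cmod z2 \<le> 1" for z1 z2
    using assms(1) that by (auto simp: tetrablock_def)
  have "1 - x1 * z \<noteq> 0" using nz[of z 0] z by simp
  with not have nz2: "x2 - x3 * z \<noteq> 0" by auto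
  define w where "w = (1 - x1 * z) / (x2 - x3 * z)"
  have "cmod w \<le> 1" using not nz2 by (simp add: w_def norm_divide divide_le_eq_1)
  then have "1 - x1 * z - x2 * w + x3 * z * w \<noteq> 0" using nz z by blast
  moreover have "w * (x2 - x3 * z) = 1 - x1 * z" using nz2 by (simp add: w_def)
  ultimately show False by (simp add: algebra_simps)
qed

lemma tetrablock_swap: "(x1, x2, x3) \<in> tetrablock \<Longrightarrow> (x2, x1, x3) \<in> tetrablock"
proof -
  assume t: "(x1, x2, x3) \<in> tetrablock"
  have "1 - x2 * z1 - x1 * z2 + x3 * z1 * z2 \<noteq> 0" if "cmod z1 \<le> 1" "cmod z2 \<le> 1" for z1 z2
  proof -
    have "1 - x1 * z2 - x2 * z1 + x3 * z2 * z1 \<noteq> 0" using t that by (simp add: tetrablock_def)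
    moreover have "1 - x1 * z2 - x2 * z1 + x3 * z2 * z1 = 1 - x2 * z1 - x1 * z2 + x3 * z1 * z2"
      by (simp add: algebra_simps)
    ultimately show ?thesis by simp
  qed
  then show ?thesis by (simp add: tetrablock_def)
qed

text \<open>Squaring \<open>\<bar>x\<^sub>2 - x\<^sub>3 z\<bar> < \<bar>1 - x\<^sub>1 z\<bar>\<close> on the unit circle leaves \<open>z\<close> only in the term
\<open>2 Re (z (x\<^sub>1 - cnj x\<^sub>2 x\<^sub>3))\<close>, which is largest when the phase of \<open>z\<close> is conjugate to that of \<open>x\<^sub>1 - cnj x\<^sub>2 x\<^sub>3\<close>.\<close>

lemma tetrablock_circle_estimate:
  assumes "(x1, x2, x3) \<in> tetrablock"
  shows "2 * cmod (x1 - cnj x2 * x3) \<le> 1 + (cmod x1)\<^sup>2 - (cmod x2)\<^sup>2 - (cmod x3)\<^sup>2"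
proof -
  define d where "d = x1 - cnj x2 * x3"
  obtain z where z: "cmod z = 1" "z * d = of_real (cmod d)"
  proof (cases "d = 0")
    case False
    show ?thesis
    proof (rule that[of "cnj d / of_real (cmod d)"])
      show "cmod (cnj d / of_real (cmod d)) = 1" using False by (simp add: norm_divide)
      show "cnj d / of_real (cmod d) * d = of_real (cmod d)"
        using False by (simp add: field_simps complex_norm_square[symmetric] power2_eq_square)
    qed
  qed (rule that[of 1], auto)
  have "(cmod (x2 - x3 * z))\<^sup>2 \<le> (cmod (1 - x1 * z))\<^sup>2"
    using tetrablock_abs_less[OF assms, of z] z(1) by (intro power_mono) auto
  moreover have "(cmod (x2 - x3 * z))\<^sup>2 = (cmod x2)\<^sup>2 + (cmod x3)\<^sup>2 - 2 * Re (z * (cnj x2 * x3))"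
  proof -
    have "(cmod (x3 * z))\<^sup>2 = (cmod x3)\<^sup>2" by (simp add: norm_mult z)
    then show ?thesis
      unfolding cmod_power2 by (simp add: power2_eq_square algebra_simps)
  qed
  moreover have "(cmod (1 - x1 * z))\<^sup>2 = 1 + (cmod x1)\<^sup>2 - 2 * Re (z * x1)"
  proof -
    have "(cmod (x1 * z))\<^sup>2 = (cmod x1)\<^sup>2" by (simp add: norm_mult z)
    then show ?thesis
      unfolding cmod_power2 by (simp add: power2_eq_square algebra_simps)
  qed
  moreover have "Re (z * x1) - Re (z * (cnj x2 * x3)) = cmod d"
    using arg_cong[OF z(2), of Re] by (simp add: d_def right_diff_distrib)
  ultimately show ?thesis by (simp add: d_def)
qed

text \<open>The supremum is evaluated at \<open>z\<^sub>1 = cnj x\<^sub>1\<close>, \<open>z\<^sub>2 = 0\<close>, where the quotient is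
\<open>\<bar>a\<bar> / (1 - \<bar>x\<^sub>1\<bar>\<^sup>2)\<^sup>1\<^sup>/\<^sup>2\<close>.\<close>

lemma hexablock_component_estimate:
  assumes "(a, x1, x2, x3) \<in> hexablock"
  shows "(cmod a)\<^sup>2 + (cmod x1)\<^sup>2 \<le> 1"
proof -
  have t: "(x1, x2, x3) \<in> tetrablock" using assms by (simp add: hexablock_def)
  define den where "den z1 z2 = 1 - x1 * z1 - x2 * z2 + x3 * z1 * z2" for z1 z2
  define f where "f = (\<lambda>(z1, z2). cmod (a * complex_of_real (sqrt ((1 - (cmod z1)\<^sup>2) * (1 - (cmod z2)\<^sup>2)))
              / den z1 z2))"
  have sup: "(SUP z \<in> ball 0 1 \<times> ball 0 1. f z) < 1"
    using assms by (simp add: hexablock_def f_def den_def)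
  \<comment> \<open>The supremum bounds the single values only if the set is bounded, which holds by compactness.\<close>
  have "compact (f ` (cball 0 1 \<times> cball 0 1))"
  proof (rule compact_continuous_image)
    show "continuous_on (cball 0 1 \<times> cball 0 1) f"
      unfolding f_def den_def case_prod_beta
      using t by (intro continuous_intros) (auto simp: tetrablock_def)
  qed (intro compact_Times compact_cball)
  then have "bdd_above (f ` (cball 0 1 \<times> cball 0 1))" by (intro bounded_imp_bdd_above compact_imp_bounded)
  then have bdd: "bdd_above (f ` (ball 0 1 \<times> ball 0 1))"
    by (rule bdd_above_mono) (intro image_mono Sigma_mono ball_subset_cball)
  have x1: "cmod x1 < 1"
  proof (rule ccontr)
    assume "\<not> cmod x1 < 1"
    then have "x1 \<noteq> 0" "cmod (1 / x1) \<le> 1" by (auto simp: norm_divide divide_le_eq_1)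
    then show False using tetrablock_abs_less[OF t, of "1 / x1"] by simp
  qed
  have "f (cnj x1, 0) < 1"
    by (rule le_less_trans[OF cSUP_upper[OF _ bdd] sup]) (use x1 in auto)
  moreover have "den (cnj x1) 0 = of_real (1 - (cmod x1)\<^sup>2)"
    by (simp add: den_def complex_norm_square del: of_real_power)
  moreover have pos: "0 < 1 - (cmod x1)\<^sup>2" using x1 by (simp add: power_less_one_iff)
  ultimately have "cmod a * sqrt (1 - (cmod x1)\<^sup>2) < 1 - (cmod x1)\<^sup>2"
    by (simp add: f_def norm_mult norm_divide divide_less_eq del: of_real_diff)
  also have "\<dots> = sqrt (1 - (cmod x1)\<^sup>2) * sqrt (1 - (cmod x1)\<^sup>2)" using pos by simp
  finally have "cmod a < sqrt (1 - (cmod x1)\<^sup>2)"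
    by (rule mult_right_less_imp_less) (use pos in simp)
  then have "(cmod a)\<^sup>2 \<le> (sqrt (1 - (cmod x1)\<^sup>2))\<^sup>2" by (intro power_mono) auto
  then show ?thesis using pos by simp
qed

text \<open>Adding the circle estimate and its mirror image cancels \<open>\<bar>x\<^sub>1\<bar>\<close> and \<open>\<bar>x\<^sub>2\<bar>\<close> on the right. Unlike the strict
conditions that define the hexablock, the resulting inequalities pass to the closure.\<close>

lemma hexablock_closure_estimates:
  assumes "(a, x1, x2, x3) \<in> closure hexablock"
  shows "(cmod a)\<^sup>2 + (cmod x1)\<^sup>2 \<le> 1"
    and "cmod (x1 - cnj x2 * x3) + cmod (x2 - cnj x1 * x3) \<le> 1 - (cmod x3)\<^sup>2"
proof -
  define P where "P = {(a, x1, x2, x3). (cmod a)\<^sup>2 + (cmod x1)\<^sup>2 \<le> 1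
     \<and> cmod (x1 - cnj x2 * x3) + cmod (x2 - cnj x1 * x3) \<le> 1 - (cmod x3)\<^sup>2}"
  have "closed P"
    unfolding P_def case_prod_beta by (intro closed_Collect_conj closed_Collect_le continuous_intros)
  moreover have "hexablock \<subseteq> P"
  proof clarify
    fix a x1 x2 x3 assume h: "(a, x1, x2, x3) \<in> hexablock"
    then have t: "(x1, x2, x3) \<in> tetrablock" by (simp add: hexablock_def)
    show "(a, x1, x2, x3) \<in> P"
      using hexablock_component_estimate[OF h] tetrablock_circle_estimate[OF t]
        tetrablock_circle_estimate[OF tetrablock_swap[OF t]]
      by (simp add: P_def)
  qed
  ultimately have "closure hexablock \<subseteq> P" by (rule closure_minimal[rotated])
  with assms have "(a, x1, x2, x3) \<in> P" by blast
  then show "(cmod a)\<^sup>2 + (cmod x1)\<^sup>2 \<le> 1"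
    and "cmod (x1 - cnj x2 * x3) + cmod (x2 - cnj x1 * x3) \<le> 1 - (cmod x3)\<^sup>2"
    by (auto simp: P_def)
qed

text \<open>The first two equations, with \<open>\<bar>x\<^sub>2\<bar> \<le> 1\<close>, describe the distinguished boundary of the tetrablock. Here
\<open>\<bar>x\<^sub>2\<bar> = \<bar>x\<^sub>1\<bar> \<le> 1\<close> follows from the third.\<close>

definition hexablock_torus :: "(complex \<times> complex \<times> complex \<times> complex) set" where
  "hexablock_torus = {(a, x1, x2, x3). x1 = cnj x2 * x3 \<and> cmod x3 = 1 \<and> (cmod a)\<^sup>2 + (cmod x1)\<^sup>2 = 1}"

text \<open>On these points \<open>\<bar>x\<^sub>2 - x\<^sub>3 w\<^sub>1\<bar> = \<bar>cnj x\<^sub>1 - w\<^sub>1\<bar>\<close>, so the squares of the two terms \<open>A\<close> and \<open>B\<close> of the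
denominator \<open>(1 - x\<^sub>1 w\<^sub>1) - (x\<^sub>2 - x\<^sub>3 w\<^sub>1) w\<^sub>2\<close> differ by \<open>(1 - \<bar>x\<^sub>1\<bar>\<^sup>2) (1 - \<bar>w\<^sub>1\<bar>\<^sup>2)\<close>. The rest is
\<open>(A - B t)\<^sup>2 - (A\<^sup>2 - B\<^sup>2) (1 - t\<^sup>2) = (A t - B)\<^sup>2\<close>.\<close>

lemma torus_denominator:
  assumes p: "x1 = cnj x2 * x3" "cmod x3 = 1" "cmod x1 \<le> 1"
    and w: "cmod w1 < 1" "cmod w2 < 1"
  defines "den \<equiv> 1 - x1 * w1 - x2 * w2 + x3 * w1 * w2"
  shows "den \<noteq> 0" and "(1 - (cmod x1)\<^sup>2) * ((1 - (cmod w1)\<^sup>2) * (1 - (cmod w2)\<^sup>2)) \<le> (cmod den)\<^sup>2"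
proof -
  define A where "A = cmod (1 - x1 * w1)"
  define B where "B = cmod (x2 - x3 * w1)"
  define t where "t = cmod w2"
  have x3: "x3 * cnj x3 = 1" using complex_norm_square[of x3] p(2) by simp
  have x2: "x2 = cnj x1 * x3" using p(1) x3 by (simp add: mult.assoc mult.commute)
  have "B = cmod (x3 * (cnj x1 - w1))" by (simp add: B_def x2 algebra_simps)
  then have B: "B = cmod (cnj x1 - w1)" by (simp add: norm_mult p(2))
  have AB: "A\<^sup>2 - B\<^sup>2 = (1 - (cmod x1)\<^sup>2) * (1 - (cmod w1)\<^sup>2)"
    unfolding A_def B cmod_power2 by (simp add: power2_eq_square algebra_simps)
  have "0 \<le> A\<^sup>2 - B\<^sup>2"
    unfolding AB using p(3) w(1) by (intro mult_nonneg_nonneg) (auto simp: power_le_one less_imp_le)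
  then have "B\<^sup>2 \<le> A\<^sup>2" by linarith
  then have BA: "B \<le> A" by (rule power2_le_imp_le) (simp add: A_def)
  have "cmod (x1 * w1) < 1"
    using mult_right_mono[OF p(3), of "cmod w1"] w(1) by (simp add: norm_mult)
  then have A0: "0 < A" by (auto simp: A_def)
  have "B * t \<le> A * t" using BA by (simp add: t_def mult_right_mono)
  also have "\<dots> < A" using A0 w(2) by (simp add: t_def)
  finally have Bt: "0 < A - B * t" by simp
  have "den = (1 - x1 * w1) - (x2 - x3 * w1) * w2" by (simp add: den_def algebra_simps)
  then have den: "A - B * t \<le> cmod den"
    using norm_triangle_ineq2[of "1 - x1 * w1" "(x2 - x3 * w1) * w2"]
    by (simp add: A_def B_def t_def norm_mult)
  with Bt show "den \<noteq> 0" by auto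
  have "(A\<^sup>2 - B\<^sup>2) * (1 - t\<^sup>2) \<le> (A - B * t)\<^sup>2"
    using zero_le_power2[of "A * t - B"] by (simp add: power2_eq_square algebra_simps)
  also have "\<dots> \<le> (cmod den)\<^sup>2" using den Bt by (intro power_mono) auto
  finally show "(1 - (cmod x1)\<^sup>2) * ((1 - (cmod w1)\<^sup>2) * (1 - (cmod w2)\<^sup>2)) \<le> (cmod den)\<^sup>2"
    by (simp add: AB t_def mult.assoc)
qed

text \<open>Contracting the point amounts to contracting the bidisc in the denominator, and the factors
\<open>1 - \<bar>z\<bar>\<^sup>2\<close> only grow when \<open>z\<close> is replaced by \<open>r z\<close>. What is gained is the factor \<open>r < 1\<close> at \<open>a\<close>.\<close>

lemma contracted_torus_in_hexablock:
  assumes "(a, x1, x2, x3) \<in> hexablock_torus" and r: "0 < r" "r < 1"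
  shows "(of_real r * a, of_real r * x1, of_real r * x2, (of_real r)\<^sup>2 * x3) \<in> hexablock"
proof -
  have p: "x1 = cnj x2 * x3" "cmod x3 = 1" "(cmod a)\<^sup>2 = 1 - (cmod x1)\<^sup>2"
    using assms(1) by (auto simp: hexablock_torus_def)
  have "(cmod x1)\<^sup>2 \<le> 1" using p(3) zero_le_power2[of "cmod a"] by linarith
  then have x1: "cmod x1 \<le> 1" by (simp add: power_le_one_iff abs_square_le_1)
  define den where "den z1 z2 = 1 - x1 * z1 - x2 * z2 + x3 * z1 * z2" for z1 z2
  have den_eq: "1 - of_real r * x1 * z1 - of_real r * x2 * z2 + (of_real r)\<^sup>2 * x3 * z1 * z2
      = den (of_real r * z1) (of_real r * z2)" for z1 z2
    by (simp add: den_def power2_eq_square algebra_simps)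
  have small: "cmod (of_real r * z) < 1" if "cmod z \<le> 1" for z
  proof -
    have "r * cmod z \<le> r * 1" using that r by (intro mult_left_mono) auto
    also have "\<dots> < 1" using r by simp
    finally show ?thesis using r by (simp add: norm_mult)
  qed
  have t: "(of_real r * x1, of_real r * x2, (of_real r)\<^sup>2 * x3) \<in> tetrablock"
    unfolding tetrablock_def using torus_denominator(1)[OF p(1,2) x1 small small]
    by (simp add: den_eq) (simp add: den_def)
  have bound: "cmod (of_real r * a * complex_of_real (sqrt ((1 - (cmod z1)\<^sup>2) * (1 - (cmod z2)\<^sup>2)))
       / den (of_real r * z1) (of_real r * z2)) \<le> r"
    if z: "cmod z1 < 1" "cmod z2 < 1" for z1 z2
  proof -
    have sq: "(cmod (of_real r * z))\<^sup>2 \<le> (cmod z)\<^sup>2" for z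
      using r by (intro power_mono) (auto simp: norm_mult mult_left_le_one_le)
    have nn: "0 \<le> 1 - (cmod z1)\<^sup>2" "0 \<le> 1 - (cmod z2)\<^sup>2" using z by (auto simp: power_le_one less_imp_le)
    have "(cmod a)\<^sup>2 * ((1 - (cmod z1)\<^sup>2) * (1 - (cmod z2)\<^sup>2))
        \<le> (cmod a)\<^sup>2 * ((1 - (cmod (of_real r * z1))\<^sup>2) * (1 - (cmod (of_real r * z2))\<^sup>2))"
    proof (intro mult_left_mono mult_mono)
      show "1 - (cmod z1)\<^sup>2 \<le> 1 - (cmod (of_real r * z1))\<^sup>2" "1 - (cmod z2)\<^sup>2 \<le> 1 - (cmod (of_real r * z2))\<^sup>2"
        "0 \<le> 1 - (cmod (of_real r * z1))\<^sup>2"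
        using sq[of z1] sq[of z2] nn by linarith+
    qed (use nn in simp_all)
    also have "\<dots> \<le> (cmod (den (of_real r * z1) (of_real r * z2)))\<^sup>2"
      unfolding p(3) den_def using z
      by (intro torus_denominator(2)[OF p(1,2) x1 small small]) auto
    finally have "sqrt ((cmod a)\<^sup>2 * ((1 - (cmod z1)\<^sup>2) * (1 - (cmod z2)\<^sup>2)))
        \<le> sqrt ((cmod (den (of_real r * z1) (of_real r * z2)))\<^sup>2)"
      by (rule real_sqrt_le_mono)
    then have "cmod a * sqrt ((1 - (cmod z1)\<^sup>2) * (1 - (cmod z2)\<^sup>2))
        \<le> cmod (den (of_real r * z1) (of_real r * z2))"
      by (simp add: real_sqrt_mult)
    moreover have "den (of_real r * z1) (of_real r * z2) \<noteq> 0"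
      unfolding den_def using z by (intro torus_denominator(1)[OF p(1,2) x1 small small]) auto
    ultimately have "r * (cmod a * sqrt ((1 - (cmod z1)\<^sup>2) * (1 - (cmod z2)\<^sup>2))
        / cmod (den (of_real r * z1) (of_real r * z2))) \<le> r * 1"
      using r by (intro mult_left_mono) (auto simp: divide_le_eq_1)
    then show ?thesis using r nn by (simp add: norm_mult norm_divide mult.assoc)
  qed
  have "(SUP (z1, z2) \<in> ball 0 1 \<times> ball 0 1.
        cmod (of_real r * a * complex_of_real (sqrt ((1 - (cmod z1)\<^sup>2) * (1 - (cmod z2)\<^sup>2)))
              / den (of_real r * z1) (of_real r * z2))) \<le> r"
    by (rule cSUP_least) (auto intro!: bound)
  then show ?thesis using t r by (simp add: hexablock_def den_eq)
qed

lemma hexablock_torus_subset_closure: "hexablock_torus \<subseteq> closure hexablock"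
proof clarify
  fix a x1 x2 x3 assume p: "(a, x1, x2, x3) \<in> hexablock_torus"
  define r where "r n = 1 - 1 / real (n + 2)" for n
  define X where "X n = (of_real (r n) * a, of_real (r n) * x1, of_real (r n) * x2,
      (of_real (r n))\<^sup>2 * x3)" for n
  have "(\<lambda>n. 1 / real (n + 2)) \<longlonglongrightarrow> 0" using LIMSEQ_ignore_initial_segment[OF lim_1_over_n, of 2] by simp
  then have "r \<longlonglongrightarrow> 1 - 0" unfolding r_def by (intro tendsto_intros)
  then have r1: "(\<lambda>n. complex_of_real (r n)) \<longlonglongrightarrow> of_real 1" by (intro tendsto_intros) simp
  have "X \<longlonglongrightarrow> (of_real 1 * a, of_real 1 * x1, of_real 1 * x2, (of_real 1)\<^sup>2 * x3)"
    unfolding X_def by (intro tendsto_intros r1)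
  moreover have "X n \<in> hexablock" for n
    unfolding X_def by (rule contracted_torus_in_hexablock[OF p]) (auto simp: r_def)
  ultimately show "(a, x1, x2, x3) \<in> closure hexablock" by (auto simp: closure_sequential)
qed

lemma Re_cnj_mult_le: "2 * Re (cnj u * v) \<le> (cmod u)\<^sup>2 + (cmod v)\<^sup>2 - (cmod (u - v))\<^sup>2"
  unfolding cmod_power2 by (simp add: power2_eq_square algebra_simps)

text \<open>Every point \<open>(\<alpha>, \<xi>\<^sub>1, \<xi>\<^sub>2, \<xi>\<^sub>3)\<close> of the set is a peak point of the affine function
\<open>2 + cnj \<alpha> a + cnj \<xi>\<^sub>1 x\<^sub>1 + cnj \<xi>\<^sub>3 x\<^sub>3\<close>. By the estimates on the closure its modulus is at most 4,
with equality only if \<open>a = \<alpha>\<close>, \<open>x\<^sub>1 = \<xi>\<^sub>1\<close> and \<open>x\<^sub>3 = \<xi>\<^sub>3\<close>; then \<open>\<bar>x\<^sub>3\<bar> = 1\<close> forces \<open>x\<^sub>2 = cnj x\<^sub>1 x\<^sub>3 = \<xi>\<^sub>2\<close>.\<close>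

lemma hexablock_torus_subset_distinguished_boundary:
  "hexablock_torus \<subseteq> distinguished_boundary hexablock"
proof clarify
  fix \<alpha> \<xi>1 \<xi>2 \<xi>3 assume p: "(\<alpha>, \<xi>1, \<xi>2, \<xi>3) \<in> hexablock_torus"
  define f :: "complex \<times> complex \<times> complex \<times> complex \<Rightarrow> complex" where
    "f = (\<lambda>(a, x1, x2, x3). 2 + (cnj \<alpha> * a + cnj \<xi>1 * x1 + cnj \<xi>3 * x3))"
  define D :: "complex \<times> complex \<times> complex \<times> complex \<Rightarrow> complex" where
    "D = (\<lambda>(a, x1, x2, x3). cnj \<alpha> * a + cnj \<xi>1 * x1 + cnj \<xi>3 * x3)"
  have bl: "bounded_linear D" unfolding D_def case_prod_beta by (intro bounded_linear_intros)
  have fD: "f = (\<lambda>q. 2 + D q)" by (auto simp: f_def D_def)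
  have p': "\<xi>1 = cnj \<xi>2 * \<xi>3" "cmod \<xi>3 = 1" "(cmod \<alpha>)\<^sup>2 + (cmod \<xi>1)\<^sup>2 = 1"
    using p by (auto simp: hexablock_torus_def)
  have peak: "(a, x1, x2, x3) = (\<alpha>, \<xi>1, \<xi>2, \<xi>3)"
    if q: "(a, x1, x2, x3) \<in> closure hexablock" and "4 \<le> cmod (f (a, x1, x2, x3))" for a x1 x2 x3
  proof -
    note est = hexablock_closure_estimates[OF q]
    have "0 \<le> 1 - (cmod x3)\<^sup>2" using est(2) by (rule order_trans[rotated]) simp
    then have x3: "(cmod x3)\<^sup>2 \<le> 1" by simp
    define s where "s = cnj \<alpha> * a + cnj \<xi>1 * x1"
    define t where "t = cnj \<xi>3 * x3"
    have "cmod t \<le> 1" using x3 by (simp add: t_def norm_mult p' abs_square_le_1)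
    have "(cmod s) \<le> cmod \<alpha> * cmod a + cmod \<xi>1 * cmod x1"
      unfolding s_def by (rule order_trans[OF norm_triangle_ineq]) (simp add: norm_mult)
    moreover have "2 * (cmod \<alpha> * cmod a) \<le> (cmod \<alpha>)\<^sup>2 + (cmod a)\<^sup>2"
      "2 * (cmod \<xi>1 * cmod x1) \<le> (cmod \<xi>1)\<^sup>2 + (cmod x1)\<^sup>2"
      using sum_squares_bound[of "cmod \<alpha>" "cmod a"] sum_squares_bound[of "cmod \<xi>1" "cmod x1"] by auto
    ultimately have "cmod s \<le> 1" using est(1) p'(3) by linarith
    have "4 \<le> cmod (2 + (s + t))" using that(2) by (simp add: f_def s_def t_def add.assoc)
    then have "4\<^sup>2 \<le> (cmod (2 + (s + t)))\<^sup>2" by (intro power_mono) auto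
    also have "\<dots> = 4 + 4 * Re (s + t) + (cmod (s + t))\<^sup>2"
      unfolding cmod_power2 by (simp add: power2_eq_square algebra_simps)
    also have "(cmod (s + t))\<^sup>2 \<le> 2\<^sup>2"
      using norm_triangle_ineq[of s t] \<open>cmod s \<le> 1\<close> \<open>cmod t \<le> 1\<close> by (intro power_mono) auto
    finally have "2 \<le> Re s + Re t" by simp
    moreover have "2 * Re s \<le> 2 - (cmod (\<alpha> - a))\<^sup>2 - (cmod (\<xi>1 - x1))\<^sup>2"
      using Re_cnj_mult_le[of \<alpha> a] Re_cnj_mult_le[of \<xi>1 x1] est(1) p'(3) by (simp add: s_def)
    moreover have "2 * Re t \<le> 2 - (cmod (\<xi>3 - x3))\<^sup>2"
      using Re_cnj_mult_le[of \<xi>3 x3] x3 p'(2) by (simp add: t_def)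
    ultimately have "(cmod (\<alpha> - a))\<^sup>2 + (cmod (\<xi>1 - x1))\<^sup>2 + (cmod (\<xi>3 - x3))\<^sup>2 \<le> 0" by linarith
    then have "(cmod (\<alpha> - a))\<^sup>2 = 0" "(cmod (\<xi>1 - x1))\<^sup>2 = 0" "(cmod (\<xi>3 - x3))\<^sup>2 = 0"
      using zero_le_power2[of "cmod (\<alpha> - a)"] zero_le_power2[of "cmod (\<xi>1 - x1)"]
        zero_le_power2[of "cmod (\<xi>3 - x3)"] by linarith+
    then have e: "a = \<alpha>" "x1 = \<xi>1" "x3 = \<xi>3" by simp_all
    have "cmod (x1 - cnj x2 * x3) + cmod (x2 - cnj x1 * x3) \<le> 0" using est(2) by (simp add: e p')
    then have "cmod (x2 - cnj x1 * x3) \<le> 0"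
      using norm_ge_zero[of "x1 - cnj x2 * x3"] by linarith
    then have "x2 = cnj \<xi>1 * \<xi>3" by (simp add: e)
    also have "\<dots> = \<xi>2 * (\<xi>3 * cnj \<xi>3)" by (simp add: p'(1) mult_ac)
    also have "\<dots> = \<xi>2" using complex_norm_square[of \<xi>3] p'(2) by simp
    finally show ?thesis by (simp add: e)
  qed
  have fp: "cmod (f (\<alpha>, \<xi>1, \<xi>2, \<xi>3)) = 4"
  proof -
    have "cnj \<alpha> * \<alpha> + cnj \<xi>1 * \<xi>1 = of_real ((cmod \<alpha>)\<^sup>2 + (cmod \<xi>1)\<^sup>2)"
      "cnj \<xi>3 * \<xi>3 = of_real ((cmod \<xi>3)\<^sup>2)"
      by (simp_all only: of_real_add complex_norm_square mult.commute)
    then have "cnj \<alpha> * \<alpha> + cnj \<xi>1 * \<xi>1 = 1" "cnj \<xi>3 * \<xi>3 = 1"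
      unfolding p'(2,3) by simp_all
    then show ?thesis by (simp add: f_def)
  qed
  show "(\<alpha>, \<xi>1, \<xi>2, \<xi>3) \<in> distinguished_boundary hexablock"
    unfolding distinguished_boundary_def
  proof clarify
    fix C assume C: "is_boundary hexablock C"
    have "continuous_on (closure hexablock) f"
      unfolding fD by (intro continuous_intros linear_continuous_on bl)
    moreover have "analytic_in f hexablock"
      unfolding analytic_in_def
    proof (intro ballI exI conjI)
      fix q
      show "complex_linear4 D"
        unfolding complex_linear4_def using bounded_linear.linear[OF bl]
        by (simp add: D_def algebra_simps)
      show "(f has_derivative D) (at q)"
        unfolding fD using bounded_linear_imp_has_derivative[OF bl, of "at q"]
        by (auto intro!: derivative_eq_intros)
    qed
    ultimately obtain q where q: "q \<in> C" "\<forall>q'\<in>closure hexablock. cmod (f q') \<le> cmod (f q)"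
      using C unfolding is_boundary_def by blast
    have "4 \<le> cmod (f q)"
      using q(2) p hexablock_torus_subset_closure fp by fastforce
    moreover have "q \<in> closure hexablock" using q(1) C by (auto simp: is_boundary_def)
    ultimately have "q = (\<alpha>, \<xi>1, \<xi>2, \<xi>3)" by (cases q) (use peak in auto)
    then show "(\<alpha>, \<xi>1, \<xi>2, \<xi>3) \<in> C" using q(1) by simp
  qed
qed

section \<open>Taylor spectra of commuting normal tuples\<close>

definition below :: "nat set \<Rightarrow> nat \<Rightarrow> nat" where
  "below I i = card {j \<in> I. j < i}"

lemma below_remove:
  assumes "finite I" "i \<in> I" "i \<noteq> j"
  shows "below I j = below (I - {i}) j + (if i < j then 1 else 0)"
proof (cases "i < j")
  case True
  then have "{k \<in> I. k < j} = insert i {k \<in> I - {i}. k < j}" using assms by auto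
  then show ?thesis using assms True by (simp add: below_def)
next
  case False
  then have "{k \<in> I. k < j} = {k \<in> I - {i}. k < j}" by auto
  then show ?thesis using False by (simp add: below_def)
qed

lemma below_remove_self: "below (I - {i}) i = below I i"
  unfolding below_def by (rule arg_cong[of _ _ card]) auto

lemma sign_swap:
  assumes "finite I" "i \<in> I" "j \<in> I" "i \<noteq> j"
  shows "(-1) ^ (below I i + below (I - {i}) j) = - ((-1) ^ (below I j + below (I - {j}) i) :: real)"
  using below_remove[of I i j] below_remove[of I j i] assms by (cases "i < j") (auto simp: add.commute)

text \<open>Contraction with the \<open>B\<^sub>j\<close>, the map \<open>h\<close> below, is a chain homotopy: \<open>d h + h d\<close> is multiplication by
\<open>\<Sum>j. B\<^sub>j A\<^sub>j = 1\<close>, as the mixed terms cancel in pairs. So a cycle \<open>x\<close> is the boundary of \<open>h x\<close>.\<close>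

lemma koszul_exact_if_contracting:
  fixes A B :: "nat \<Rightarrow> 'a::complex_hilbert bop"
  assumes AA: "\<And>i j. i < n \<Longrightarrow> j < n \<Longrightarrow> comm (A i) (A j)"
    and AB: "\<And>i j. i < n \<Longrightarrow> j < n \<Longrightarrow> comm (A i) (B j)"
    and one: "(\<Sum>j<n. B j * A j) = 1"
  shows "koszul_exact UNIV (map (\<lambda>i. app (A i)) [0..<n])"
proof -
  define N where "N = {..<n}"
  define d where "d = koszul_map (map (\<lambda>i. app (A i)) [0..<n])"
  define h where "h x I = (if I \<subseteq> N then \<Sum>j\<in>N - I. (-1) ^ below I j *\<^sub>R app (B j) (x (insert j I)) else 0)"
    for x :: "nat set \<Rightarrow> 'a" and I
  have d: "d x I = (if I \<subseteq> N then \<Sum>i\<in>I. (-1) ^ below I i *\<^sub>R app (A i) (x (I - {i})) else 0)" for x I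
    unfolding d_def koszul_map_def N_def below_def by (auto intro!: sum.cong)
  have fin: "finite I" if "I \<subseteq> N" for I using that finite_subset by (auto simp: N_def)
  have app_comm: "app (A i) (app (A j) v) = app (A j) (app (A i) v)"
    "app (A i) (app (B j) v) = app (B j) (app (A i) v)" if "i \<in> N" "j \<in> N" for i j v
    using AA[of i j] AB[of i j] that by (simp_all add: N_def comm_def app_mult[symmetric])
  have dd: "d (d x) I = 0" for x I
  proof (cases "I \<subseteq> N")
    case I: True
    define t where "t i j = (-1) ^ (below I i + below (I - {i}) j) *\<^sub>R app (A i) (app (A j) (x (I - {i} - {j})))" for i j
    define S where "S = (\<Sum>i\<in>I. \<Sum>j\<in>I. if i = j then 0 else t i j)"
    have "d (d x) I = (\<Sum>i\<in>I. \<Sum>j\<in>I - {i}. t i j)"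
    proof -
      have sub: "I - {i} \<subseteq> N" for i using I by auto
      show ?thesis
        using I by (simp add: d sub app_sum_right app_scaleR_right scaleR_sum_right t_def power_add)
    qed
    also have "\<dots> = S"
      unfolding S_def
    proof (rule sum.cong[OF refl])
      fix i assume "i \<in> I"
      show "(\<Sum>j\<in>I - {i}. t i j) = (\<Sum>j\<in>I. if i = j then 0 else t i j)"
        using fin[OF I] by (intro sum.mono_neutral_cong_left) auto
    qed
    finally have dS: "d (d x) I = S" .
    \<comment> \<open>Removing \<open>i\<close> and \<open>j\<close> in either order gives opposite signs.\<close>
    have anti: "t i j = - t j i" if "i \<in> I" "j \<in> I" "i \<noteq> j" for i j
    proof -
      have "I - {i} - {j} = I - {j} - {i}" by auto
      then show ?thesis
        using sign_swap[OF fin[OF I] that] app_comm(1)[of i j] that I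
        by (auto simp: t_def)
    qed
    have "(if i = j then 0 else t i j) = - (if j = i then 0 else t j i)" if "i \<in> I" "j \<in> I" for i j
      by (cases "i = j") (simp_all, rule anti[OF that])
    then have "S = (\<Sum>i\<in>I. \<Sum>j\<in>I. - (if j = i then 0 else t j i))"
      unfolding S_def by (intro sum.cong refl)
    also have "\<dots> = - S" unfolding S_def by (subst sum.swap) (simp add: sum_negf)
    finally have "2 *\<^sub>R S = 0" by (simp add: scaleR_2 eq_neg_iff_add_eq_0)
    then show ?thesis using dS by simp
  qed (simp add: d)
  have homotopy: "d (h x) I + h (d x) I = x I" if I: "I \<subseteq> N" for x I
  proof -
    define c where "c i j = (-1) ^ (below I i + below (I - {i}) j) *\<^sub>R
        app (A i) (app (B j) (x (insert j (I - {i}))))" for i j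
    have "d (h x) I = (\<Sum>i\<in>I. app (B i) (app (A i) (x I)) + (\<Sum>j\<in>N - I. c i j))"
    proof -
      have "(-1) ^ below I i *\<^sub>R app (A i) (h x (I - {i}))
          = app (B i) (app (A i) (x I)) + (\<Sum>j\<in>N - I. c i j)" if i: "i \<in> I" for i
      proof -
        have sub: "I - {i} \<subseteq> N" using I by auto
        have "N - (I - {i}) = insert i (N - I)" using i I by auto
        moreover have "insert i (I - {i}) = I" using i by auto
        moreover have "finite (N - I)" "i \<notin> N - I" using i by (auto simp: N_def)
        moreover have "i \<in> N" using i I by auto
        ultimately show ?thesis
          unfolding h_def using sub
          by (simp add: below_remove_self app_add_right app_scaleR_right scaleR_add_right
              app_comm(2) app_sum_right scaleR_sum_right c_def power_add power_mult_distrib[symmetric]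
              flip: mult.assoc)
      qed
      then show ?thesis using I by (simp add: d)
    qed
    moreover have "h (d x) I = (\<Sum>j\<in>N - I. app (B j) (app (A j) (x I)) + (\<Sum>i\<in>I. - c i j))"
    proof -
      have "(-1) ^ below I j *\<^sub>R app (B j) (d x (insert j I))
          = app (B j) (app (A j) (x I)) + (\<Sum>i\<in>I. - c i j)" if j: "j \<in> N - I" for j
      proof -
        let ?I = "insert j I"
        have sub: "?I \<subseteq> N" "?I - {j} = I" "finite I" "j \<notin> I" using j I fin by auto
        \<comment> \<open>Exactly one of \<open>i < j\<close> and \<open>j < i\<close> shifts a position, which yields the opposite sign.\<close>
        have "(-1) ^ below I j *\<^sub>R (-1) ^ below ?I i *\<^sub>R app (B j) (app (A i) (x (?I - {i}))) = - c i j"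
          if i: "i \<in> I" for i
        proof -
          have ij: "i \<noteq> j" "i \<in> N" "j \<in> N" using i j I by auto
          have "?I - {i} = insert j (I - {i})" using ij by auto
          moreover have "below I j = below (I - {i}) j + (if i < j then 1 else 0)"
            using below_remove[OF sub(3) i ij(1)] .
          moreover have "below ?I i = below I i + (if j < i then 1 else 0)"
            using below_remove[of ?I j i] sub ij by simp
          ultimately show ?thesis
            using ij app_comm(2)[OF ij(2,3)] by (cases "i < j") (auto simp: c_def power_add mult.commute)
        qed
        moreover have "below ?I j = below I j" using below_remove_self[of ?I j] sub by simp
        ultimately show ?thesis
          using sub
          by (simp add: d app_add_right app_scaleR_right scaleR_add_right app_sum_right
              scaleR_sum_right power_mult_distrib[symmetric] flip: power_add)
      qed
      then show ?thesis using I by (simp add: h_def)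
    qed
    ultimately have "d (h x) I + h (d x) I
        = (\<Sum>i\<in>I. app (B i) (app (A i) (x I))) + (\<Sum>i\<in>N - I. app (B i) (app (A i) (x I)))
          + ((\<Sum>i\<in>I. \<Sum>j\<in>N - I. c i j) - (\<Sum>j\<in>N - I. \<Sum>i\<in>I. c i j))"
      by (simp add: sum.distrib sum_negf sum_subtractf)
    also have "(\<Sum>i\<in>I. \<Sum>j\<in>N - I. c i j) = (\<Sum>j\<in>N - I. \<Sum>i\<in>I. c i j)" by (rule sum.swap)
    also have "(\<Sum>i\<in>I. app (B i) (app (A i) (x I))) + (\<Sum>i\<in>N - I. app (B i) (app (A i) (x I)))
        = (\<Sum>i\<in>N. app (B i) (app (A i) (x I)))"
      using sum.subset_diff[OF I, of "\<lambda>i. app (B i) (app (A i) (x I))"] by (simp add: N_def add.commute)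
    also have "\<dots> = x I"
      using arg_cong[OF one, of "\<lambda>T. app T (x I)"] by (simp add: app_sum app_mult N_def)
    finally show ?thesis by simp
  qed
  have space: "koszul_space UNIV n = {x. \<forall>I. \<not> I \<subseteq> N \<longrightarrow> x I = (0 :: 'a)}"
    by (auto simp: koszul_space_def N_def)
  have "{x \<in> koszul_space UNIV n. d x = (\<lambda>_. 0)} = d ` koszul_space UNIV n"
  proof (intro equalityI subsetI)
    fix x assume "x \<in> {x \<in> koszul_space UNIV n. d x = (\<lambda>_. 0)}"
    then have x: "\<And>I. \<not> I \<subseteq> N \<Longrightarrow> x I = 0" "d x = (\<lambda>_. 0)" by (auto simp: space)
    have "d (h x) I = x I" for I
    proof (cases "I \<subseteq> N")
      case True
      have "h (\<lambda>_. 0) I = 0" by (simp add: h_def)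
      then show ?thesis using homotopy[OF True, of x] by (simp add: x(2))
    qed (simp add: d x)
    then have "x = d (h x)" by auto
    moreover have "h x \<in> koszul_space UNIV n" by (simp add: space h_def)
    ultimately show "x \<in> d ` koszul_space UNIV n" by blast
  next
    fix y assume "y \<in> d ` koszul_space UNIV n"
    then obtain x where "y = d x" by blast
    moreover have "d x I = 0" if "\<not> I \<subseteq> N" for I using that by (simp add: d)
    moreover have "d (d x) = (\<lambda>_. 0)" by (rule ext) (rule dd)
    ultimately show "y \<in> {x \<in> koszul_space UNIV n. d x = (\<lambda>_. 0)}" by (simp add: space)
  qed
  then show ?thesis by (simp add: koszul_exact_def d_def)
qed

lemma comm_sum: "(\<And>j. j \<in> I \<Longrightarrow> comm R (f j)) \<Longrightarrow> comm R (sum f I)"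
  by (induction I rule: infinite_finite_induct) (simp_all add: comm_intros)

text \<open>The operator \<open>D = \<Sum>i. A\<^sub>i\<^sup>* A\<^sub>i\<close> is invertible and commutes with everything in sight, so the
homotopy with \<open>B\<^sub>j = D\<^sup>-\<^sup>1 A\<^sub>j\<^sup>*\<close> applies.\<close>

lemma koszul_exact_if_coercive:
  fixes A :: "nat \<Rightarrow> 'a::complex_hilbert bop"
  assumes AA: "\<And>i j. i < n \<Longrightarrow> j < n \<Longrightarrow> comm (A i) (A j)"
    and AA': "\<And>i j. i < n \<Longrightarrow> j < n \<Longrightarrow> comm (A i) (adj (A j))"
    and c: "0 < c" "\<And>x. c * (norm x)\<^sup>2 \<le> (\<Sum>i<n. (norm (app (A i) x))\<^sup>2)"
  shows "koszul_exact UNIV (map (\<lambda>i. app (A i)) [0..<n])"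
proof -
  define D where "D = (\<Sum>i<n. adj (A i) * A i)"
  have "(\<Sum>i<n. (norm (app (A i) x))\<^sup>2) = inner (app D x) x" for x
    by (simp add: D_def app_sum inner_sum_left norm_app_sq)
  then obtain E where E: "D * E = 1" "E * D = 1"
    using coercive_invertible[OF c(1), of D] c(2) by metis
  have AD: "comm (A i) D" if "i < n" for i
    unfolding D_def by (intro comm_sum comm_mult AA AA') (use that in auto)
  show ?thesis
  proof (rule koszul_exact_if_contracting[where B = "\<lambda>j. E * adj (A j)"])
    show "(\<Sum>j<n. E * adj (A j) * A j) = 1"
      using E(2) by (simp add: D_def sum_distrib_left mult.assoc)
    show "comm (A i) (E * adj (A j))" if "i < n" "j < n" for i j
      by (intro comm_mult comm_inverse[OF E AD] AA' that)
  qed (rule AA)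
qed

text \<open>On vectors that the \<open>A\<^sub>i\<close> almost annihilate, \<open>X\<close> acts almost as the scalar \<open>c\<close>. For \<open>A\<^sub>i = N\<^sub>i - \<lambda>\<^sub>i\<close> this
behaves like the value of \<open>X\<close> under the character of the algebra of the \<open>N\<^sub>i\<close> and \<open>N\<^sub>i\<^sup>*\<close> that sends \<open>N\<^sub>i\<close> to
\<open>\<lambda>\<^sub>i\<close>: it is multiplicative, and it is unique as soon as the \<open>A\<^sub>i\<close> have a joint approximate kernel.\<close>

definition approx_value ::
    "nat \<Rightarrow> (nat \<Rightarrow> 'a::complex_hilbert bop) \<Rightarrow> 'a bop \<Rightarrow> complex \<Rightarrow> bool" where
  "approx_value n A X c \<longleftrightarrow>
     (\<exists>C. \<forall>x. norm (app (X - scal c) x) \<le> C * sqrt (\<Sum>i<n. (norm (app (A i) x))\<^sup>2))"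

lemma approx_value_scal: "approx_value n A (scal c) c"
  unfolding approx_value_def by (rule exI[of _ 0]) simp

lemma approx_value_one: "approx_value n A 1 1"
  using approx_value_scal[of n A 1] by simp

lemma approx_value_add:
  assumes "approx_value n A X c" "approx_value n A Y d"
  shows "approx_value n A (X + Y) (c + d)"
proof -
  obtain C C' where
    "\<And>x. norm (app (X - scal c) x) \<le> C * sqrt (\<Sum>i<n. (norm (app (A i) x))\<^sup>2)"
    "\<And>x. norm (app (Y - scal d) x) \<le> C' * sqrt (\<Sum>i<n. (norm (app (A i) x))\<^sup>2)"
    using assms unfolding approx_value_def by blast
  then have "norm (app (X - scal c) x + app (Y - scal d) x)
      \<le> (C + C') * sqrt (\<Sum>i<n. (norm (app (A i) x))\<^sup>2)" for x
    unfolding distrib_right by (intro norm_triangle_le add_mono)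
  moreover have "app (X - scal c) x + app (Y - scal d) x = app (X + Y - scal (c + d)) x" for x
    by (simp add: app_simps scal_add)
  ultimately show ?thesis unfolding approx_value_def by auto
qed

lemma approx_value_mult:
  assumes "approx_value n A X c" "approx_value n A Y d"
  shows "approx_value n A (X * Y) (c * d)"
proof -
  define e where "e x = sqrt (\<Sum>i<n. (norm (app (A i) x))\<^sup>2)" for x
  obtain C C' where
    C: "\<And>x. norm (app (X - scal c) x) \<le> C * e x" "\<And>x. norm (app (Y - scal d) x) \<le> C' * e x"
    using assms unfolding approx_value_def e_def by blast
  have "norm (app (X * Y - scal (c * d)) x) \<le> (norm X * C' + cmod d * C) * e x" for x
  proof -
    have "app (X * Y - scal (c * d)) x = app X (app (Y - scal d) x) + d *\<^sub>C app (X - scal c) x"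
      by (simp add: app_simps app_scaleC_right scaleC_scaleC mult.commute
          linear_diff[OF bounded_linear.linear[OF bounded_linear_scaleC]])
    also have "norm \<dots> \<le> norm X * norm (app (Y - scal d) x) + cmod d * norm (app (X - scal c) x)"
      by (intro norm_triangle_le add_mono norm_app_le) (simp add: norm_scaleC)
    also have "\<dots> \<le> norm X * (C' * e x) + cmod d * (C * e x)"
      by (intro add_mono mult_left_mono C) auto
    finally show ?thesis by (simp add: algebra_simps)
  qed
  then show ?thesis unfolding approx_value_def e_def by blast
qed

lemma approx_value_unique:
  assumes X: "approx_value n A X c" "approx_value n A X d"
    and not: "\<not> (\<exists>b>0. \<forall>x. b * (norm x)\<^sup>2 \<le> (\<Sum>i<n. (norm (app (A i) x))\<^sup>2))"
  shows "c = d"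
proof (rule ccontr)
  assume "c \<noteq> d"
  define q where "q x = (\<Sum>i<n. (norm (app (A i) x))\<^sup>2)" for x
  have q: "0 \<le> q x" for x by (simp add: q_def sum_nonneg)
  obtain C C' where
    C: "\<And>x. norm (app (X - scal c) x) \<le> C * sqrt (q x)" "\<And>x. norm (app (X - scal d) x) \<le> C' * sqrt (q x)"
    using X unfolding approx_value_def q_def by blast
  define K where "K = (\<bar>C\<bar> + \<bar>C'\<bar> + 1) / cmod (d - c)"
  have K: "0 < K" using \<open>c \<noteq> d\<close> by (simp add: K_def add_nonneg_pos)
  have "(1 / K\<^sup>2) * (norm x)\<^sup>2 \<le> q x" for x
  proof -
    have "(d - c) *\<^sub>C x = app (X - scal c) x - app (X - scal d) x"
      using arg_cong[OF scal_diff[of d c], of "\<lambda>T. app T x"] by (simp add: app_simps)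
    then have "cmod (d - c) * norm x = norm (app (X - scal c) x - app (X - scal d) x)"
      by (metis norm_scaleC)
    also have "\<dots> \<le> C * sqrt (q x) + C' * sqrt (q x)"
      using C[of x] norm_triangle_ineq4[of "app (X - scal c) x" "app (X - scal d) x"] by linarith
    also have "\<dots> \<le> (\<bar>C\<bar> + \<bar>C'\<bar> + 1) * sqrt (q x)"
      unfolding distrib_right[symmetric] using q[of x] by (intro mult_right_mono) auto
    finally have "norm x \<le> K * sqrt (q x)"
      using \<open>c \<noteq> d\<close> by (simp add: K_def field_simps)
    then have "(norm x)\<^sup>2 \<le> (K * sqrt (q x))\<^sup>2" by (intro power_mono) auto
    then have "(norm x)\<^sup>2 \<le> K\<^sup>2 * q x" using q[of x] by (simp add: power_mult_distrib)
    then show ?thesis using K by (simp add: field_simps)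
  qed
  moreover have "0 < 1 / K\<^sup>2" using K by simp
  ultimately show False using not unfolding q_def by blast
qed

lemma approx_value_component:
  assumes "A i = N - scal c" "i < n"
  shows "approx_value n A N c"
proof -
  have "norm (app (A i) x) \<le> sqrt (\<Sum>i<n. (norm (app (A i) x))\<^sup>2)" for x
    using member_le_sum[of i "{..<n}" "\<lambda>i. (norm (app (A i) x))\<^sup>2"] assms(2)
    by (intro real_le_rsqrt) auto
  then show ?thesis unfolding approx_value_def assms(1)[symmetric] by (intro exI[of _ 1]) simp
qed

lemma norm_app_adj_normal:
  assumes "comm N (adj N)"
  shows "norm (app (adj N) x) = norm (app N x)"
proof -
  have "(norm (app (adj N) x))\<^sup>2 = (norm (app N x))\<^sup>2"
    unfolding norm_app_sq using assms by (simp add: comm_def)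
  then show ?thesis by (simp add: power2_eq_iff_nonneg)
qed

lemma comm_shift: "comm (S - scal c) (T - scal d)" if "comm S T"
proof -
  have "comm T (S - scal c)" using comm_sym[OF that] by (intro comm_diff comm_scal)
  then show ?thesis by (intro comm_diff comm_scal) (rule comm_sym)
qed

lemma approx_value_component_adj:
  assumes "A i = N - scal c" "i < n" "comm N (adj N)"
  shows "approx_value n A (adj N) (cnj c)"
proof -
  have "comm (A i) (adj (A i))"
    unfolding assms(1) adj_diff adj_scal using assms(3) by (rule comm_shift)
  then have "norm (app (adj N - scal (cnj c)) x) = norm (app (N - scal c) x)" for x
    using norm_app_adj_normal[of "A i" x] by (simp add: assms(1))
  then show ?thesis
    using approx_value_component[of A i N c n, OF assms(1,2)] by (simp add: approx_value_def)
qed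

lemma operator_on_app: "operator_on UNIV (app T)"
  unfolding operator_on_def
  by (auto simp: app_simps app_scaleC_right intro!: exI[of _ "norm T"] norm_app_le)

lemma adjoint_on_app: "adjoint_on UNIV (app T) (app (adj T))"
  by (simp add: adjoint_on_def operator_on_app cinner_app_left)

text \<open>A point \<open>\<lambda>\<close> of the Taylor spectrum makes the \<open>N\<^sub>i - \<lambda>\<^sub>i\<close> jointly non-coercive, so approximate values are
unique, and every polynomial relation between the operators and their adjoints holds for the
\<open>\<lambda>\<^sub>i\<close> and their conjugates. The three relations assumed here are those that define
\<open>hexablock_torus\<close>.\<close>

lemma hexablock_unitaryI:
  fixes N :: "nat \<Rightarrow> 'a::complex_hilbert bop"
  assumes comm: "\<And>i j. i < 4 \<Longrightarrow> j < 4 \<Longrightarrow> comm (N i) (N j)"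
    and comm': "\<And>i j. i < 4 \<Longrightarrow> j < 4 \<Longrightarrow> comm (N i) (adj (N j))"
    and rel: "N 1 = adj (N 2) * N 3" "adj (N 3) * N 3 = 1" "adj (N 0) * N 0 + adj (N 1) * N 1 = 1"
  shows "hexablock_unitary_on UNIV (map (\<lambda>i. app (N i)) [0..<4])"
proof -
  have "cs \<in> {[a, x1, x2, x3] | a x1 x2 x3. (a, x1, x2, x3) \<in> hexablock_torus}"
    if cs: "cs \<in> taylor_spectrum UNIV (map (\<lambda>i. app (N i)) [0..<4])" for cs
  proof -
    define A where "A i = N i - scal (cs ! i)" for i
    have len: "length cs = 4" using cs by (simp add: taylor_spectrum_def)
    have "map2 (\<lambda>T c x. T x - c *\<^sub>C x) (map (\<lambda>i. app (N i)) [0..<4]) cs = map (\<lambda>i. app (A i)) [0..<4]"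
      using len by (intro nth_equalityI) (auto simp: A_def app_simps)
    then have "\<not> koszul_exact UNIV (map (\<lambda>i. app (A i)) [0..<4])"
      using cs by (simp add: taylor_spectrum_def)
    moreover have "comm (A i) (A j)" "comm (A i) (adj (A j))" if "i < 4" "j < 4" for i j
      unfolding A_def adj_diff adj_scal by (rule comm_shift comm comm' that)+
    ultimately have not: "\<not> (\<exists>b>0. \<forall>x. b * (norm x)\<^sup>2 \<le> (\<Sum>i<4. (norm (app (A i) x))\<^sup>2))"
      using koszul_exact_if_coercive[of 4 A] by blast
    have v: "approx_value 4 A (N i) (cs ! i)" "approx_value 4 A (adj (N i)) (cnj (cs ! i))" if "i < 4" for i
      using approx_value_component[of A i "N i" "cs ! i" 4]
        approx_value_component_adj[of A i "N i" "cs ! i" 4] comm'[of i i] that by (simp_all add: A_def)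
    note uniq = approx_value_unique[OF _ _ not]
    have "approx_value 4 A (adj (N 2) * N 3) (cnj (cs ! 2) * cs ! 3)"
      by (intro approx_value_mult v) simp_all
    then have 1: "cs ! 1 = cnj (cs ! 2) * cs ! 3"
      unfolding rel(1)[symmetric] by (intro uniq[OF v(1)]) simp_all
    have "approx_value 4 A (adj (N 3) * N 3) (cnj (cs ! 3) * cs ! 3)"
      by (intro approx_value_mult v) simp_all
    then have 2: "cnj (cs ! 3) * cs ! 3 = 1"
      unfolding rel(2) by (rule uniq[OF _ approx_value_one])
    have "approx_value 4 A (adj (N 0) * N 0 + adj (N 1) * N 1)
        (cnj (cs ! 0) * cs ! 0 + cnj (cs ! 1) * cs ! 1)"
      by (intro approx_value_add approx_value_mult v) simp_all
    then have 3: "cnj (cs ! 0) * cs ! 0 + cnj (cs ! 1) * cs ! 1 = 1"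
      unfolding rel(3) by (rule uniq[OF _ approx_value_one])
    have sq: "cnj z * z = of_real ((cmod z)\<^sup>2)" for z
      by (simp only: complex_norm_square mult.commute)
    have "(cmod (cs ! 3))\<^sup>2 = 1" using 2 unfolding sq by (simp only: of_real_eq_1_iff)
    then have "cmod (cs ! 3) = 1" by (simp add: power2_eq_1_iff) (smt (verit) norm_ge_zero)
    moreover have "(cmod (cs ! 0))\<^sup>2 + (cmod (cs ! 1))\<^sup>2 = 1"
      using 3 unfolding sq of_real_add[symmetric] by (simp only: of_real_eq_1_iff)
    moreover have "cs = [cs ! 0, cs ! 1, cs ! 2, cs ! 3]"
      using len by (auto simp: list_eq_iff_nth_eq less_Suc_eq numeral_eq_Suc)
    ultimately show ?thesis using 1 unfolding hexablock_torus_def by blast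
  qed
  then have "taylor_spectrum UNIV (map (\<lambda>i. app (N i)) [0..<4])
      \<subseteq> {[a, x1, x2, x3] | a x1 x2 x3. (a, x1, x2, x3) \<in> distinguished_boundary hexablock}"
    using hexablock_torus_subset_distinguished_boundary by fastforce
  moreover have "commute_on UNIV (app (N i)) (app (N j))" if "i < 4" "j < 4" for i j
    using comm[OF that] by (simp add: commute_on_def comm_def app_mult[symmetric])
  moreover have "normal_on UNIV (app (N i))" if "i < 4" for i
    unfolding normal_on_def
    using comm'[OF that that] adjoint_on_app[of "N i"] operator_on_app[of "N i"]
    by (auto simp: commute_on_def comm_def app_mult[symmetric] intro!: exI[of _ "app (adj (N i))"])
  ultimately show ?thesis
    by (auto simp: hexablock_unitary_on_def commuting_operators_def operator_on_app)
qed

section \<open>Operators on square-summable sequences and on the Hardy space\<close>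

lemma ell2_eqI: "(\<And>n. Rep_ell2 x n = Rep_ell2 y n) \<Longrightarrow> x = y"
  by (simp add: Rep_ell2_inject[symmetric] fun_eq_iff)

lemma Rep_Abs_ell2: "summable (\<lambda>n. (norm (f n))\<^sup>2) \<Longrightarrow> Rep_ell2 (Abs_ell2 f) = f"
  by (simp add: Abs_ell2_inverse)

definition amp :: "'a::complex_hilbert bop \<Rightarrow> 'a ell2 bop" where
  "amp T = (THE S. \<forall>x n. Rep_ell2 (app S x) n = app T (Rep_ell2 x n))"

lemma summable_app_ell2: "summable (\<lambda>n. (norm (app T (Rep_ell2 x n)))\<^sup>2)"
  and suminf_app_ell2_le: "(\<Sum>n. (norm (app T (Rep_ell2 x n)))\<^sup>2) \<le> (norm T * norm x)\<^sup>2"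
proof -
  have le: "(norm (app T (Rep_ell2 x n)))\<^sup>2 \<le> (norm T)\<^sup>2 * (norm (Rep_ell2 x n))\<^sup>2" for n
    unfolding power_mult_distrib[symmetric] by (intro power_mono norm_app_le) simp
  have s: "summable (\<lambda>n. (norm T)\<^sup>2 * (norm (Rep_ell2 x n))\<^sup>2)"
    by (intro summable_mult summable_Rep_ell2)
  show *: "summable (\<lambda>n. (norm (app T (Rep_ell2 x n)))\<^sup>2)"
    by (rule summable_comparison_test'[OF s]) (simp add: le)
  have "(\<Sum>n. (norm (app T (Rep_ell2 x n)))\<^sup>2) \<le> (\<Sum>n. (norm T)\<^sup>2 * (norm (Rep_ell2 x n))\<^sup>2)"
    by (rule suminf_le[OF le * s])
  also have "\<dots> = (norm T * norm x)\<^sup>2"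
    by (simp add: suminf_mult summable_Rep_ell2 norm_ell2_sq power_mult_distrib)
  finally show "(\<Sum>n. (norm (app T (Rep_ell2 x n)))\<^sup>2) \<le> (norm T * norm x)\<^sup>2" .
qed

lemma Rep_amp: "Rep_ell2 (app (amp T) x) n = app T (Rep_ell2 x n)"
proof -
  define f where "f T x = Abs_ell2 (\<lambda>n. app T (Rep_ell2 x n))" for T :: "'a bop" and x
  have f: "Rep_ell2 (f T x) n = app T (Rep_ell2 x n)" for T x n
    by (simp add: f_def Rep_Abs_ell2 summable_app_ell2)
  obtain S where S: "app S = f T"
  proof (rule bop_of_adjoint_pair)
    show "cinner (f T x) y = cinner x (f (adj T) y)" for x y
      by (simp add: cinner_ell2.rep_eq f cinner_app_left)
    show "norm (f T x) \<le> norm T * norm x" for x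
      using suminf_app_ell2_le[of T x] by - (rule power2_le_imp_le, simp_all add: norm_ell2_sq f)
  qed
  have "amp T = S"
    unfolding amp_def
  proof (rule the_equality)
    show "\<forall>x n. Rep_ell2 (app S x) n = app T (Rep_ell2 x n)" by (simp add: S f)
    show "S' = S" if "\<forall>x n. Rep_ell2 (app S' x) n = app T (Rep_ell2 x n)" for S'
      using that by (intro bop_eqI ell2_eqI) (simp add: S f)
  qed
  then show ?thesis by (simp add: S f)
qed

lemma amp_add: "amp (S + T) = amp S + amp T"
  and amp_mult: "amp (S * T) = amp S * amp T"
  and amp_one: "amp 1 = 1"
  and amp_zero: "amp 0 = 0"
  by (intro bop_eqI ell2_eqI;
      simp add: Rep_amp app_simps plus_ell2.rep_eq zero_ell2.rep_eq)+

lemma adj_amp: "adj (amp T) = amp (adj T)"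
  by (rule adjI) (simp add: cinner_ell2.rep_eq Rep_amp cinner_app_left)

lemma summable_norm_cinner_ell2: "summable (\<lambda>n. norm (cinner (Rep_ell2 x n) (Rep_ell2 y n)))"
proof (rule summable_comparison_test'[where N = 0])
  show "summable (\<lambda>n. (norm (Rep_ell2 x n))\<^sup>2 + (norm (Rep_ell2 y n))\<^sup>2)"
    by (intro summable_add summable_Rep_ell2)
  fix n
  show "norm (norm (cinner (Rep_ell2 x n) (Rep_ell2 y n)))
      \<le> (norm (Rep_ell2 x n))\<^sup>2 + (norm (Rep_ell2 y n))\<^sup>2"
    using cmod_cinner_le[of "Rep_ell2 x n" "Rep_ell2 y n"]
      sum_squares_bound[of "norm (Rep_ell2 x n)" "norm (Rep_ell2 y n)"]
      mult_nonneg_nonneg[OF norm_ge_zero norm_ge_zero, of "Rep_ell2 x n" "Rep_ell2 y n"]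
    unfolding real_norm_def abs_norm_cancel by linarith
qed

lemma sums_bij_reindex:
  fixes f :: "nat \<Rightarrow> 'a::banach"
  assumes "summable (\<lambda>n. norm (f n))" "bij \<tau>"
  shows "(\<lambda>n. f (\<tau> n)) sums suminf f"
proof -
  have "(f has_sum suminf f) UNIV"
    by (rule norm_summable_imp_has_sum[OF assms(1) summable_sums[OF summable_norm_cancel[OF assms(1)]]])
  then have "((\<lambda>n. f (\<tau> n)) has_sum suminf f) UNIV"
    using has_sum_reindex_bij_betw[of \<tau> UNIV UNIV f] assms(2) by simp
  then show ?thesis by (rule has_sum_imp_sums)
qed

definition perm_op :: "(nat \<Rightarrow> nat) \<Rightarrow> 'a::complex_hilbert ell2 bop" where
  "perm_op \<tau> = (THE S. \<forall>x n. Rep_ell2 (app S x) n = Rep_ell2 x (\<tau> n))"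

lemma bij_if_inverse: "bij \<tau>" if "\<And>n. \<tau> (\<sigma> n) = n" "\<And>n. \<sigma> (\<tau> n) = n"
  using that by (metis bijI injI surjI)

lemma perm_op:
  fixes x :: "'a::complex_hilbert ell2"
  assumes ts: "\<And>n. \<tau> (\<sigma> n) = n" and st: "\<And>n. \<sigma> (\<tau> n) = n"
  shows Rep_perm_op: "Rep_ell2 (app (perm_op \<tau>) x) n = Rep_ell2 x (\<tau> n)"
    and Rep_adj_perm_op: "Rep_ell2 (app (adj (perm_op \<tau>)) x) n = Rep_ell2 x (\<sigma> n)"
proof -
  have bt: "bij \<tau>" and bs: "bij \<sigma>" using bij_if_inverse ts st by metis+
  define f where "f \<rho> x = Abs_ell2 (\<lambda>n. Rep_ell2 x (\<rho> n))" for \<rho> and x :: "'a ell2"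
  have sums: "(\<lambda>n. (norm (Rep_ell2 x (\<rho> n)))\<^sup>2) sums (norm x)\<^sup>2" if "bij \<rho>" for \<rho> and x :: "'a ell2"
    using sums_bij_reindex[of "\<lambda>n. (norm (Rep_ell2 x n))\<^sup>2" \<rho>] that summable_Rep_ell2[of x]
    by (simp add: norm_ell2_sq)
  have f: "Rep_ell2 (f \<rho> x) n = Rep_ell2 x (\<rho> n)" if "bij \<rho>" for \<rho> n and x :: "'a ell2"
    using sums[OF that, of x] by (simp add: f_def Rep_Abs_ell2 sums_iff)
  have adj: "cinner (f \<tau> x) y = cinner x (f \<sigma> y)" for x y :: "'a ell2"
    using sums_bij_reindex[OF summable_norm_cinner_ell2[of x "f \<sigma> y"] bt]
    by (simp add: cinner_ell2.rep_eq f bt bs st sums_iff)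
  obtain S where S: "app S = f \<tau>"
  proof (rule bop_of_adjoint_pair)
    show "norm (f \<tau> x) \<le> 1 * norm x" for x :: "'a ell2"
      using sums[OF bt, of x] by - (rule power2_le_imp_le, simp_all add: norm_ell2_sq f bt sums_iff)
  qed (rule adj)
  have "perm_op \<tau> = S"
    unfolding perm_op_def
  proof (rule the_equality)
    show "\<forall>x n. Rep_ell2 (app S x) n = Rep_ell2 x (\<tau> n)" by (simp add: S f bt)
    show "S' = S" if "\<forall>x n. Rep_ell2 (app S' x) n = Rep_ell2 x (\<tau> n)" for S'
      using that by (intro bop_eqI ell2_eqI) (simp add: S f bt)
  qed
  then show "Rep_ell2 (app (perm_op \<tau>) x) n = Rep_ell2 x (\<tau> n)" by (simp add: S f bt)
  have "cinner z (app (adj (perm_op \<tau>)) x) = cinner z (f \<sigma> x)" for z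
    using \<open>perm_op \<tau> = S\<close> adj[of z x] S by (simp add: cinner_app_left[symmetric])
  then have "app (adj (perm_op \<tau>)) x = f \<sigma> x"
    by (intro cinner_eqI) (metis cinner_commute)
  then show "Rep_ell2 (app (adj (perm_op \<tau>)) x) n = Rep_ell2 x (\<sigma> n)" by (simp add: f bs)
qed

definition of_coeff :: "'a::complex_hilbert ell2 \<Rightarrow> 'a hardy" where
  "of_coeff a = (SOME f. hardy_coeff f = a)"

lemma hardy_coeff_of_coeff [simp]: "hardy_coeff (of_coeff a) = a"
  unfolding of_coeff_def by (rule someI_ex) (rule hardy_coeff_surj)

abbreviation hcoeff :: "'a::complex_hilbert hardy \<Rightarrow> nat \<Rightarrow> 'a" where
  "hcoeff f \<equiv> Rep_ell2 (hardy_coeff f)"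

lemma hardy_eqI: "(\<And>n. hcoeff f n = hcoeff g n) \<Longrightarrow> f = g"
  by (simp add: hardy_coeff_inject[symmetric] ell2_eqI)

definition hardy_amp :: "'a::complex_hilbert bop \<Rightarrow> 'a hardy bop" where
  "hardy_amp T = (THE S. \<forall>f. hardy_coeff (app S f) = app (amp T) (hardy_coeff f))"

lemma hardy_coeff_hardy_amp: "hardy_coeff (app (hardy_amp T) f) = app (amp T) (hardy_coeff f)"
proof -
  define h where "h T f = of_coeff (app (amp T) (hardy_coeff f))" for T :: "'a bop" and f
  obtain S where S: "app S = h T"
  proof (rule bop_of_adjoint_pair)
    show "cinner (h T f) g = cinner f (h (adj T) g)" for f g
      by (simp add: h_def cinner_hardy_def cinner_app_left adj_amp)
    show "norm (h T f) \<le> norm (amp T) * norm f" for f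
      using norm_app_le[of "amp T" "hardy_coeff f"] by (simp add: h_def norm_hardy_coeff[symmetric])
  qed
  have "hardy_amp T = S"
    unfolding hardy_amp_def
  proof (rule the_equality)
    show "\<forall>f. hardy_coeff (app S f) = app (amp T) (hardy_coeff f)" by (simp add: S h_def)
    show "S' = S" if "\<forall>f. hardy_coeff (app S' f) = app (amp T) (hardy_coeff f)" for S'
      using that by (intro bop_eqI) (simp add: S h_def hardy_coeff_inject[symmetric])
  qed
  then show ?thesis by (simp add: S h_def)
qed

lemma hcoeff_hardy_amp: "hcoeff (app (hardy_amp T) f) n = app T (hcoeff f n)"
  by (simp add: hardy_coeff_hardy_amp Rep_amp)

lemma hardy_amp_add: "hardy_amp (S + T) = hardy_amp S + hardy_amp T"
  and hardy_amp_mult: "hardy_amp (S * T) = hardy_amp S * hardy_amp T"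
  and hardy_amp_one: "hardy_amp 1 = 1"
  and hardy_amp_zero: "hardy_amp 0 = 0"
  by (intro bop_eqI hardy_eqI;
      simp add: hcoeff_hardy_amp app_simps hardy_coeff_add hardy_coeff_zero plus_ell2.rep_eq zero_ell2.rep_eq)+

lemma adj_hardy_amp: "adj (hardy_amp T) = hardy_amp (adj T)"
  by (rule adjI) (simp add: cinner_hardy_def hardy_coeff_hardy_amp cinner_app_left adj_amp)

text \<open>Multiplication by \<open>A + z B\<close> maps the coefficients \<open>f\<^sub>n\<close> to \<open>A f\<^sub>n + B f\<^sub>n\<^sub>-\<^sub>1\<close>; in particular the product
is again in the Hardy space.\<close>

lemma hcoeff_toeplitz_pencil:
  "hcoeff (toeplitz (\<lambda>z x. app A x + z *\<^sub>C app B x) f) n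
    = app A (hcoeff f n) + (case n of 0 \<Rightarrow> 0 | Suc m \<Rightarrow> app B (hcoeff f m))"
proof -
  define g where "g z = (if cmod z < 1 then app A (Rep_hardy f z) + z *\<^sub>C app B (Rep_hardy f z) else 0)" for z
  define s where "s n = (case n of 0 \<Rightarrow> 0 | Suc m \<Rightarrow> app B (hcoeff f m))" for n
  have "summable (\<lambda>n. (norm (s (Suc n)))\<^sup>2)" by (simp add: s_def summable_app_ell2)
  then have "summable (\<lambda>n. (norm (s n))\<^sup>2)" by (subst (asm) summable_Suc_iff)
  then have sm: "summable (\<lambda>n. (norm (app A (hcoeff f n) + s n))\<^sup>2)"
    by (intro summable_sq_add summable_app_ell2)
  define b where "b = Abs_ell2 (\<lambda>n. app A (hcoeff f n) + s n)"
  have b: "Rep_ell2 b n = app A (hcoeff f n) + s n" for n by (simp add: b_def Rep_Abs_ell2 sm)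
  have "is_taylor b g"
    unfolding is_taylor_def
  proof (intro allI conjI impI)
    fix z :: complex assume z: "cmod z < 1"
    have tf: "(\<lambda>n. z ^ n *\<^sub>C hcoeff f n) sums Rep_hardy f z"
      using is_taylor_hardy_coeff[of f] z by (simp add: is_taylor_def)
    have app: "(\<lambda>n. z ^ n *\<^sub>C app T (hcoeff f n)) sums app T (Rep_hardy f z)" for T
      using bounded_linear.sums[OF bounded_linear_app[of T] tf] by (simp add: app_scaleC_right)
    have "(\<lambda>n. z ^ Suc n *\<^sub>C s (Suc n)) sums (z *\<^sub>C app B (Rep_hardy f z))"
      using bounded_linear.sums[OF bounded_linear_scaleC[of z] app[of B]]
      by (simp add: s_def scaleC_scaleC)
    then have "(\<lambda>n. z ^ n *\<^sub>C s n) sums (z *\<^sub>C app B (Rep_hardy f z))"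
      by (subst (asm) sums_Suc_iff) (simp add: s_def)
    from sums_add[OF app[of A] this]
    show "(\<lambda>n. z ^ n *\<^sub>C Rep_ell2 b n) sums g z"
      using z by (simp add: b g_def scaleC_add_right)
  qed (simp add: g_def)
  moreover from this have "Rep_hardy (Abs_hardy g) = g" by (intro Abs_hardy_inverse) auto
  ultimately have "hardy_coeff (Abs_hardy g) = b" by (intro hardy_coeffI) simp
  moreover have "toeplitz (\<lambda>z x. app A x + z *\<^sub>C app B x) f = Abs_hardy g"
    unfolding toeplitz_def g_def by simp
  ultimately show ?thesis by (simp add: b s_def)
qed

section \<open>The unitary extension\<close>

text \<open>The natural numbers are used as names of the integers, \<open>2 k\<close> for \<open>k\<close> and \<open>2 k + 1\<close> for \<open>- k - 1\<close>, and
\<open>shift_index\<close> is the predecessor map of the integers under these names. So sequences indexed by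
natural numbers carry a bilateral shift.\<close>

definition shift_index :: "nat \<Rightarrow> nat" where
  "shift_index n = (if n = 0 then 1 else if even n then n - 2 else n + 2)"

definition unshift_index :: "nat \<Rightarrow> nat" where
  "unshift_index n = (if n = 1 then 0 else if even n then n + 2 else n - 2)"

lemma shift_unshift: "shift_index (unshift_index n) = n"
  by (auto simp: shift_index_def unshift_index_def) presburger+

lemma unshift_shift: "unshift_index (shift_index n) = n"
  by (auto simp: shift_index_def unshift_index_def) presburger+

definition bilateral_shift :: "'a::complex_hilbert ell2 bop" where
  "bilateral_shift = perm_op shift_index"

lemmas Rep_bilateral_shift = Rep_perm_op[OF shift_unshift unshift_shift, folded bilateral_shift_def]
lemmas Rep_adj_bilateral_shift =
  Rep_adj_perm_op[OF shift_unshift unshift_shift, folded bilateral_shift_def]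

lemma bilateral_shift_unitary:
  "adj bilateral_shift * bilateral_shift = 1" "bilateral_shift * adj bilateral_shift = 1"
  by (intro bop_eqI ell2_eqI;
      simp add: app_mult Rep_bilateral_shift Rep_adj_bilateral_shift shift_unshift unshift_shift)+

lemma comm_bilateral_shift: "comm (amp T) bilateral_shift" "comm (amp T) (adj bilateral_shift)"
  unfolding comm_def
  by (intro bop_eqI ell2_eqI;
      simp add: app_mult Rep_amp Rep_bilateral_shift Rep_adj_bilateral_shift)+

text \<open>Multiplication by \<open>A + z B\<close> on bilateral sequences, acting on every entry as well as by the
bilateral shift in place of \<open>z\<close>. The entries are taken in the Hardy space, as the unitary extension
has to act on a space of sequences over the space of the isometry; vectors of the coefficient
space enter as constant functions.\<close>

definition laurent_pencil :: "'a::complex_hilbert bop \<Rightarrow> 'a bop \<Rightarrow> 'a hardy ell2 bop" where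
  "laurent_pencil A B = amp (hardy_amp A) + amp (hardy_amp B) * bilateral_shift"

lemma comm_amp: "comm S T \<Longrightarrow> comm (amp (hardy_amp S)) (amp (hardy_amp T))"
  by (simp add: comm_def amp_mult[symmetric] hardy_amp_mult[symmetric])

lemma comm_laurent_pencil:
  assumes "comm A C" "comm A D" "comm B C" "comm B D"
  shows "comm (laurent_pencil A B) (laurent_pencil C D)"
proof -
  have "comm (amp (hardy_amp X)) (laurent_pencil C D)" if "comm X C" "comm X D" for X
    unfolding laurent_pencil_def by (intro comm_add comm_mult comm_amp comm_bilateral_shift that)
  moreover have "comm bilateral_shift (laurent_pencil C D)"
    unfolding laurent_pencil_def
    by (intro comm_add comm_mult comm_refl comm_sym[OF comm_bilateral_shift(1)])
  ultimately show ?thesis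
    using assms unfolding laurent_pencil_def[of A B]
    by (intro comm_sym[OF comm_add] comm_mult) (auto intro: comm_sym)
qed

lemma adj_laurent_pencil:
  "adj (laurent_pencil A B) = amp (hardy_amp (adj A)) + amp (hardy_amp (adj B)) * adj bilateral_shift"
  using comm_bilateral_shift(2)[of "hardy_amp (adj B)"]
  by (simp add: laurent_pencil_def adj_amp adj_hardy_amp comm_def)

lemma comm_adj_laurent_pencil:
  assumes "comm A (adj C)" "comm A (adj D)" "comm B (adj C)" "comm B (adj D)"
  shows "comm (laurent_pencil A B) (adj (laurent_pencil C D))"
proof -
  have "comm (amp (hardy_amp X)) (adj (laurent_pencil C D))" if "comm X (adj C)" "comm X (adj D)" for X
    unfolding adj_laurent_pencil by (intro comm_add comm_mult comm_amp comm_bilateral_shift that)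
  moreover have "comm bilateral_shift (adj (laurent_pencil C D))"
    unfolding adj_laurent_pencil
    by (intro comm_add comm_mult comm_sym[OF comm_bilateral_shift(1)])
      (simp add: comm_def bilateral_shift_unitary)
  ultimately show ?thesis
    using assms unfolding laurent_pencil_def[of A B]
    by (intro comm_sym[OF comm_add] comm_mult) (auto intro: comm_sym)
qed

lemma adj_laurent_pencil_mult:
  "adj (laurent_pencil A B) * laurent_pencil C D
    = amp (hardy_amp (adj A * C + adj B * D)) + amp (hardy_amp (adj A * D)) * bilateral_shift
      + amp (hardy_amp (adj B * C)) * adj bilateral_shift"
proof -
  let ?p = "\<lambda>X. amp (hardy_amp X)"
  have c: "adj bilateral_shift * ?p X = ?p X * adj bilateral_shift" for X
    using comm_bilateral_shift(2)[of "hardy_amp X"] by (simp add: comm_def)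
  have "?p (adj B) * adj bilateral_shift * (?p D * bilateral_shift)
      = ?p (adj B) * (adj bilateral_shift * ?p D) * bilateral_shift"
    by (simp add: mult.assoc)
  also have "\<dots> = ?p (adj B) * ?p D * (adj bilateral_shift * bilateral_shift)"
    unfolding c by (simp add: mult.assoc)
  finally have 1: "?p (adj B) * adj bilateral_shift * (?p D * bilateral_shift) = ?p (adj B * D)"
    by (simp add: bilateral_shift_unitary amp_mult hardy_amp_mult)
  have 2: "?p (adj B) * adj bilateral_shift * ?p C = ?p (adj B * C) * adj bilateral_shift"
    by (simp add: mult.assoc c amp_mult hardy_amp_mult)
  show ?thesis
    unfolding adj_laurent_pencil unfolding laurent_pencil_def distrib_left distrib_right 1 2
    by (simp add: amp_mult hardy_amp_mult amp_add hardy_amp_add mult.assoc add_ac)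
qed

definition ell2_single :: "'a::complex_hilbert \<Rightarrow> 'a ell2" where
  "ell2_single v = Abs_ell2 (\<lambda>n. if n = 0 then v else 0)"

lemma summable_single: "summable (\<lambda>n. (norm (if n = (0::nat) then v else 0))\<^sup>2)"
  by (rule summable_finite[of "{0}"]) auto

lemma Rep_ell2_single: "Rep_ell2 (ell2_single v) n = (if n = 0 then v else 0)"
  by (simp add: ell2_single_def Rep_Abs_ell2 summable_single)

definition hardy_const :: "'a::complex_hilbert \<Rightarrow> 'a hardy" where
  "hardy_const v = of_coeff (ell2_single v)"

lemma hcoeff_hardy_const: "hcoeff (hardy_const v) n = (if n = 0 then v else 0)"
  by (simp add: hardy_const_def Rep_ell2_single)

lemma hardy_const_add: "hardy_const (v + w) = hardy_const v + hardy_const w"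
  and hardy_const_scaleC: "hardy_const (c *\<^sub>C v) = c *\<^sub>C hardy_const v"
  and hardy_const_zero [simp]: "hardy_const 0 = 0"
  and hardy_amp_const: "app (hardy_amp T) (hardy_const v) = hardy_const (app T v)"
  by (rule hardy_eqI; simp add: hcoeff_hardy_const hcoeff_hardy_amp hardy_coeff_add hardy_coeff_scaleC
      hardy_coeff_zero plus_ell2.rep_eq scaleC_ell2.rep_eq zero_ell2.rep_eq)+

lemma norm_hardy_const [simp]: "norm (hardy_const v) = norm v"
proof -
  have "(norm (hardy_const v))\<^sup>2 = (\<Sum>n. (norm (if n = (0::nat) then v else 0))\<^sup>2)"
    unfolding norm_hardy_coeff[symmetric] norm_ell2_sq by (simp add: hcoeff_hardy_const)
  also have "\<dots> = (norm v)\<^sup>2" by (subst suminf_finite[of "{0}"]) auto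
  finally show ?thesis by (simp add: power2_eq_iff_nonneg)
qed

text \<open>The inclusion of one-sided into bilateral sequences: the coefficients go to the even indices,
which stand for the nonnegative integers.\<close>

definition spread :: "'a::complex_hilbert hardy \<Rightarrow> 'a hardy ell2" where
  "spread f = Abs_ell2 (\<lambda>n. if even n then hardy_const (hcoeff f (n div 2)) else 0)"

lemma Rep_spread: "Rep_ell2 (spread f) n = (if even n then hardy_const (hcoeff f (n div 2)) else 0)"
  and norm_spread: "norm (spread f) = norm f"
proof -
  define s where "s n = (norm (if even n then hardy_const (hcoeff f (n div 2)) else 0))\<^sup>2" for n
  have sm: "strict_mono (\<lambda>n::nat. 2 * n)" by (simp add: strict_mono_def)
  have zero: "s n = 0" if "n \<notin> range (\<lambda>n. 2 * n)" for n
    using that by (auto simp: s_def elim!: evenE)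
  have s: "(\<lambda>n. s (2 * n)) = (\<lambda>n. (norm (hcoeff f n))\<^sup>2)" by (simp add: s_def)
  have "summable s"
    using summable_mono_reindex[of "\<lambda>n. 2 * n" s, OF sm zero] summable_Rep_ell2[of "hardy_coeff f"] by (simp add: s)
  then show R: "Rep_ell2 (spread f) n = (if even n then hardy_const (hcoeff f (n div 2)) else 0)" for n
    unfolding spread_def s_def by (simp add: Rep_Abs_ell2)
  have "(norm (spread f))\<^sup>2 = suminf s" unfolding norm_ell2_sq R s_def by simp
  also have "\<dots> = (norm f)\<^sup>2"
    using suminf_mono_reindex[of "\<lambda>n. 2 * n" s, OF sm zero] by (simp add: s norm_ell2_sq norm_hardy_coeff[symmetric])
  finally show "norm (spread f) = norm f" by (simp add: power2_eq_iff_nonneg)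
qed

lemma spread_add: "spread (f + g) = spread f + spread g"
  and spread_scaleC: "spread (c *\<^sub>C f) = c *\<^sub>C spread f"
  by (rule ell2_eqI; simp add: Rep_spread hardy_coeff_add hardy_coeff_scaleC plus_ell2.rep_eq
      scaleC_ell2.rep_eq hardy_const_add hardy_const_scaleC)+

lemma laurent_pencil_spread:
  "app (laurent_pencil A B) (spread f) = spread (toeplitz (\<lambda>z x. app A x + z *\<^sub>C app B x) f)"
proof (rule ell2_eqI)
  fix n
  show "Rep_ell2 (app (laurent_pencil A B) (spread f)) n
      = Rep_ell2 (spread (toeplitz (\<lambda>z x. app A x + z *\<^sub>C app B x) f)) n"
  proof (cases "even n")
    case True
    then obtain k where n: "n = 2 * k" by (auto elim: evenE)
    show ?thesis
      by (cases k) (auto simp: n laurent_pencil_def app_simps plus_ell2.rep_eq Rep_amp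
          Rep_bilateral_shift shift_index_def Rep_spread hardy_amp_const hardy_const_add
          hcoeff_toeplitz_pencil)
  next
    case False
    then have "odd (shift_index n)" by (auto simp: shift_index_def)
    with False show ?thesis
      by (simp add: laurent_pencil_def app_simps plus_ell2.rep_eq Rep_amp Rep_bilateral_shift Rep_spread)
  qed
qed

text \<open>Boundedness, linearity and commutation of the \<open>Ts\<close> are inherited from the extension \<open>Us\<close>, as \<open>V\<close> is
injective.\<close>

lemma hexablock_isometryI:
  fixes Ts :: "('a::complex_hilbert \<Rightarrow> 'a) list" and V :: "'a \<Rightarrow> 'a ell2"
  assumes U: "hexablock_unitary_on UNIV Us" and len: "length Ts = 4"
    and V: "\<And>x y. V (x + y) = V x + V y" "\<And>c x. V (c *\<^sub>C x) = c *\<^sub>C V x" "\<And>x. norm (V x) = norm x"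
    and UV: "\<And>i x. i < 4 \<Longrightarrow> (Us ! i) (V x) = V ((Ts ! i) x)"
  shows "hexablock_isometry Ts"
proof -
  have Vinj: "x = y" if "V x = V y" for x y
  proof -
    have "V (x - y) + V y = V y" using V(1)[of "x - y" y] that by simp
    then have "norm (x - y) = 0" using V(3)[of "x - y"] by simp
    then show ?thesis by simp
  qed
  have lenU: "length Us = 4" and Us: "operator_on UNIV (Us ! i)" "commute_on UNIV (Us ! i) (Us ! j)"
    if "i < 4" "j < 4" for i j
    using U that by (auto simp: hexablock_unitary_on_def commuting_operators_def)
  have "operator_on UNIV (Ts ! i)" if i: "i < 4" for i
    unfolding operator_on_def
  proof (intro conjI ballI allI)
    note op = Us(1)[OF i i, unfolded operator_on_def]
    show "(Ts ! i) (x + y) = (Ts ! i) x + (Ts ! i) y" for x y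
      by (rule Vinj) (use op in \<open>simp add: V(1) UV[OF i, symmetric]\<close>)
    show "(Ts ! i) (c *\<^sub>C x) = c *\<^sub>C (Ts ! i) x" for c x
      by (rule Vinj) (use op in \<open>simp add: V(2) UV[OF i, symmetric]\<close>)
    obtain B where "\<And>x. norm ((Us ! i) x) \<le> B * norm x" using op by auto
    then have "norm ((Ts ! i) x) \<le> B * norm x" for x by (metis UV[OF i] V(3))
    then show "\<exists>B. \<forall>x\<in>UNIV. norm ((Ts ! i) x) \<le> B * norm x" by auto
  qed simp
  moreover have "commute_on UNIV (Ts ! i) (Ts ! j)" if "i < 4" "j < 4" for i j
    unfolding commute_on_def
  proof
    show "(Ts ! i) ((Ts ! j) x) = (Ts ! j) ((Ts ! i) x)" for x
      by (rule Vinj) (use Us(2)[OF that] that in \<open>simp add: UV[symmetric] commute_on_def\<close>)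
  qed
  ultimately have "commuting_operators UNIV Ts"
    using len by (auto simp: commuting_operators_def in_set_conv_nth)
  moreover have "closed_csubspace (UNIV :: 'a ell2 set)" by (simp add: closed_csubspace_def)
  ultimately show ?thesis unfolding hexablock_isometry_def using len U V UV by blast
qed

section \<open>Purity\<close>

lemma hcoeff_toeplitz_shift:
  "hcoeff (toeplitz (\<lambda>z x. z *\<^sub>C x) f) n = (case n of 0 \<Rightarrow> 0 | Suc m \<Rightarrow> hcoeff f m)"
  using hcoeff_toeplitz_pencil[of 0 1 f n] by (simp split: nat.split)

lemma cinner_toeplitz_shift:
  "cinner (toeplitz (\<lambda>z x. z *\<^sub>C x) f) (toeplitz (\<lambda>z x. z *\<^sub>C x) g) = cinner f g"
  using suminf_split_head[OF summable_norm_cancel[OF summable_norm_cinner_ell2], of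
      "hardy_coeff (toeplitz (\<lambda>z x. z *\<^sub>C x) f)" "hardy_coeff (toeplitz (\<lambda>z x. z *\<^sub>C x) g)"]
  by (simp add: cinner_hardy_def cinner_ell2.rep_eq hcoeff_toeplitz_shift)

text \<open>Multiplication by \<open>z\<close> is isometric, so if it is normal on \<open>M\<close> it maps \<open>M\<close> onto \<open>M\<close>. Hence every element
of \<open>M\<close> is divisible by all powers of \<open>z\<close>.\<close>

lemma normal_on_toeplitz_shift_trivial:
  assumes M: "closed_csubspace M" and N: "normal_on M (toeplitz (\<lambda>z x. z *\<^sub>C x))"
  shows "M = {0}"
proof -
  let ?T = "toeplitz (\<lambda>z x. z *\<^sub>C x)"
  obtain S where S: "operator_on M S" "\<And>x y. x \<in> M \<Longrightarrow> y \<in> M \<Longrightarrow> cinner (?T x) y = cinner x (S y)"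
    "\<And>x. x \<in> M \<Longrightarrow> S (?T x) = ?T (S x)" and T: "operator_on M ?T"
    using N by (auto simp: normal_on_def adjoint_on_def commute_on_def)
  have sub: "subspace M" using M by (simp add: closed_csubspace_def)
  have onto: "x = ?T (S x)" "S x \<in> M" if x: "x \<in> M" for x
  proof -
    have TM: "?T x \<in> M" and STM: "S (?T x) \<in> M" using T S(1) x by (auto simp: operator_on_def)
    define d where "d = S (?T x) - x"
    have d: "d \<in> M" using sub STM x by (simp add: d_def subspace_diff)
    \<comment> \<open>Here \<open>S T\<close> is the identity on \<open>M\<close> since \<open>T\<close> is isometric.\<close>
    have "cinner d (S (?T x)) = cinner d x"
      using S(2)[OF d TM] by (simp add: cinner_toeplitz_shift)
    then have "cinner d d = 0" by (simp add: d_def cinner_diff_right)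
    then have "d = 0" by (simp add: cinner_self)
    then show "x = ?T (S x)" using S(3)[OF x] by (simp add: d_def)
    show "S x \<in> M" using S(1) x by (simp add: operator_on_def)
  qed
  have "hcoeff x n = 0" if "x \<in> M" for x n
    using that
  proof (induction n arbitrary: x)
    case 0
    then show ?case using onto[OF 0] hcoeff_toeplitz_shift[of "S x" 0] by simp
  next
    case (Suc n)
    then show ?case using onto[OF Suc.prems] hcoeff_toeplitz_shift[of "S x" "Suc n"] by simp
  qed
  then have "M \<subseteq> {0}" by (auto intro!: hardy_eqI simp: hardy_coeff_zero zero_ell2.rep_eq)
  then show ?thesis using sub by (auto simp: subspace_0)
qed

section \<open>Existence of the pure isometry\<close>

lemma normal_operator_as_bop:
  assumes "normal_on UNIV F"
  obtains T where "app T = F" "comm T (adj T)" "cadjoint F = app (adj T)"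
proof -
  obtain S where S: "operator_on UNIV F" "adjoint_on UNIV F S" "commute_on UNIV S F"
    using assms by (auto simp: normal_on_def)
  obtain B where B: "\<And>x. norm (F x) \<le> B * norm x" using S(1) by (auto simp: operator_on_def)
  obtain T where T: "app T = F"
    by (rule bop_of_adjoint_pair[of F S B]) (use S(2) B in \<open>auto simp: adjoint_on_def\<close>)
  have uniq: "S' = app (adj T)" if "adjoint_on UNIV F S'" for S'
  proof
    fix y
    have "cinner x (S' y) = cinner x (app (adj T) y)" for x
      using that by (simp add: adjoint_on_def cinner_app_left[symmetric] T)
    then show "S' y = app (adj T) y" by (intro cinner_eqI) (metis cinner_commute)
  qed
  have "cadjoint F = app (adj T)"
    unfolding cadjoint_def
  proof (rule the_equality)
    show "adjoint_on UNIV F (app (adj T))" using adjoint_on_app[of T] by (simp only: T)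
  qed (rule uniq)
  moreover have "comm T (adj T)"
    unfolding comm_def
    by (rule bop_eqI) (use S(3) uniq[OF S(2)] in \<open>simp add: app_mult T commute_on_def\<close>)
  ultimately show ?thesis using that T by blast
qed

definition star_comm :: "'a::complex_hilbert bop \<Rightarrow> 'a bop \<Rightarrow> bool" where
  "star_comm S T \<longleftrightarrow> comm S T \<and> comm S (adj T)"

lemma star_comm_sym: "star_comm S T \<Longrightarrow> star_comm T S"
  using comm_adj[of S T] comm_adj[of S "adj T"] by (auto simp: star_comm_def intro: comm_sym)

lemma star_comm_adj: "star_comm S (adj T) \<longleftrightarrow> star_comm S T"
  by (auto simp: star_comm_def)

lemma star_comm_adj_left: "star_comm (adj S) T \<longleftrightarrow> star_comm S T"
  by (metis star_comm_adj star_comm_sym)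

theorem theorem4p15:
  fixes F1 F2 :: "'a::complex_hilbert \<Rightarrow> 'a"
  assumes "normal_on UNIV F1" and "normal_on UNIV F2" and "commute_on UNIV F1 F2"
    and "(SUP z\<in>cball 0 1. onorm (\<lambda>x. cadjoint F1 x + z *\<^sub>C F2 x)) \<le> 1"
  shows "\<exists>G0 G1. operator_on UNIV G0 \<and> operator_on UNIV G1 \<and>
    pure_hexablock_isometry
      [toeplitz (\<lambda>z x. G0 x + z *\<^sub>C G1 x),
       toeplitz (\<lambda>z x. cadjoint F1 x + z *\<^sub>C F2 x),
       toeplitz (\<lambda>z x. cadjoint F2 x + z *\<^sub>C F1 x),
       toeplitz (\<lambda>z x. z *\<^sub>C x)]"
proof -
  obtain f1 where f1: "app f1 = F1" "comm f1 (adj f1)" "cadjoint F1 = app (adj f1)"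
    using normal_operator_as_bop[OF assms(1)] .
  obtain f2 where f2: "app f2 = F2" "comm f2 (adj f2)" "cadjoint F2 = app (adj f2)"
    using normal_operator_as_bop[OF assms(2)] .
  have f12: "comm f1 f2"
    unfolding comm_def
    by (rule bop_eqI) (use assms(3) in \<open>simp add: app_mult f1 f2 commute_on_def\<close>)
  have pencil: "(\<lambda>x. cadjoint F1 x + z *\<^sub>C F2 x) = app (adj f1 + scal z * f2)" for z
    by (simp add: fun_eq_iff app_simps f1(3) f2(1))
  have bd: "norm (adj f1 + scal z * f2) \<le> 1" if z: "cmod z = 1" for z
  proof -
    have "norm (adj f1 + scal z * f2) \<le> norm f1 + norm f2" if "cmod z \<le> 1" for z
      using norm_triangle_ineq[of "adj f1" "scal z * f2"] mult_right_mono[OF that, of "norm f2"] by simp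
    then have "bdd_above ((\<lambda>z. norm (adj f1 + scal z * f2)) ` cball 0 1)" by (intro bdd_aboveI2) simp
    then have "norm (adj f1 + scal z * f2) \<le> (SUP z\<in>cball 0 1. norm (adj f1 + scal z * f2))"
      by (rule cSUP_upper[rotated]) (use z in simp)
    also have "\<dots> \<le> 1" using assms(4) by (simp add: pencil norm_bop_eq_onorm)
    finally show ?thesis .
  qed
  obtain g0 g1 where g: "adj g0 * g0 + adj g1 * g1 + f1 * adj f1 + adj f2 * f2 = 1"
    "adj g0 * g1 + f1 * f2 = 0"
    and gC: "\<And>R. comm R f1 \<Longrightarrow> comm R (adj f1) \<Longrightarrow> comm R f2 \<Longrightarrow> comm R (adj f2) \<Longrightarrow> comm R g0 \<and> comm R g1"
    using spectral_factorization[OF f1(2) f2(2) f12 bd] by blast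
  have ff: "star_comm f1 f1" "star_comm f2 f2" "star_comm f1 f2"
    using f1(2) f2(2) f12 fuglede[OF f2(2) f12] by (simp_all add: star_comm_def comm_refl)
  note ff' = ff star_comm_sym[OF ff(3)]
  have gs: "star_comm R g0 \<and> star_comm R g1" if "star_comm R f1" "star_comm R f2" for R
  proof -
    have R: "comm R f1" "comm R (adj f1)" "comm R f2" "comm R (adj f2)"
      using that by (auto simp: star_comm_def)
    then have "comm (adj R) f1" "comm (adj R) (adj f1)" "comm (adj R) f2" "comm (adj R) (adj f2)"
      using comm_adj[of R f1] comm_adj[of R "adj f1"] comm_adj[of R f2] comm_adj[of R "adj f2"] by auto
    from gC[OF R] gC[OF this] show ?thesis
      using comm_adj[of "adj R" g0] comm_adj[of "adj R" g1] by (auto simp: star_comm_def)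
  qed
  have fg: "star_comm f1 g0" "star_comm f1 g1" "star_comm f2 g0" "star_comm f2 g1"
    using gs ff' by auto
  have gg: "star_comm g0 g0" "star_comm g0 g1" "star_comm g1 g0" "star_comm g1 g1"
    using gs fg[THEN star_comm_sym] by auto
  have const: "star_comm R 0" "star_comm R 1" for R
    by (auto simp: star_comm_def comm_zero comm_one)
  define A where "A = (\<lambda>i. [g0, adj f1, adj f2, 0] ! i)"
  define B where "B = (\<lambda>i. [g1, f2, f1, 1] ! i)"
  define N where "N i = laurent_pencil (A i) (B i)" for i
  \<comment> \<open>All coefficients commute with each other and with all adjoints, so the pencils do.\<close>
  have all: "star_comm X Y" if "X \<in> {f1, f2, adj f1, adj f2, g0, g1, 0, 1}" "Y \<in> {f1, f2, adj f1, adj f2, g0, g1, 0, 1}" for X Y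
    using that ff' fg gg const fg[THEN star_comm_sym] const[THEN star_comm_sym]
    by (auto simp: star_comm_adj star_comm_adj_left)
  have AB: "A i \<in> {f1, f2, adj f1, adj f2, g0, g1, 0, 1}" "B i \<in> {f1, f2, adj f1, adj f2, g0, g1, 0, 1}"
    if "i < 4" for i
    using that by (auto simp: A_def B_def less_Suc_eq numeral_eq_Suc)
  define Ts where "Ts = [toeplitz (\<lambda>z x. app g0 x + z *\<^sub>C app g1 x),
       toeplitz (\<lambda>z x. cadjoint F1 x + z *\<^sub>C F2 x),
       toeplitz (\<lambda>z x. cadjoint F2 x + z *\<^sub>C F1 x),
       toeplitz (\<lambda>z x. z *\<^sub>C x)]"
  have unitary: "hexablock_unitary_on UNIV (map (\<lambda>i. app (N i)) [0..<4])"
  proof (rule hexablock_unitaryI)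
    fix i j :: nat assume ij: "i < 4" "j < 4"
    show "comm (N i) (N j)"
      unfolding N_def using all AB[OF ij(1)] AB[OF ij(2)]
      by (intro comm_laurent_pencil) (auto simp only: star_comm_def)
    show "comm (N i) (adj (N j))"
      unfolding N_def using all AB[OF ij(1)] AB[OF ij(2)]
      by (intro comm_adj_laurent_pencil) (auto simp only: star_comm_def)
  next
    have g': "adj g1 * g0 + adj f2 * adj f1 = 0" using arg_cong[OF g(2), of adj] by simp
    show "N 1 = adj (N 2) * N 3"
      by (simp add: N_def A_def B_def adj_laurent_pencil_mult amp_zero hardy_amp_zero)
        (simp add: laurent_pencil_def)
    show "adj (N 3) * N 3 = 1"
      by (simp add: N_def A_def B_def adj_laurent_pencil_mult amp_zero hardy_amp_zero amp_one hardy_amp_one)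
    have "adj (N 0) * N 0 + adj (N 1) * N 1
        = amp (hardy_amp (adj g0 * g0 + adj g1 * g1 + f1 * adj f1 + adj f2 * f2))
          + amp (hardy_amp (adj g0 * g1 + f1 * f2)) * bilateral_shift
          + amp (hardy_amp (adj g1 * g0 + adj f2 * adj f1)) * adj bilateral_shift"
      by (simp add: N_def A_def B_def adj_laurent_pencil_mult amp_add hardy_amp_add distrib_right add_ac)
    then show "adj (N 0) * N 0 + adj (N 1) * N 1 = 1"
      unfolding g g' by (simp add: amp_zero hardy_amp_zero amp_one hardy_amp_one)
  qed
  have intertwines: "(map (\<lambda>i. app (N i)) [0..<4] ! i) (spread f) = spread ((Ts ! i) f)" if "i < 4" for i f
  proof -
    have "i \<in> {0, 1, 2, 3}" using that by auto
    then have "Ts ! i = toeplitz (\<lambda>z x. app (A i) x + z *\<^sub>C app (B i) x)"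
      by (auto simp: Ts_def A_def B_def f1 f2)
    then show ?thesis using that by (simp add: N_def laurent_pencil_spread)
  qed
  have "length Ts = 4" by (simp add: Ts_def)
  then have "hexablock_isometry Ts"
    by (rule hexablock_isometryI[OF unitary _ spread_add spread_scaleC norm_spread intertwines])
  moreover have "M = {0}" if "closed_csubspace M" "hexablock_unitary_on M Ts" for M
    using that normal_on_toeplitz_shift_trivial[of M]
    by (auto simp: hexablock_unitary_on_def Ts_def)
  ultimately have "pure_hexablock_isometry Ts" unfolding pure_hexablock_isometry_def by blast
  then show ?thesis unfolding Ts_def using operator_on_app by blast
qed

end
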